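(* Let $k\ge1$ and let $\mathbf{n}=(n_1,\dots,n_k)$ and $\mathbf{a}=(a_1,\dots,a_k)$ be $k$-tuples of positive integers. Then $T(\mathbf{n};\mathbf{a};4)$ is false if and only if, up to simultaneous permutation of the entries of $\mathbf{n}$ and $\mathbf{a}$, $(\mathbf{n};\mathbf{a})$ falls into one of the following cases: \begin{itemize} \item $k=1$, $\mathbf{n}=n$ with $n\ge4$ and $\mathbf{a}=2$; \item $\mathbf{n}=(n_1,n_2)$ with $4\le n_1\le n_2$ and $\mathbf{a}=(1,1)$; \item $\mathbf{n}=(1,2)$ and $\mathbf{a}=(2,2)$; \item $\mathbf{n}=(2,2,2)$ and $\mathbf{a}=(1,1,1)$; \item $\mathbf{n}=(1,2,n)$ with $n\ge4$ and $\mathbf{a}=(1,1,1)$; \item $\mathbf{n}=(2,2,1)$ and $\mathbf{a}=(1,1,2)$. \end{itemize}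
   Context: We work over $\mathbb{C}$. For $k$-tuples $\mathbf{n},\mathbf{a}$ of positive integers, $\mathbb{P}^{\mathbf{n}}=\prod_{i=1}^k\mathbb{P}^{n_i}$ and $N=\prod_{i=1}^k\binom{n_i+a_i}{a_i}=\dim H^0(\mathbb{P}^{\mathbf{n}},\mathcal{O}(\mathbf{a}))$. For a zero-dimensional subscheme $Z\subset\mathbb{P}^{\mathbf{n}}$ put $h_{\mathbb{P}^{\mathbf{n}}}(Z,\mathbf{a})=\dim H^0(\mathcal{O}(\mathbf{a}))-\dim H^0(\mathcal{I}_Z(\mathbf{a}))$. A double point $p^2$ is the subscheme with ideal sheaf $\mathcal{I}_p^2$. The statement $T(\mathbf{n};\mathbf{a};s)$ is true if, for $Z$ a collection of $s$ general double points of $\mathbb{P}^{\mathbf{n}}$, $h_{\mathbb{P}^{\mathbf{n}}}(Z,\mathbf{a})=\min\{s(1+\sum_{i=1}^k n_i),\ N\}$; otherwise it is false. Equivalently (Terracini's lemma), $T(\mathbf{n};\mathbf{a};s)$ is true iff the $s$-th secant variety of the Segre-Veronese variety $X_{\mathbf{n},\mathbf{a}}\subset\mathbb{P}^{N-1}$ ($\mathbb{P}^{\mathbf{n}}$ embedded by $\mathcal{O}(\mathbf{a})$) has the expected dimension $\min\{N-1,s(1+\sum_i n_i)-1\}$. *)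

theory Defs
  imports
    Complex_Main
    "HOL-Library.Poly_Mapping"
    "HOL-Combinatorics.Permutations"
    "HOL-Algebra.Ideal_Product"
begin

section \<open>Polynomials in doubly indexed variables\<close>

text \<open>
  A multiprojective space is given by a finite set \<open>B\<close> of blocks and a dimension function \<open>n\<close>;
  it is the product over \<open>i \<in> B\<close> of the projective spaces of dimension \<open>n i\<close>, whose homogeneous
  coordinates are the variables \<open>(i, 0), \<dots>, (i, n i)\<close>.  The block type is left arbitrary because
  both \<open>\<P>\<^sup>n\<close> itself and its \<open>s\<close>-fold power, the parameter space of \<open>s\<close>-tuples of points, are of
  this form.
\<close>

type_synonym 'b mpoly = "('b \<times> nat \<Rightarrow>\<^sub>0 nat) \<Rightarrow>\<^sub>0 complex"

definition vars :: "'b set \<Rightarrow> ('b \<Rightarrow> nat) \<Rightarrow> ('b \<times> nat) set" where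
  "vars B n = (SIGMA i:B. {..n i})"

definition eval_poly :: "'b mpoly \<Rightarrow> ('b \<times> nat \<Rightarrow> complex) \<Rightarrow> complex" where
  "eval_poly F x =
     (\<Sum>m\<in>Poly_Mapping.keys F.
        Poly_Mapping.lookup F m * (\<Prod>v\<in>Poly_Mapping.keys m. x v ^ Poly_Mapping.lookup m v))"

definition scale_poly :: "complex \<Rightarrow> 'b mpoly \<Rightarrow> 'b mpoly" where
  "scale_poly c F = Poly_Mapping.single 0 c * F"

global_interpretation poly_vs: vector_space scale_poly
  by unfold_locales
    (simp_all add: scale_poly_def algebra_simps single_add mult_single
      flip: mult.assoc)

definition coord_ring :: "'b set \<Rightarrow> ('b \<Rightarrow> nat) \<Rightarrow> 'b mpoly ring" where
  "coord_ring B n =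
     \<lparr>carrier = {F. \<forall>m\<in>Poly_Mapping.keys F. Poly_Mapping.keys m \<subseteq> vars B n},
      mult = (*), one = 1, zero = 0, add = (+)\<rparr>"

lemma cring_coord_ring: "cring (coord_ring B n)"
proof (rule cringI)
  let ?R = "coord_ring B n"
  have carr: "F \<in> carrier ?R \<longleftrightarrow>
      (\<forall>m\<in>Poly_Mapping.keys F. Poly_Mapping.keys m \<subseteq> vars B n)" for F
    by (simp add: coord_ring_def)
  have add: "F + G \<in> carrier ?R" if "F \<in> carrier ?R" "G \<in> carrier ?R" for F G
    using that Poly_Mapping.keys_add[of F G] unfolding carr by blast
  have mult: "F * G \<in> carrier ?R" if "F \<in> carrier ?R" "G \<in> carrier ?R" for F G
    unfolding carr
  proof
    fix m assume "m \<in> Poly_Mapping.keys (F * G)"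
    then obtain u v where "u \<in> Poly_Mapping.keys F" "v \<in> Poly_Mapping.keys G" "m = u + v"
      using Poly_Mapping.keys_mult[of F G] by blast
    with that show "Poly_Mapping.keys m \<subseteq> vars B n"
      using Poly_Mapping.keys_add[of u v] unfolding carr by blast
  qed
  have minus: "- F \<in> carrier ?R" if "F \<in> carrier ?R" for F
    using that unfolding carr by (simp add: in_keys_iff)
  have ops: "x \<otimes>\<^bsub>?R\<^esub> y = x * y" "x \<oplus>\<^bsub>?R\<^esub> y = x + y"
      "\<one>\<^bsub>?R\<^esub> = 1" "\<zero>\<^bsub>?R\<^esub> = 0" for x y
    by (simp_all add: coord_ring_def)
  show "abelian_group ?R"
  proof (rule abelian_groupI)
    show "\<exists>G\<in>carrier ?R. G \<oplus>\<^bsub>?R\<^esub> F = \<zero>\<^bsub>?R\<^esub>" if "F \<in> carrier ?R" for F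
      using minus[OF that] by (auto simp: ops intro!: bexI[of _ "- F"])
  qed (simp_all add: ops add carr[of 0] algebra_simps)
  show "comm_monoid ?R"
    by (rule comm_monoidI) (simp_all add: ops mult carr[of 1] algebra_simps)
  show "(x \<oplus>\<^bsub>?R\<^esub> y) \<otimes>\<^bsub>?R\<^esub> z = x \<otimes>\<^bsub>?R\<^esub> z \<oplus>\<^bsub>?R\<^esub> y \<otimes>\<^bsub>?R\<^esub> z" for x y z
    by (simp add: ops algebra_simps)
qed

text \<open>The multihomogeneous forms of multidegree \<open>d\<close>, that is, the global sections of \<open>\<O>(d)\<close>.\<close>

definition forms :: "'b set \<Rightarrow> ('b \<Rightarrow> nat) \<Rightarrow> ('b \<Rightarrow> nat) \<Rightarrow> 'b mpoly set" where
  "forms B n d =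
     {F \<in> carrier (coord_ring B n).
        \<forall>m\<in>Poly_Mapping.keys F. \<forall>i\<in>B. (\<Sum>j\<le>n i. Poly_Mapping.lookup m (i, j)) = d i}"

section \<open>Points, Zariski topology, ideal sheaves\<close>

text \<open>
  Points are represented by homogeneous coordinates: every block of coordinates is nonzero, and
  two such vectors represent the same point iff they agree up to a nonzero scalar in each block.
  Below, points are only tested by the (non)vanishing of multihomogeneous forms, which does not
  depend on the representative.
\<close>

definition points :: "'b set \<Rightarrow> ('b \<Rightarrow> nat) \<Rightarrow> ('b \<times> nat \<Rightarrow> complex) set" where
  "points B n =
     {x. (\<forall>i\<in>B. \<exists>j\<le>n i. x (i, j) \<noteq> 0) \<and> (\<forall>v. v \<notin> vars B n \<longrightarrow> x v = 0)}"

definition zariski_open ::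
    "'b set \<Rightarrow> ('b \<Rightarrow> nat) \<Rightarrow> ('b \<times> nat \<Rightarrow> complex) set \<Rightarrow> bool" where
  "zariski_open B n U \<longleftrightarrow>
     (\<exists>\<G>. \<G> \<subseteq> (\<Union>d. forms B n d) \<and> U = points B n - {x. \<forall>G\<in>\<G>. eval_poly G x = 0})"

definition point_ideal :: "'b set \<Rightarrow> ('b \<Rightarrow> nat) \<Rightarrow> ('b \<times> nat \<Rightarrow> complex) \<Rightarrow> 'b mpoly set" where
  "point_ideal B n x =
     Idl\<^bsub>coord_ring B n\<^esub> {G \<in> (\<Union>d. forms B n d). eval_poly G x = 0}"

definition double_point_ideal ::
    "'b set \<Rightarrow> ('b \<Rightarrow> nat) \<Rightarrow> ('b \<times> nat \<Rightarrow> complex) \<Rightarrow> 'b mpoly set" where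
  "double_point_ideal B n x =
     ideal_prod (coord_ring B n) (point_ideal B n x) (point_ideal B n x)"

text \<open>
  Let \<open>\<I>\<close> be the ideal sheaf associated with the multihomogeneous ideal \<open>I\<close>.  A form \<open>F\<close> of
  multidegree \<open>a\<close> is a global section of \<open>\<I>(a)\<close> iff near every point \<open>x\<close> it can be written as
  \<open>G / H\<close> with \<open>G \<in> I\<close> and \<open>H\<close> a form that does not vanish at \<open>x\<close>.
\<close>

definition ideal_sections ::
    "'b set \<Rightarrow> ('b \<Rightarrow> nat) \<Rightarrow> 'b mpoly set \<Rightarrow> ('b \<Rightarrow> nat) \<Rightarrow> 'b mpoly set" where
  "ideal_sections B n I a =
     {F \<in> forms B n a.
        \<forall>x\<in>points B n. \<exists>H\<in>(\<Union>d. forms B n d). eval_poly H x \<noteq> 0 \<and> H * F \<in> I}"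

text \<open>The value \<open>h(Z, a)\<close> for the closed subscheme \<open>Z\<close> defined by the ideal \<open>I\<close>.\<close>

definition hilbert_fun ::
    "'b set \<Rightarrow> ('b \<Rightarrow> nat) \<Rightarrow> 'b mpoly set \<Rightarrow> ('b \<Rightarrow> nat) \<Rightarrow> int" where
  "hilbert_fun B n I a =
     int (poly_vs.dim (forms B n a)) - int (poly_vs.dim (ideal_sections B n I a))"

section \<open>The statement T(n; a; s)\<close>

text \<open>
  A point \<open>p\<close> of the multiprojective space with block set \<open>{..<s} \<times> {..<k}\<close> is an \<open>s\<close>-tuple of
  points of the one with block set \<open>{..<k}\<close>; its \<open>t\<close>-th entry is \<open>tuple_entry p t\<close>.
\<close>

definition tuple_entry ::
    "((nat \<times> nat) \<times> nat \<Rightarrow> complex) \<Rightarrow> nat \<Rightarrow> (nat \<times> nat \<Rightarrow> complex)" where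
  "tuple_entry p t = (\<lambda>(i, j). p ((t, i), j))"

definition double_points_ideal ::
    "nat list \<Rightarrow> nat \<Rightarrow> ((nat \<times> nat) \<times> nat \<Rightarrow> complex) \<Rightarrow> nat mpoly set" where
  "double_points_ideal n s p =
     carrier (coord_ring {..<length n} ((!) n)) \<inter>
     (\<Inter>t<s. double_point_ideal {..<length n} ((!) n) (tuple_entry p t))"

text \<open>``General'' means: for all \<open>s\<close>-tuples in some nonempty Zariski open set of tuples.\<close>

definition T :: "nat list \<Rightarrow> nat list \<Rightarrow> nat \<Rightarrow> bool" where
  "T n a s \<longleftrightarrow>
     (\<exists>U. zariski_open ({..<s} \<times> {..<length n}) (\<lambda>(t, i). n ! i) U \<and> U \<noteq> {} \<and>
        (\<forall>p\<in>U. hilbert_fun {..<length n} ((!) n) (double_points_ideal n s p) ((!) a) =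
           int (min (s * (1 + (\<Sum>i<length n. n ! i)))
                    (\<Prod>i<length n. (n ! i + a ! i) choose (a ! i)))))"

end

theory Submission
  imports Defs "HOL-Library.Product_Lexorder" "Jordan_Normal_Form.Determinant"
begin

text \<open>
  A form lies in the square of the ideal of a point iff all its partial derivatives vanish there,
  and by semicontinuity of rank \<open>T\<close> holds as soon as one tuple of points imposes the expected
  number of conditions.  If four double points of a small space impose independent conditions, the
  same holds after enlarging dimensions, degrees and the number of factors; if no nonzero form is
  singular at four points of a large space, the same holds for every smaller one.  Hence it suffices
  to treat finitely many minimal and maximal cases, by explicit integer matrices, and three infinite
  families with a linear factor.  In the exceptional cases products of forms of smaller degree
  through the points give too many singular forms, for every choice of the points.
\<close>

section \<open>Kernels of finitely many functionals\<close>

text \<open>Ten of the certified cases have exactly as many forms as conditions. There independence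
  of the conditions and absence of singular forms coincide, so one matrix serves both as a minimal
  case upwards and as a maximal case downwards. Plane cubics, with ten forms against twelve
  conditions, need a maximal certificate of their own. A block of degree one and unbounded dimension
  has no largest member; it is settled at once when the other blocks carry a four-dimensional space
  of forms on which the four points are independent. The exceptional cases are what neither
  direction reaches.

  Since a single good tuple proves \<open>T\<close>, its failure has to be shown at every tuple,
  degenerate ones included. This is why the constructions for three planes and for two planes and a
  line branch on collinear points instead of assuming general position.

  Conditions are expressed by derivatives in homogeneous coordinates; Euler's formula trades one
  derivative in each block for the single value at the point.\<close>

definition functional :: "('b mpoly \<Rightarrow> complex) \<Rightarrow> bool" where
  "functional l \<longleftrightarrow> (\<forall>x y. l (x + y) = l x + l y) \<and> (\<forall>c x. l (scale_poly c x) = c * l x)"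

definition kernel_on :: "'b mpoly set \<Rightarrow> 'i set \<Rightarrow> ('i \<Rightarrow> 'b mpoly \<Rightarrow> complex) \<Rightarrow> 'b mpoly set" where
  "kernel_on V I l = {v \<in> V. \<forall>i\<in>I. l i v = 0}"

lemma functional_add: "functional l \<Longrightarrow> l (x + y) = l x + l y"
  by (simp add: functional_def)

lemma functional_scale: "functional l \<Longrightarrow> l (scale_poly c x) = c * l x"
  by (simp add: functional_def)

lemma functional_zero: "functional l \<Longrightarrow> l 0 = 0"
  using functional_scale[of l 0 0] by simp

lemma functional_diff: "functional l \<Longrightarrow> l (x - y) = l x - l y"
  using functional_add[of l "x - y" y] by (simp add: algebra_simps)

lemma functional_sum: "functional l \<Longrightarrow> l (sum f A) = (\<Sum>a\<in>A. l (f a))"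
  by (induction A rule: infinite_finite_induct) (simp_all add: functional_zero functional_add)

lemma functional_zero_on_span:
  assumes "functional l" "\<And>x. x \<in> S \<Longrightarrow> l x = 0" "v \<in> poly_vs.span S"
  shows "l v = 0"
  using assms(3)
  by (induction rule: poly_vs.span_induct_alt)
    (simp_all add: assms functional_zero functional_add functional_scale)

text \<open>\<open>poly_vs.dim\<close> counts a basis by \<open>card\<close>, which is 0 for an
  infinite one. The hypothesis that \<open>V\<close> lies in the span of a finite \<open>W\<close>
  rules this out and recurs below for the same reason.\<close>

lemma independent_card_le_dim_subset:
  assumes "finite W" "V \<subseteq> poly_vs.span W" "S \<subseteq> V" "poly_vs.independent S"
  shows "card S \<le> poly_vs.dim V" "finite S"
proof -
  obtain B where B: "B \<subseteq> V" "poly_vs.independent B" "V \<subseteq> poly_vs.span B"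
    using poly_vs.maximal_independent_subset by blast
  have "finite B"
    using poly_vs.independent_span_bound[OF assms(1) B(2)] B(1) assms(2) by blast
  moreover have "card B = poly_vs.dim V"
    using B by (simp add: poly_vs.basis_card_eq_dim)
  ultimately show "card S \<le> poly_vs.dim V" "finite S"
    using poly_vs.independent_span_bound[of B S] assms B(3) by auto
qed

text \<open>A dual system splits \<open>V\<close>: each \<open>v\<close> is the sum of the multiples
  \<open>l i v\<close> of the \<open>F i\<close> and an element of the kernel, so a basis of the
  kernel together with the \<open>F i\<close> is a basis of \<open>V\<close>.\<close>

lemma dim_kernel_dual:
  assumes V: "poly_vs.subspace V" "finite W" "V \<subseteq> poly_vs.span W" and I: "finite I"
    and l: "\<And>i. i \<in> I \<Longrightarrow> functional (l i)"
    and F: "\<And>i. i \<in> I \<Longrightarrow> F i \<in> V"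
    and d: "\<And>i j. i \<in> I \<Longrightarrow> j \<in> I \<Longrightarrow> l i (F j) = (if i = j then 1 else 0)"
  shows "poly_vs.dim V = poly_vs.dim (kernel_on V I l) + card I"
proof -
  let ?K = "kernel_on V I l"
  obtain B where B: "B \<subseteq> ?K" "poly_vs.independent B" "?K \<subseteq> poly_vs.span B"
    using poly_vs.maximal_independent_subset by blast
  have finB: "finite B"
    using poly_vs.independent_span_bound[OF V(2) B(2)] B(1) V(3) by (auto simp: kernel_on_def)
  have inj: "inj_on F I"
    by (rule inj_onI) (metis d zero_neq_one)
  have disj: "B \<inter> F ` I = {}"
  proof -
    have False if "i \<in> I" "F i \<in> B" for i
      using that B(1) d[of i i] by (auto simp: kernel_on_def)
    thus ?thesis by auto
  qed
  have ind: "poly_vs.independent (B \<union> F ` J)" if "J \<subseteq> I" for J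
    using finite_subset[OF that I] that
  proof (induction J)
    case (insert j J)
    have "l j (F i) = 0" if "i \<in> J" for i
      using that insert d[of j i] by auto
    moreover have "l j x = 0" if "x \<in> B" for x
      using that insert B(1) by (auto simp: kernel_on_def)
    ultimately have "F j \<notin> poly_vs.span (B \<union> F ` J)"
      using functional_zero_on_span[of "l j" "B \<union> F ` J" "F j"] insert l d[of j j] by auto
    with insert show ?case
      by (simp add: poly_vs.independent_insertI)
  qed (simp add: B)
  have span: "V \<subseteq> poly_vs.span (B \<union> F ` I)"
  proof
    fix v assume v: "v \<in> V"
    let ?u = "\<Sum>i\<in>I. scale_poly (l i v) (F i)"
    have "?u \<in> V"
      using F by (intro poly_vs.subspace_sum V(1) poly_vs.subspace_scale) auto
    moreover have "l j (v - ?u) = 0" if "j \<in> I" for j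
    proof -
      have "l j ?u = (\<Sum>i\<in>I. if i = j then l i v else 0)"
        using that d[OF that] by (auto simp: functional_sum l functional_scale intro!: sum.cong)
      also have "\<dots> = l j v"
        using that I by simp
      finally show ?thesis
        using l[OF that] by (simp add: functional_diff)
    qed
    ultimately have "v - ?u \<in> ?K"
      using V(1) v by (auto simp: kernel_on_def poly_vs.subspace_diff)
    hence "v - ?u \<in> poly_vs.span (B \<union> F ` I)"
      using B(3) poly_vs.span_mono[of B "B \<union> F ` I"] by auto
    moreover have "?u \<in> poly_vs.span (B \<union> F ` I)"
      by (intro poly_vs.span_sum poly_vs.span_scale poly_vs.span_base) auto
    ultimately show "v \<in> poly_vs.span (B \<union> F ` I)"
      using poly_vs.span_add by fastforce
  qed
  have "poly_vs.dim V = card (B \<union> F ` I)"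
    using B F span ind[of I] by (intro poly_vs.dim_unique) (auto simp: kernel_on_def)
  also have "\<dots> = card B + card I"
    using finB I disj by (simp add: card_Un_disjoint card_image inj)
  also have "card B = poly_vs.dim ?K"
    using B by (simp add: poly_vs.basis_card_eq_dim)
  finally show ?thesis .
qed

text \<open>Gaussian elimination on functionals: \<open>J\<close> keeps a functional only if it does
  not vanish on the kernel of those kept before, so \<open>card J\<close> is the rank of the whole
  system on \<open>V\<close>.\<close>

lemma dual_system_exists:
  assumes V: "poly_vs.subspace V" and I: "finite I" and l: "\<And>i. i \<in> I \<Longrightarrow> functional (l i)"
  obtains J F where "J \<subseteq> I" "\<And>i. i \<in> J \<Longrightarrow> F i \<in> V"
    "\<And>i j. i \<in> J \<Longrightarrow> j \<in> J \<Longrightarrow> l i (F j) = (if i = j then 1 else 0)"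
    "kernel_on V J l = kernel_on V I l"
proof -
  have "\<exists>J F. J \<subseteq> I \<and> (\<forall>i\<in>J. F i \<in> V) \<and>
      (\<forall>i\<in>J. \<forall>j\<in>J. l i (F j) = (if i = j then 1 else 0)) \<and>
      kernel_on V J l = kernel_on V I l"
    using I l
  proof (induction I)
    case empty
    show ?case by (intro exI[of _ "{}"]) simp
  next
    case (insert i I)
    have "\<exists>J F. J \<subseteq> I \<and> (\<forall>i\<in>J. F i \<in> V) \<and>
        (\<forall>i\<in>J. \<forall>j\<in>J. l i (F j) = (if i = j then 1 else 0)) \<and>
        kernel_on V J l = kernel_on V I l"
      by (rule insert.IH) (simp add: insert.prems)
    then obtain J F where J: "J \<subseteq> I" "\<forall>i\<in>J. F i \<in> V"
        "\<forall>i\<in>J. \<forall>j\<in>J. l i (F j) = (if i = j then 1 else 0)"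
        "kernel_on V J l = kernel_on V I l"
      by (elim exE conjE)
    have ins: "kernel_on V (insert i M) l = {v \<in> kernel_on V M l. l i v = 0}" for M
      by (auto simp: kernel_on_def)
    show ?case
    proof (cases "\<forall>v\<in>kernel_on V J l. l i v = 0")
      case True
      hence "kernel_on V J l = kernel_on V (insert i I) l"
        using J(4) unfolding ins by blast
      moreover have "J \<subseteq> insert i I" using J(1) by blast
      ultimately show ?thesis using J(2,3) by (intro exI[of _ J] exI[of _ F] conjI)
    next
      case False
      then obtain v where v: "v \<in> kernel_on V J l" "l i v \<noteq> 0" by blast
      define G where "G = scale_poly (inverse (l i v)) v"
      have li: "functional (l i)" using insert by simp
      have G: "G \<in> V" "l i G = 1" "\<And>j. j \<in> J \<Longrightarrow> l j G = 0"
        using v V li insert.prems J(1)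
        by (auto simp: G_def kernel_on_def poly_vs.subspace_scale functional_scale)
      \<comment> \<open>\<open>G\<close> has value 1 under \<open>l i\<close> and 0 under the
        functionals kept so far; subtracting a multiple of it from each old dual vector makes that
        vector invisible to \<open>l i\<close> without disturbing its other values.\<close>
      define F' where "F' = (\<lambda>j. if j = i then G else F j - scale_poly (l i (F j)) G)"
      have iJ: "i \<notin> J" using J(1) insert by auto
      have "l a (F' b) = (if a = b then 1 else 0)" if "a \<in> insert i J" "b \<in> insert i J" for a b
      proof -
        have "functional (l a)" using that insert.prems J(1) by auto
        thus ?thesis
          using that iJ G(2,3) J(3)
          by (cases "a = i"; cases "b = i") (auto simp: F'_def functional_diff functional_scale)
      qed
      moreover have "F' j \<in> V" if "j \<in> insert i J" for j
        using that G J(2) V by (auto simp: F'_def poly_vs.subspace_diff poly_vs.subspace_scale)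
      moreover have "kernel_on V (insert i J) l = kernel_on V (insert i I) l"
        using J(4) by (simp only: ins)
      moreover have "insert i J \<subseteq> insert i I" using J(1) by blast
      ultimately show ?thesis
        by (intro exI[of _ "insert i J"] exI[of _ F'] conjI ballI)
    qed
  qed
  then obtain J F where "J \<subseteq> I" "\<forall>i\<in>J. F i \<in> V"
      "\<forall>i\<in>J. \<forall>j\<in>J. l i (F j) = (if i = j then 1 else 0)"
      "kernel_on V J l = kernel_on V I l"
    by (elim exE conjE)
  thus thesis by (intro that[of J F]) simp_all
qed

lemma dim_le_dim_kernel:
  assumes V: "poly_vs.subspace V" "finite W" "V \<subseteq> poly_vs.span W" and I: "finite I"
    and l: "\<And>i. i \<in> I \<Longrightarrow> functional (l i)"
  shows "poly_vs.dim V \<le> poly_vs.dim (kernel_on V I l) + card I"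
proof -
  obtain J F where J: "J \<subseteq> I" "\<And>i. i \<in> J \<Longrightarrow> F i \<in> V"
    "\<And>i j. i \<in> J \<Longrightarrow> j \<in> J \<Longrightarrow> l i (F j) = (if i = j then 1 else 0)"
    "kernel_on V J l = kernel_on V I l"
    by (rule dual_system_exists[OF V(1) I, of l]) (erule l, rule that)
  have "poly_vs.dim V = poly_vs.dim (kernel_on V J l) + card J"
    using J l finite_subset[OF J(1) I] by (intro dim_kernel_dual[OF V]) auto
  with J(4) show ?thesis
    using card_mono[OF I J(1)] by simp
qed

lemma dim_mono_finite:
  assumes "finite W" "V \<subseteq> poly_vs.span W" "U \<subseteq> V"
  shows "poly_vs.dim U \<le> poly_vs.dim V"
proof -
  obtain B where "B \<subseteq> U" "poly_vs.independent B" "U \<subseteq> poly_vs.span B"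
    using poly_vs.maximal_independent_subset by blast
  moreover from this have "card B = poly_vs.dim U" by (simp add: poly_vs.basis_card_eq_dim)
  ultimately show ?thesis
    using independent_card_le_dim_subset[OF assms(1,2), of B] assms(3) by auto
qed

lemma obtain_independent_subset:
  assumes "q \<le> poly_vs.dim V" "finite W" "V \<subseteq> poly_vs.span W"
  obtains B where "B \<subseteq> V" "poly_vs.independent B" "finite B" "card B = q"
proof -
  obtain B where B: "B \<subseteq> V" "poly_vs.independent B" "V \<subseteq> poly_vs.span B"
    using poly_vs.maximal_independent_subset by blast
  have "finite B" "card B = poly_vs.dim V"
    using poly_vs.independent_span_bound[OF assms(2) B(2)] B assms(3) by (auto simp: poly_vs.basis_card_eq_dim)
  with assms(1) obtain B' where "B' \<subseteq> B" "card B' = q"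
    by (metis obtain_subset_with_card_n)
  with B \<open>finite B\<close> show thesis
    using that[of B'] poly_vs.independent_mono finite_subset by blast
qed

section \<open>Polynomials\<close>

abbreviation lookup where "lookup \<equiv> Poly_Mapping.lookup"
abbreviation keys where "keys \<equiv> Poly_Mapping.keys"
abbreviation single where "single \<equiv> Poly_Mapping.single"

type_synonym 'b monom = "'b \<times> nat \<Rightarrow>\<^sub>0 nat"

lemma mpoly_eq_sum: "F = (\<Sum>m\<in>keys F. single m (lookup F m))"
  by (rule poly_mapping_eqI)
    (simp add: lookup_sum lookup_single when_def in_keys_iff sum.delta)

lemma mpoly_induct [case_names single add]:
  fixes F :: "'a \<Rightarrow>\<^sub>0 'c::comm_monoid_add"
  assumes "\<And>m c. P (single m c)" "\<And>F G. P F \<Longrightarrow> P G \<Longrightarrow> P (F + G)"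
  shows "P F"
proof -
  have "P (\<Sum>m\<in>A. single m (lookup F m))" if "finite A" for A
    using that
  proof induction
    case empty
    show ?case using assms(1)[of undefined 0] by simp
  qed (use assms in simp)
  from this[of "keys F"] show ?thesis
    using mpoly_eq_sum[of F] by simp
qed

lemma eval_poly_single:
  "eval_poly (single m c) x = c * (\<Prod>v\<in>keys m. x v ^ lookup m v)"
  by (cases "c = 0") (simp_all add: eval_poly_def)

lemma eval_poly_add [simp]: "eval_poly (F + G) x = eval_poly F x + eval_poly G x"
  unfolding eval_poly_def
  by (rule setsum_keys_plus_distrib) (simp_all add: distrib_right)

lemma eval_poly_zero [simp]: "eval_poly 0 x = 0"
  by (simp add: eval_poly_def)

lemma eval_poly_one [simp]: "eval_poly 1 x = 1"
  using eval_poly_single[of 0 1 x] by simp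

definition monom_val :: "'b monom \<Rightarrow> ('b \<times> nat \<Rightarrow> complex) \<Rightarrow> complex" where
  "monom_val m x = (\<Prod>v\<in>keys m. x v ^ lookup m v)"

lemma monom_val_superset:
  assumes "finite A" "keys m \<subseteq> A"
  shows "monom_val m x = (\<Prod>v\<in>A. x v ^ lookup m v)"
  unfolding monom_val_def
  using assms by (intro prod.mono_neutral_left) (auto simp: in_keys_iff)

lemma monom_val_add: "monom_val (m + m') x = monom_val m x * monom_val m' x"
proof -
  have *: "finite (keys m \<union> keys m')" by simp
  show ?thesis
    by (subst (1 2 3) monom_val_superset[OF *])
      (auto simp: lookup_add power_add prod.distrib dest: subsetD[OF Poly_Mapping.keys_add])
qed

lemma monom_val_zero [simp]: "monom_val 0 x = 1"
  by (simp add: monom_val_def)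

lemma monom_val_single: "monom_val (single v e) x = x v ^ e"
  by (cases "e = 0") (simp_all add: monom_val_def)

lemma eval_poly_single': "eval_poly (single m c) x = c * monom_val m x"
  by (simp add: eval_poly_single monom_val_def)

lemma eval_poly_mult [simp]: "eval_poly (F * G) x = eval_poly F x * eval_poly G x"
proof (induction F rule: mpoly_induct)
  case (single m c)
  show ?case
    by (induction G rule: mpoly_induct)
      (simp_all add: mult_single eval_poly_single' monom_val_add algebra_simps)
qed (simp add: algebra_simps)

lemma eval_poly_uminus [simp]: "eval_poly (- F) x = - eval_poly F x"
  using eval_poly_add[of F "- F" x] by (simp add: eq_neg_iff_add_eq_0 add.commute)

lemma eval_poly_diff [simp]: "eval_poly (F - G) x = eval_poly F x - eval_poly G x"
  using eval_poly_add[of F "- G" x] by simp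

lemma eval_poly_scale [simp]: "eval_poly (scale_poly c F) x = c * eval_poly F x"
  by (simp add: scale_poly_def eval_poly_single')

lemma eval_poly_sum [simp]: "eval_poly (sum f A) x = (\<Sum>a\<in>A. eval_poly (f a) x)"
  by (induction A rule: infinite_finite_induct) simp_all

lemma eval_poly_prod [simp]: "eval_poly (prod f A) x = (\<Prod>a\<in>A. eval_poly (f a) x)"
  by (induction A rule: infinite_finite_induct) simp_all

lemma eval_poly_power [simp]: "eval_poly (F ^ e) x = eval_poly F x ^ e"
  by (induction e) simp_all

definition Var :: "'b \<times> nat \<Rightarrow> 'b mpoly" where
  "Var v = single (single v 1) 1"

lemma eval_poly_Var [simp]: "eval_poly (Var v) x = x v"
  by (simp add: Var_def eval_poly_single' monom_val_single)

subsection \<open>Partial derivatives\<close>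

text \<open>Subtraction of exponents is truncated. Where the variable is absent the coefficient
  carries the factor 0, so the wrong exponent never shows.\<close>

definition pd :: "'b \<times> nat \<Rightarrow> 'b mpoly \<Rightarrow> 'b mpoly" where
  "pd v F = (\<Sum>m\<in>keys F. single (m - single v 1) (lookup F m * of_nat (lookup m v)))"

lemma single_sum: "single m (sum f A) = (\<Sum>a\<in>A. single m (f a))"
  by (induction A rule: infinite_finite_induct) (simp_all add: single_add)

lemma pd_single: "pd v (single m c) = single (m - single v 1) (c * of_nat (lookup m v))"
  by (cases "c = 0") (simp_all add: pd_def)

lemma pd_add [simp]: "pd v (F + G) = pd v F + pd v G"
  unfolding pd_def
  by (rule setsum_keys_plus_distrib) (simp_all add: distrib_right single_add)

lemma pd_zero [simp]: "pd v 0 = 0"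
  by (simp add: pd_def)

lemma pd_one [simp]: "pd v 1 = 0"
  using pd_single[of v 0 1] by simp

lemma monom_add_diff:
  fixes m m' :: "'b monom"
  assumes "lookup m v \<noteq> 0"
  shows "m + m' - single v 1 = (m - single v 1) + m'"
  using assms
  by (intro poly_mapping_eqI) (auto simp: lookup_add lookup_minus lookup_single when_def)

lemma pd_mult [simp]: "pd v (F * G) = pd v F * G + F * pd v G"
proof (induction F rule: mpoly_induct)
  case (single m c)
  show ?case
  proof (induction G rule: mpoly_induct)
    case (single m' c')
    show ?case
      using monom_add_diff[of m v m'] monom_add_diff[of m' v m]
      by (cases "lookup m v = 0"; cases "lookup m' v = 0")
        (simp_all add: mult_single pd_single lookup_add algebra_simps flip: single_add)
  qed (simp add: algebra_simps)
qed (simp add: algebra_simps)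

lemma pd_const [simp]: "pd v (single 0 c) = 0"
  by (simp add: pd_single)

lemma pd_scale [simp]: "pd v (scale_poly c F) = scale_poly c (pd v F)"
  by (simp add: scale_poly_def)

lemma pd_uminus [simp]: "pd v (- F) = - pd v F"
  using pd_add[of v F "- F"] by (simp add: eq_neg_iff_add_eq_0 add.commute)

lemma pd_diff [simp]: "pd v (F - G) = pd v F - pd v G"
  using pd_add[of v F "- G"] by simp

lemma pd_sum [simp]: "pd v (sum f A) = (\<Sum>a\<in>A. pd v (f a))"
  by (induction A rule: infinite_finite_induct) simp_all

lemma pd_Var [simp]: "pd v (Var w) = (if v = w then 1 else 0)"
  by (simp add: Var_def pd_single lookup_single)

lemma pd_notin:
  assumes "\<forall>m\<in>keys F. v \<notin> keys m"
  shows "pd v F = 0"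
  using assms by (auto simp: pd_def in_keys_iff intro!: sum.neutral)

lemma functional_eval: "functional (\<lambda>F. eval_poly F x)"
  and functional_pd: "functional (\<lambda>F. eval_poly (pd v F) x)"
  by (simp_all add: functional_def)

subsection \<open>Forms\<close>

lemma finite_vars [simp]: "finite B \<Longrightarrow> finite (vars B n)"
  by (simp add: vars_def)

definition bdeg :: "('b \<Rightarrow> nat) \<Rightarrow> 'b monom \<Rightarrow> 'b \<Rightarrow> nat" where
  "bdeg n m i = (\<Sum>j\<le>n i. lookup m (i, j))"

lemma bdeg_add: "bdeg n (m + m') i = bdeg n m i + bdeg n m' i"
  by (simp add: bdeg_def lookup_add sum.distrib)

lemma bdeg_zero [simp]: "bdeg n 0 i = 0"
  by (simp add: bdeg_def)

lemma bdeg_single: "j \<le> n i \<Longrightarrow> bdeg n (single (i, j) e) = (\<lambda>i'. if i = i' then e else 0)"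
  by (auto simp: bdeg_def lookup_single when_def fun_eq_iff)

definition monoms :: "'b set \<Rightarrow> ('b \<Rightarrow> nat) \<Rightarrow> ('b \<Rightarrow> nat) \<Rightarrow> 'b monom set" where
  "monoms B n d = {m. keys m \<subseteq> vars B n \<and> (\<forall>i\<in>B. bdeg n m i = d i)}"

lemma forms_iff: "F \<in> forms B n d \<longleftrightarrow> keys F \<subseteq> monoms B n d"
  by (auto simp: forms_def coord_ring_def monoms_def bdeg_def)

lemma forms_single: "single m c \<in> forms B n d \<longleftrightarrow> c = 0 \<or> m \<in> monoms B n d"
  by (auto simp: forms_iff)

lemma subspace_forms: "poly_vs.subspace (forms B n d)"
proof (rule poly_vs.subspaceI)
  show "F + G \<in> forms B n d" if "F \<in> forms B n d" "G \<in> forms B n d" for F G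
    using that Poly_Mapping.keys_add[of F G] by (auto simp: forms_iff)
  show "scale_poly c F \<in> forms B n d" if "F \<in> forms B n d" for c F
    using that
    by (fastforce simp: forms_iff scale_poly_def in_keys_iff Poly_Mapping.map.rep_eq when_def
        simp flip: mult_map_scale_conv_mult split: if_splits)
qed (simp add: forms_iff)

lemmas forms_zero [simp] = poly_vs.subspace_0[OF subspace_forms]
  and forms_add = poly_vs.subspace_add[OF subspace_forms]
  and forms_scale = poly_vs.subspace_scale[OF subspace_forms]
  and forms_diff = poly_vs.subspace_diff[OF subspace_forms]
  and forms_sum = poly_vs.subspace_sum[OF subspace_forms]
  and forms_uminus = poly_vs.subspace_neg[OF subspace_forms]

lemma monoms_add:
  "m \<in> monoms B n d \<Longrightarrow> m' \<in> monoms B n d' \<Longrightarrow> m + m' \<in> monoms B n (\<lambda>i. d i + d' i)"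
  using Poly_Mapping.keys_add[of m m'] by (auto simp: monoms_def bdeg_add)

lemma forms_mult:
  assumes "F \<in> forms B n d" "G \<in> forms B n d'"
  shows "F * G \<in> forms B n (\<lambda>i. d i + d' i)"
  using assms Poly_Mapping.keys_mult[of F G] monoms_add[of _ B n d _ d']
  by (fastforce simp: forms_iff)

lemma forms_cong: "(\<And>i. i \<in> B \<Longrightarrow> d i = d' i) \<Longrightarrow> forms B n d = forms B n d'"
  by (auto simp: forms_iff monoms_def)

lemma forms_one: "(\<And>i. i \<in> B \<Longrightarrow> d i = 0) \<Longrightarrow> 1 \<in> forms B n d"
  by (auto simp: forms_iff monoms_def)

lemma forms_Var:
  assumes "i \<in> B" "j \<le> n i" "\<And>i'. i' \<in> B \<Longrightarrow> d i' = (if i' = i then 1 else 0)"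
  shows "Var (i, j) \<in> forms B n d"
  using assms by (auto simp: Var_def forms_single monoms_def vars_def bdeg_single)

lemma forms_prod:
  assumes "\<And>a. a \<in> A \<Longrightarrow> F a \<in> forms B n (d a)"
  shows "prod F A \<in> forms B n (\<lambda>i. \<Sum>a\<in>A. d a i)"
  using assms
  by (induction A rule: infinite_finite_induct) (auto intro: forms_one forms_mult)

lemma forms_power: "F \<in> forms B n d \<Longrightarrow> F ^ e \<in> forms B n (\<lambda>i. e * d i)"
  using forms_mult[of F B n d "F ^ _"]
  by (induction e) (auto intro: forms_one forms_mult)

text \<open>For \<open>d i = 0\<close> the degree stays 0 by truncation; the derivative is then the
  zero polynomial, which is a form of every degree.\<close>

lemma pd_form:
  assumes F: "F \<in> forms B n d" and v: "(i, j) \<in> vars B n"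
  shows "pd (i, j) F \<in> forms B n (d(i := d i - 1))"
proof -
  have "single (m - single (i, j) 1) (c * of_nat (lookup m (i, j))) \<in> forms B n (d(i := d i - 1))"
    if m: "m \<in> monoms B n d" for m c
  proof (cases "lookup m (i, j) = 0")
    case False
    define m' where "m' = m - single (i, j) 1"
    have eq: "m = m' + single (i, j) 1"
      using False by (intro poly_mapping_eqI)
        (auto simp: m'_def lookup_add lookup_minus lookup_single when_def)
    have j: "j \<le> n i" using v by (simp add: vars_def)
    have "keys m' \<subseteq> keys m"
      by (auto simp: m'_def in_keys_iff lookup_minus)
    hence "m' \<in> monoms B n (d(i := d i - 1))"
      using m bdeg_add[of n m' "single (i, j) 1"] unfolding eq[symmetric]
      by (auto simp: monoms_def bdeg_single[of j n i, OF j])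
    thus ?thesis
      by (simp add: forms_single m'_def)
  qed simp
  moreover have "m \<in> monoms B n d" if "m \<in> keys F" for m
    using that F by (auto simp: forms_iff)
  ultimately show ?thesis
    unfolding pd_def by (intro forms_sum) blast
qed

lemma pd_form_outside: "F \<in> forms B n d \<Longrightarrow> v \<notin> vars B n \<Longrightarrow> pd v F = 0"
  by (rule pd_notin) (auto simp: forms_iff monoms_def)

text \<open>The formula holds in each block separately, since every monomial is homogeneous in the
  variables of that block. It recovers the value at a point from the derivatives there, and one
  derivative of a block from the value and the other derivatives.\<close>

lemma euler:
  assumes F: "F \<in> forms B n d" and i: "i \<in> B"
  shows "(\<Sum>j\<le>n i. Var (i, j) * pd (i, j) F) = scale_poly (of_nat (d i)) F"
proof -
  have mono: "(\<Sum>j\<le>n i. Var (i, j) * pd (i, j) (single m c)) = scale_poly (of_nat (d i)) (single m c)"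
    if m: "m \<in> monoms B n d" for m c
  proof -
    have "Var (i, j) * pd (i, j) (single m c) = single m (c * of_nat (lookup m (i, j)))" for j
    proof (cases "lookup m (i, j) = 0")
      case False
      hence "single (i, j) 1 + (m - single (i, j) 1) = m"
        by (intro poly_mapping_eqI) (auto simp: lookup_add lookup_minus lookup_single when_def)
      thus ?thesis by (simp add: Var_def pd_single mult_single)
    qed (simp add: pd_single)
    hence "(\<Sum>j\<le>n i. Var (i, j) * pd (i, j) (single m c)) =
        single m (c * of_nat (bdeg n m i))"
      by (simp add: bdeg_def sum_distrib_left single_sum)
    thus ?thesis
      using m i by (simp add: monoms_def scale_poly_def mult_single mult.commute del: single_of_nat)
  qed
  have "(\<Sum>j\<le>n i. Var (i, j) * pd (i, j) F) =
      (\<Sum>m\<in>keys F. \<Sum>j\<le>n i. Var (i, j) * pd (i, j) (single m (lookup F m)))"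
    by (subst mpoly_eq_sum[of F], subst sum.swap) (simp add: sum_distrib_left)
  also have "\<dots> = (\<Sum>m\<in>keys F. scale_poly (of_nat (d i)) (single m (lookup F m)))"
    using F by (intro sum.cong refl mono) (auto simp: forms_iff)
  also have "\<dots> = scale_poly (of_nat (d i)) F"
    using mpoly_eq_sum[of F] by (simp add: poly_vs.scale_sum_right[symmetric])
  finally show ?thesis .
qed

lemma euler_eval:
  assumes "F \<in> forms B n d" "i \<in> B"
  shows "(\<Sum>j\<le>n i. x (i, j) * eval_poly (pd (i, j) F) x) = of_nat (d i) * eval_poly F x"
  using arg_cong[OF euler[OF assms], of "\<lambda>G. eval_poly G x"] by simp

subsection \<open>The dimension of the space of forms\<close>

definition restr :: "('b \<times> nat) set \<Rightarrow> 'b monom \<Rightarrow> 'b monom" where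
  "restr A m = (\<Sum>v\<in>keys m \<inter> A. single v (lookup m v))"

lemma lookup_restr: "lookup (restr A m) v = (if v \<in> A then lookup m v else 0)"
  by (auto simp: restr_def lookup_sum lookup_single when_def in_keys_iff sum.delta)

lemma keys_restr: "keys (restr A m) = keys m \<inter> A"
  by (auto simp: in_keys_iff lookup_restr split: if_splits)

lemma restr_add_compl: "restr {v. P v} m + restr {v. \<not> P v} m = m"
  by (rule poly_mapping_eqI) (simp add: lookup_add lookup_restr)

lemma lookup_zero_notin_vars: "keys m \<subseteq> vars B n \<Longrightarrow> i \<notin> B \<Longrightarrow> lookup m (i, j) = 0"
  by (fastforce simp: vars_def in_keys_iff)

lemma bdeg_outside: "keys m \<subseteq> vars B n \<Longrightarrow> i \<notin> B \<Longrightarrow> bdeg n m i = 0"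
  by (simp add: bdeg_def lookup_zero_notin_vars)

text \<open>A monomial splits uniquely into its part in block \<open>i\<close> and its part in
  \<open>B\<close>; this makes the number of monomials a product over the blocks.\<close>

lemma monoms_insert_bij:
  assumes "i \<notin> B"
  shows "bij_betw (\<lambda>(m, m'). m + m') (monoms {i} n d \<times> monoms B n d) (monoms (insert i B) n d)"
proof (rule bij_betw_byWitness[where f' = "\<lambda>m. (restr {v. fst v = i} m, restr {v. fst v \<noteq> i} m)"])
  show "\<forall>p\<in>monoms {i} n d \<times> monoms B n d.
      (restr {v. fst v = i} (case p of (m, m') \<Rightarrow> m + m'),
       restr {v. fst v \<noteq> i} (case p of (m, m') \<Rightarrow> m + m')) = p"
  proof (clarify, intro conjI poly_mapping_eqI)
    fix m m' v assume "m \<in> monoms {i} n d" "m' \<in> monoms B n d"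
    hence z: "lookup m' (i, j) = 0" "i' \<noteq> i \<Longrightarrow> lookup m (i', j) = 0" for i' j
      using assms by (auto simp: monoms_def intro: lookup_zero_notin_vars)
    show "lookup (restr {v. fst v = i} (m + m')) v = lookup m v"
      using z by (cases v) (auto simp: lookup_restr lookup_add)
    show "lookup (restr {v. fst v \<noteq> i} (m + m')) v = lookup m' v"
      using z by (cases v) (auto simp: lookup_restr lookup_add)
  qed
  show "\<forall>m\<in>monoms (insert i B) n d.
      (case (restr {v. fst v = i} m, restr {v. fst v \<noteq> i} m) of (m, m') \<Rightarrow> m + m') = m"
    by (simp add: restr_add_compl)
  show "(\<lambda>(m, m'). m + m') ` (monoms {i} n d \<times> monoms B n d) \<subseteq> monoms (insert i B) n d"
  proof clarify
    fix m m' assume m: "m \<in> monoms {i} n d" "m' \<in> monoms B n d"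
    hence "bdeg n m' i = 0" "\<And>i'. i' \<in> B \<Longrightarrow> bdeg n m i' = 0"
      using assms by (auto simp: monoms_def intro!: bdeg_outside)
    with m show "m + m' \<in> monoms (insert i B) n d"
      using Poly_Mapping.keys_add[of m m'] by (fastforce simp: monoms_def bdeg_add vars_def)
  qed
  show "(\<lambda>m. (restr {v. fst v = i} m, restr {v. fst v \<noteq> i} m)) ` monoms (insert i B) n d
      \<subseteq> monoms {i} n d \<times> monoms B n d"
  proof clarify
    fix m assume m: "m \<in> monoms (insert i B) n d"
    have "bdeg n (restr {v. fst v \<noteq> i} m) i' = bdeg n m i'" if "i' \<noteq> i" for i'
      using that by (simp add: bdeg_def lookup_restr)
    moreover have "i' \<noteq> i" if "i' \<in> B" for i' using that assms by blast
    ultimately have "\<forall>i'\<in>B. bdeg n (restr {v. fst v \<noteq> i} m) i' = d i'"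
      using m by (simp add: monoms_def)
    moreover have "bdeg n (restr {v. fst v = i} m) i = d i"
      using m by (simp add: bdeg_def lookup_restr monoms_def)
    ultimately show "restr {v. fst v = i} m \<in> monoms {i} n d \<and>
        restr {v. fst v \<noteq> i} m \<in> monoms B n d"
      using m by (auto simp: monoms_def keys_restr vars_def)
  qed
qed

text \<open>The exponent \<open>x\<close> of the last variable is split off. The resulting recursion
  in the number of variables is the identity \<open>sum_choose_lower\<close> for binomial
  coefficients.\<close>

lemma monoms_block_Suc_bij:
  "bij_betw (\<lambda>(x, m). single (i, Suc N) x + m)
     (SIGMA x:{..e}. monoms {i} (\<lambda>_. N) (\<lambda>_. e - x)) (monoms {i} (\<lambda>_. Suc N) (\<lambda>_. e))"
proof (rule bij_betw_byWitness[where f' = "\<lambda>m. (lookup m (i, Suc N), restr (- {(i, Suc N)}) m)"])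
  let ?S = "SIGMA x:{..e}. monoms {i} (\<lambda>_. N) (\<lambda>_. e - x)"
  have z: "lookup m (i, Suc N) = 0" if "m \<in> monoms {i} (\<lambda>_. N) d" for m d
    using that by (fastforce simp: monoms_def vars_def in_keys_iff)
  show "\<forall>p\<in>?S. (lookup (case p of (x, m) \<Rightarrow> single (i, Suc N) x + m) (i, Suc N),
      restr (- {(i, Suc N)}) (case p of (x, m) \<Rightarrow> single (i, Suc N) x + m)) = p"
    by (auto simp: lookup_add z lookup_restr lookup_single when_def intro!: poly_mapping_eqI)
  show "\<forall>m\<in>monoms {i} (\<lambda>_. Suc N) (\<lambda>_. e).
      (case (lookup m (i, Suc N), restr (- {(i, Suc N)}) m) of
        (x, m) \<Rightarrow> single (i, Suc N) x + m) = m"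
    by (auto simp: lookup_add lookup_restr lookup_single when_def intro!: poly_mapping_eqI)
  show "(\<lambda>(x, m). single (i, Suc N) x + m) ` ?S \<subseteq> monoms {i} (\<lambda>_. Suc N) (\<lambda>_. e)"
  proof clarify
    fix x m assume *: "x \<le> e" "m \<in> monoms {i} (\<lambda>_. N) (\<lambda>_. e - x)"
    hence "bdeg (\<lambda>_. Suc N) m i = e - x"
      using z[OF *(2)] by (simp add: monoms_def bdeg_def)
    moreover have "keys (single (i, Suc N) x + m) \<subseteq> {(i, Suc N)} \<union> keys m"
      using Poly_Mapping.keys_add[of "single (i, Suc N) x" m] by (auto split: if_splits)
    hence "keys (single (i, Suc N) x + m) \<subseteq> vars {i} (\<lambda>_. Suc N)"
      using *(2) by (force simp: monoms_def vars_def)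
    ultimately show "single (i, Suc N) x + m \<in> monoms {i} (\<lambda>_. Suc N) (\<lambda>_. e)"
      using *(1) by (simp add: monoms_def bdeg_add bdeg_single)
  qed
  show "(\<lambda>m. (lookup m (i, Suc N), restr (- {(i, Suc N)}) m)) ` monoms {i} (\<lambda>_. Suc N) (\<lambda>_. e)
      \<subseteq> ?S"
  proof (rule image_subsetI)
    fix m assume m: "m \<in> monoms {i} (\<lambda>_. Suc N) (\<lambda>_. e)"
    hence "(\<Sum>j\<le>N. lookup m (i, j)) + lookup m (i, Suc N) = e"
      by (simp add: monoms_def bdeg_def)
    moreover have "keys m - {(i, Suc N)} \<subseteq> vars {i} (\<lambda>_. N)"
      using m by (auto simp: monoms_def vars_def le_Suc_eq)
    ultimately show "(lookup m (i, Suc N), restr (- {(i, Suc N)}) m) \<in> ?S"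
      by (auto simp: monoms_def keys_restr bdeg_def lookup_restr)
  qed
qed

lemma card_monoms_block:
  "finite (monoms {i} (\<lambda>_. N) (\<lambda>_. e)) \<and> card (monoms {i} (\<lambda>_. N) (\<lambda>_. e)) = (N + e) choose e"
proof (induction N arbitrary: e)
  case 0
  have "m = single (i, 0) e" if "m \<in> monoms {i} (\<lambda>_. 0) (\<lambda>_. e)" for m
  proof (rule poly_mapping_eqI)
    fix v
    have "lookup m v = 0" if "v \<noteq> (i, 0)"
      using that \<open>m \<in> _\<close> by (fastforce simp: monoms_def vars_def in_keys_iff)
    thus "lookup m v = lookup (single (i, 0) e) v"
      using that by (cases "v = (i, 0)") (auto simp: monoms_def bdeg_def lookup_single)
  qed
  moreover have "single (i, 0) e \<in> monoms {i} (\<lambda>_. 0) (\<lambda>_. e)"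
    by (auto simp: monoms_def vars_def bdeg_single)
  ultimately have "monoms {i} (\<lambda>_. 0) (\<lambda>_. e) = {single (i, 0) e}" by blast
  thus ?case by simp
next
  case (Suc N)
  let ?S = "SIGMA x:{..e}. monoms {i} (\<lambda>_. N) (\<lambda>_. e - x)"
  have "finite ?S" using Suc.IH by auto
  moreover have "card ?S = (\<Sum>x\<le>e. (N + (e - x)) choose (e - x))"
    using Suc.IH by (subst card_SigmaI) auto
  moreover have "\<dots> = (\<Sum>x\<le>e. (N + x) choose x)"
    by (rule sum.reindex_bij_witness[of _ "\<lambda>x. e - x" "\<lambda>x. e - x"]) auto
  ultimately show ?case
    using bij_betw_finite[OF monoms_block_Suc_bij[of i N e]]
      bij_betw_same_card[OF monoms_block_Suc_bij[of i N e]] sum_choose_lower[of N e]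
    by (simp only:) simp
qed

lemma monoms_cong:
  "(\<And>i. i \<in> B \<Longrightarrow> n i = n' i) \<Longrightarrow> (\<And>i. i \<in> B \<Longrightarrow> d i = d' i) \<Longrightarrow> monoms B n d = monoms B n' d'"
  by (auto simp: monoms_def vars_def bdeg_def)

lemma card_monoms:
  assumes "finite B"
  shows "finite (monoms B n d) \<and> card (monoms B n d) = (\<Prod>i\<in>B. (n i + d i) choose d i)"
  using assms
proof induction
  case empty
  have "monoms {} n d = {0}" by (auto simp: monoms_def vars_def)
  thus ?case by simp
next
  case (insert i B)
  have "monoms {i} n d = monoms {i} (\<lambda>_. n i) (\<lambda>_. d i)"
    by (rule monoms_cong) auto
  with insert card_monoms_block[of i "n i" "d i"] show ?case
    using bij_betw_finite[OF monoms_insert_bij[of i B n d]]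
      bij_betw_same_card[OF monoms_insert_bij[of i B n d]]
    by (simp add: card_cartesian_product)
qed

lemma finite_monoms: "finite B \<Longrightarrow> finite (monoms B n d)"
  by (simp add: card_monoms)

abbreviation monomial_basis :: "'b set \<Rightarrow> ('b \<Rightarrow> nat) \<Rightarrow> ('b \<Rightarrow> nat) \<Rightarrow> 'b mpoly set" where
  "monomial_basis B n d \<equiv> (\<lambda>m. single m 1) ` monoms B n d"

lemma forms_subset_span: "forms B n d \<subseteq> poly_vs.span (monomial_basis B n d)"
proof
  fix F assume F: "F \<in> forms B n d"
  have "F = (\<Sum>m\<in>keys F. scale_poly (lookup F m) (single m 1))"
    by (subst mpoly_eq_sum) (simp add: scale_poly_def mult_single)
  also have "\<dots> \<in> poly_vs.span (monomial_basis B n d)"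
    using F by (intro poly_vs.span_sum poly_vs.span_scale poly_vs.span_base) (auto simp: forms_iff)
  finally show "F \<in> poly_vs.span (monomial_basis B n d)" .
qed

lemma inj_single_one: "inj (\<lambda>m. single m (1 :: complex))"
  by (rule injI) (metis keys_single zero_neq_one singleton_inject)

lemma dim_forms:
  assumes "finite B"
  shows "poly_vs.dim (forms B n d) = (\<Prod>i\<in>B. (n i + d i) choose d i)"
proof -
  have "poly_vs.independent (monomial_basis B n d)"
  proof (rule poly_vs.independent_if_scalars_zero)
    show "finite (monomial_basis B n d)" using finite_monoms[OF assms] by simp
  next
    fix f x assume *: "(\<Sum>x\<in>monomial_basis B n d. scale_poly (f x) x) = 0"
      and "x \<in> monomial_basis B n d"
    then obtain m where m: "m \<in> monoms B n d" "x = single m 1" by blast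
    have "0 = lookup (\<Sum>m\<in>monoms B n d. scale_poly (f (single m 1)) (single m 1)) m"
      using * by (simp add: sum.reindex inj_on_subset[OF inj_single_one])
    also have "\<dots> = f x"
      using m finite_monoms[OF assms]
      by (simp add: lookup_sum scale_poly_def mult_single lookup_single when_def)
    finally show "f x = 0" by simp
  qed
  hence "poly_vs.dim (forms B n d) = card (monomial_basis B n d)"
    using forms_subset_span by (intro poly_vs.dim_unique) (auto simp: forms_single)
  also have "\<dots> = card (monoms B n d)"
    by (rule card_image) (rule inj_on_subset[OF inj_single_one], simp)
  finally show ?thesis using card_monoms[OF assms] by simp
qed

lemma forms_finite_dim:
  assumes "finite B"
  shows "finite (monomial_basis B n d)" "forms B n d \<subseteq> poly_vs.span (monomial_basis B n d)"
  using finite_monoms[OF assms] by (simp_all add: forms_subset_span)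

section \<open>Double points\<close>

text \<open>Only derivatives are tested: by Euler's formula in a block of positive degree the value
  then vanishes as well (\<open>sing_eval\<close>).\<close>

definition sing :: "'b set \<Rightarrow> ('b \<Rightarrow> nat) \<Rightarrow> ('b \<times> nat \<Rightarrow> complex) \<Rightarrow> 'b mpoly \<Rightarrow> bool" where
  "sing B n x F \<longleftrightarrow> (\<forall>v\<in>vars B n. eval_poly (pd v F) x = 0)"

definition jet :: "('b \<times> nat \<Rightarrow> complex) \<Rightarrow> ('b \<times> nat) option \<Rightarrow> 'b mpoly \<Rightarrow> complex" where
  "jet x u F = (case u of None \<Rightarrow> eval_poly F x | Some v \<Rightarrow> eval_poly (pd v F) x)"

lemma jet_simps [simp]: "jet x None F = eval_poly F x" "jet x (Some v) F = eval_poly (pd v F) x"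
  by (simp_all add: jet_def)

lemma functional_jet: "functional (jet x u)"
  using functional_eval[of x] functional_pd[of _ x] by (cases u) (simp_all add: jet_def functional_def)

text \<open>The affine coordinates of the chart in which the coordinate \<open>(i, c i)\<close> of
  each block is nonzero. Derivatives along them, together with the value, are the
  \<open>1 + n_1 + ... + n_k\<close> conditions of a double point.\<close>

definition chart_vars :: "'b set \<Rightarrow> ('b \<Rightarrow> nat) \<Rightarrow> ('b \<Rightarrow> nat) \<Rightarrow> ('b \<times> nat) set" where
  "chart_vars B n c = vars B n - (\<lambda>i. (i, c i)) ` B"

definition jet_index :: "'b set \<Rightarrow> ('b \<Rightarrow> nat) \<Rightarrow> ('b \<Rightarrow> nat) \<Rightarrow> ('b \<times> nat) option set" where
  "jet_index B n c = insert None (Some ` chart_vars B n c)"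

locale chart_point =
  fixes B :: "'b set" and n d c :: "'b \<Rightarrow> nat" and x :: "'b \<times> nat \<Rightarrow> complex"
  assumes finite_B: "finite B" and B_nonempty: "B \<noteq> {}"
    and d_pos: "\<And>i. i \<in> B \<Longrightarrow> d i > 0"
    and c_le: "\<And>i. i \<in> B \<Longrightarrow> c i \<le> n i" and x_c: "\<And>i. i \<in> B \<Longrightarrow> x (i, c i) \<noteq> 0"
begin

abbreviation "nvars \<equiv> chart_vars B n c"

lemmas nvars_def = chart_vars_def[of B n c]

lemma finite_nvars: "finite nvars"
  using finite_B by (simp add: nvars_def)

lemma card_nvars: "card nvars = (\<Sum>i\<in>B. n i)"
proof -
  have "card nvars = card (vars B n) - card ((\<lambda>i. (i, c i)) ` B)"
    unfolding nvars_def using finite_B c_le by (intro card_Diff_subset) (auto simp: vars_def)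
  also have "card (vars B n) = (\<Sum>i\<in>B. n i) + card B"
    using finite_B by (simp add: vars_def sum.distrib flip: sum_Suc)
  also have "card ((\<lambda>i. (i, c i)) ` B) = card B"
    by (rule card_image) (auto intro: inj_onI)
  finally show ?thesis by simp
qed

lemma finite_jet_index: "finite (jet_index B n c)"
  by (simp add: jet_index_def finite_nvars)

lemma card_jet_index: "card (jet_index B n c) = 1 + (\<Sum>i\<in>B. n i)"
proof -
  have "None \<notin> Some ` nvars" by auto
  thus ?thesis
    by (simp add: jet_index_def finite_nvars card_nvars card_image)
qed

lemma sing_eval:
  assumes F: "F \<in> forms B n d" and s: "sing B n x F"
  shows "eval_poly F x = 0"
proof -
  obtain i where i: "i \<in> B" using B_nonempty by blast
  have "(\<Sum>j\<le>n i. x (i, j) * eval_poly (pd (i, j) F) x) = 0"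
    using s i by (auto simp: sing_def vars_def intro!: sum.neutral)
  thus ?thesis
    using euler_eval[OF F i, of x] d_pos[OF i] by simp
qed

text \<open>The derivative along \<open>(i, c i)\<close> is not among the jets, but Euler's formula
  in block \<open>i\<close> gives it from the value and the other derivatives, because
  \<open>x (i, c i)\<close> is nonzero.\<close>

lemma sing_iff_jets:
  assumes F: "F \<in> forms B n d"
  shows "sing B n x F \<longleftrightarrow> (\<forall>u\<in>jet_index B n c. jet x u F = 0)"
proof
  assume "sing B n x F"
  thus "\<forall>u\<in>jet_index B n c. jet x u F = 0"
    using sing_eval[OF F] by (auto simp: jet_index_def nvars_def sing_def)
next
  assume j: "\<forall>u\<in>jet_index B n c. jet x u F = 0"
  have "eval_poly (pd (i, l) F) x = 0" if i: "i \<in> B" "l \<le> n i" for i l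
  proof (cases "l = c i")
    case False
    hence "(i, l) \<in> nvars" using i by (auto simp: nvars_def vars_def)
    with j show ?thesis by (auto simp: jet_index_def)
  next
    case True
    have "0 = (\<Sum>l\<le>n i. x (i, l) * eval_poly (pd (i, l) F) x)"
      using euler_eval[OF F i(1), of x] j by (simp add: jet_index_def)
    also have "\<dots> = (\<Sum>l\<in>{c i}. x (i, l) * eval_poly (pd (i, l) F) x)"
    proof (rule sum.mono_neutral_right)
      show "\<forall>l\<in>{..n i} - {c i}. x (i, l) * eval_poly (pd (i, l) F) x = 0"
        using j i by (auto simp: jet_index_def nvars_def vars_def)
    qed (use c_le i in auto)
    finally show ?thesis using True x_c[OF i(1)] by simp
  qed
  thus "sing B n x F" by (auto simp: sing_def vars_def)
qed

section \<open>The square of the ideal of a point\<close>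

abbreviation "R \<equiv> coord_ring B n"
abbreviation "I \<equiv> point_ideal B n x"
abbreviation "J \<equiv> double_point_ideal B n x"

lemma ring_ops [simp]:
  "F \<otimes>\<^bsub>R\<^esub> G = F * G" "F \<oplus>\<^bsub>R\<^esub> G = F + G" "\<one>\<^bsub>R\<^esub> = 1" "\<zero>\<^bsub>R\<^esub> = 0"
  by (simp_all add: coord_ring_def)

lemma carrier_iff: "F \<in> carrier R \<longleftrightarrow> (\<forall>m\<in>keys F. keys m \<subseteq> vars B n)"
  by (simp add: coord_ring_def)

lemma forms_carrier: "F \<in> forms B n e \<Longrightarrow> F \<in> carrier R"
  by (simp add: forms_def)

lemma ring_R: "ring R"
  using cring_coord_ring by (rule cring.axioms)

lemma carrier_closed:
  "F \<in> carrier R \<Longrightarrow> G \<in> carrier R \<Longrightarrow> F + G \<in> carrier R"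
  "F \<in> carrier R \<Longrightarrow> G \<in> carrier R \<Longrightarrow> F * G \<in> carrier R"
  "F \<in> carrier R \<Longrightarrow> - F \<in> carrier R"
proof -
  interpret ring R by (rule ring_R)
  show "F \<in> carrier R \<Longrightarrow> G \<in> carrier R \<Longrightarrow> F + G \<in> carrier R"
    using add.m_closed[of F G] by simp
  show "F \<in> carrier R \<Longrightarrow> G \<in> carrier R \<Longrightarrow> F * G \<in> carrier R"
    using m_closed[of F G] by simp
  show "F \<in> carrier R \<Longrightarrow> - F \<in> carrier R"
    by (auto simp: carrier_iff in_keys_iff)
qed

lemma ideal_I: "ideal I R"
  unfolding point_ideal_def by (rule ring.genideal_ideal[OF ring_R]) (auto intro: forms_carrier)

lemma ideal_J: "ideal J R"
  unfolding double_point_ideal_def by (rule ring.ideal_prod_is_ideal[OF ring_R ideal_I ideal_I])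

lemma J_add: "F \<in> J \<Longrightarrow> G \<in> J \<Longrightarrow> F + G \<in> J"
  using additive_subgroup.a_closed[OF ideal.axioms(1)[OF ideal_J], of F G] by simp

lemma J_zero: "0 \<in> J"
  using additive_subgroup.zero_closed[OF ideal.axioms(1)[OF ideal_J]] by simp

lemma J_mult: "F \<in> J \<Longrightarrow> G \<in> carrier R \<Longrightarrow> G * F \<in> J"
  using ideal.I_l_closed[OF ideal_J, of F G] by simp

lemma J_scale: "F \<in> J \<Longrightarrow> scale_poly t F \<in> J"
  by (auto simp: scale_poly_def carrier_iff intro!: J_mult)

lemma J_I: "F \<in> I \<Longrightarrow> G \<in> I \<Longrightarrow> F * G \<in> J"
  unfolding double_point_ideal_def using ideal_prod.prod[of F I G I R] by simp

lemma I_form: "F \<in> forms B n e \<Longrightarrow> eval_poly F x = 0 \<Longrightarrow> F \<in> I"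
  unfolding point_ideal_def
  by (rule subsetD[OF ring.genideal_self[OF ring_R]]) (auto intro: forms_carrier)

text \<open>The polynomials that vanish at \<open>x\<close>, multihomogeneous or not, form an ideal
  that contains the generators of \<open>I\<close>.\<close>

lemma I_eval:
  assumes "F \<in> I"
  shows "eval_poly F x = 0"
proof -
  let ?V = "{F \<in> carrier R. eval_poly F x = 0}"
  interpret ring R by (rule ring_R)
  have inv: "\<ominus>\<^bsub>R\<^esub> F = - F" if "F \<in> carrier R" for F
    using that by (intro minus_equality) (auto intro: carrier_closed)
  have "subgroup ?V (add_monoid R)"
  proof (rule add.subgroupI)
    show "?V \<noteq> {}" using zero_closed by (auto intro!: exI[of _ 0])
    show "a \<in> ?V \<Longrightarrow> \<ominus>\<^bsub>R\<^esub> a \<in> ?V" for a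
      using inv[of a] by (simp add: carrier_closed)
    show "a \<in> ?V \<Longrightarrow> b \<in> ?V \<Longrightarrow> a \<oplus>\<^bsub>R\<^esub> b \<in> ?V" for a b
      by (simp add: carrier_closed)
  qed auto
  hence "ideal ?V R"
    by (rule idealI[OF ring_R]) (simp_all add: carrier_closed)
  hence "I \<subseteq> ?V"
    unfolding point_ideal_def by (rule genideal_minimal) (auto intro: forms_carrier)
  thus ?thesis using assms by blast
qed

lemma J_eval:
  assumes "F \<in> J"
  shows "eval_poly F x = 0 \<and> eval_poly (pd v F) x = 0"
  using assms unfolding double_point_ideal_def
  by (induction rule: ideal_prod.induct) (simp_all add: I_eval)

text \<open>
  Modulo the square of the ideal of the point, each coordinate is a multiple of the coordinate
  \<open>(i, c i)\<close> of its block plus a small \<open>yv v\<close>, so every form is a multiple of \<open>zz d\<close> plus terms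
  linear in the \<open>yv v\<close>.
\<close>

definition yv :: "'b \<times> nat \<Rightarrow> 'b mpoly" where
  "yv v = scale_poly (x (fst v, c (fst v))) (Var v) - scale_poly (x v) (Var (fst v, c (fst v)))"

definition zz :: "('b \<Rightarrow> nat) \<Rightarrow> 'b mpoly" where
  "zz e = (\<Prod>i\<in>B. Var (i, c i) ^ e i)"

lemma Var_form:
  "v \<in> vars B n \<Longrightarrow> Var v \<in> forms B n (\<lambda>i. if i = fst v then 1 else 0)"
  by (cases v) (auto intro!: forms_Var simp: vars_def)

lemma yv_I: "v \<in> vars B n \<Longrightarrow> yv v \<in> I"
  unfolding yv_def
  by (rule I_form[of _ "\<lambda>i. if i = fst v then 1 else 0"])
    (auto intro!: forms_diff forms_scale Var_form forms_Var simp: vars_def c_le)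

lemma Var_carrier: "v \<in> vars B n \<Longrightarrow> Var v \<in> carrier R"
  using Var_form forms_carrier by blast

lemma zz_carrier: "zz e \<in> carrier R"
proof -
  have "zz e \<in> forms B n (\<lambda>i. \<Sum>i'\<in>B. e i' * (if i = i' then 1 else 0))"
    unfolding zz_def by (intro forms_prod forms_power forms_Var) (auto simp: c_le)
  thus ?thesis by (rule forms_carrier)
qed

lemma zz_Suc: "i \<in> B \<Longrightarrow> zz (e(i := Suc (e i))) = Var (i, c i) * zz e"
  by (simp add: zz_def prod.remove[OF finite_B] algebra_simps)

lemma zz_cong: "(\<And>i. i \<in> B \<Longrightarrow> e i = e' i) \<Longrightarrow> zz e = zz e'"
  by (simp add: zz_def)

lemma eval_zz: "eval_poly (zz e) x \<noteq> 0"
  using x_c finite_B by (simp add: zz_def)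

text \<open>On \<open>B\<close> the exponent \<open>f\<close> is \<open>e\<close> lowered by one in
  the block of \<open>v\<close>. This is put additively because \<open>e\<close> may be 0 there, and
  truncated subtraction would then admit a generator of the wrong degree.\<close>

definition taylor_gens :: "('b \<Rightarrow> nat) \<Rightarrow> 'b mpoly set" where
  "taylor_gens e = insert (zz e)
     ({yv v * zz f | v f. v \<in> vars B n \<and> (\<forall>i\<in>B. (f(fst v := Suc (f (fst v)))) i = e i)} \<union> J)"

lemma Var_eq_yv:
  assumes "v \<in> vars B n"
  shows "Var v = scale_poly (inverse (x (fst v, c (fst v))))
    (yv v + scale_poly (x v) (Var (fst v, c (fst v))))"
  using x_c[of "fst v"] assms by (auto simp: yv_def vars_def)

text \<open>The step that raises the degree: \<open>Var w\<close> is a combination of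
  \<open>yv w\<close> and the coordinate \<open>(fst w, c (fst w))\<close>, and a product of two
  factors \<open>yv\<close> falls into \<open>J\<close>.\<close>

lemma taylor_mult_Var:
  assumes w: "w \<in> vars B n" and F: "F \<in> poly_vs.span (taylor_gens e)"
  shows "Var w * F \<in> poly_vs.span (taylor_gens (e(fst w := Suc (e (fst w)))))"
    (is "_ \<in> poly_vs.span ?G'")
proof -
  let ?e' = "e(fst w := Suc (e (fst w)))"
  have iw: "fst w \<in> B" using w by (auto simp: vars_def)
  have core: "Var w * F \<in> poly_vs.span ?G'"
    if "yv w * F \<in> poly_vs.span ?G'" "Var (fst w, c (fst w)) * F \<in> poly_vs.span ?G'" for F
  proof -
    have "Var w * F = scale_poly (inverse (x (fst w, c (fst w))))
        (yv w * F + scale_poly (x w) (Var (fst w, c (fst w)) * F))"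
      by (subst Var_eq_yv[OF w]) (simp add: scale_poly_def algebra_simps)
    thus ?thesis using that by (simp add: poly_vs.span_add poly_vs.span_scale)
  qed
  have Jspan: "G \<in> poly_vs.span ?G'" if "G \<in> J" for G
    using that by (intro poly_vs.span_base) (simp add: taylor_gens_def)
  have yspan: "yv v * zz f \<in> poly_vs.span ?G'"
    if "v \<in> vars B n" "\<forall>i\<in>B. (f(fst v := Suc (f (fst v)))) i = ?e' i" for v f
    using that unfolding taylor_gens_def by (intro poly_vs.span_base) blast
  from F show ?thesis
  proof (induction rule: poly_vs.span_induct_alt)
    case base
    show ?case by (simp add: poly_vs.span_zero)
  next
    case (step t F G)
    have "Var w * F \<in> poly_vs.span ?G'"
    proof -
      from step.hyps consider "F = zz e"
        | v f where "v \<in> vars B n" "\<forall>i\<in>B. (f(fst v := Suc (f (fst v)))) i = e i" "F = yv v * zz f"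
        | "F \<in> J"
        by (auto simp: taylor_gens_def)
      thus ?thesis
      proof cases
        case 1
        have "zz ?e' \<in> poly_vs.span ?G'"
          by (intro poly_vs.span_base) (simp add: taylor_gens_def)
        thus ?thesis
          using 1 w iw by (intro core) (auto simp: zz_Suc intro!: yspan)
      next
        case 2
        have "yv w * F \<in> J"
          unfolding 2 using J_mult[OF J_I[OF yv_I[OF w] yv_I[OF 2(1)]] zz_carrier[of f]]
          by (simp add: algebra_simps)
        moreover have "Var (fst w, c (fst w)) * F = yv v * zz (f(fst w := Suc (f (fst w))))"
          unfolding 2 using iw by (simp add: zz_Suc algebra_simps)
        moreover have "\<dots> \<in> poly_vs.span ?G'"
          using 2 by (intro yspan) auto
        ultimately show ?thesis
          by (intro core) (auto intro: Jspan)
      next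
        case 3
        thus ?thesis using w by (intro Jspan J_mult Var_carrier)
      qed
    qed
    moreover have "Var w * (scale_poly t F + G) = scale_poly t (Var w * F) + Var w * G"
      by (simp add: scale_poly_def algebra_simps)
    ultimately show ?case using step.IH
      by (simp only: poly_vs.span_add poly_vs.span_scale)
  qed
qed

lemma taylor_gens_cong: "(\<And>i. i \<in> B \<Longrightarrow> e i = e' i) \<Longrightarrow> taylor_gens e = taylor_gens e'"
  using zz_cong[of e e'] by (simp add: taylor_gens_def)

lemma single_taylor:
  assumes "keys m \<subseteq> vars B n"
  shows "single m 1 \<in> poly_vs.span (taylor_gens (bdeg n m))"
  using assms
proof (induction "\<Sum>v\<in>vars B n. lookup m v" arbitrary: m)
  case 0
  hence "lookup m v = 0" for v
    using finite_B by (cases "v \<in> vars B n") (auto simp: in_keys_iff)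
  hence "m = 0" by (intro poly_mapping_eqI) simp
  thus ?case by (auto simp: taylor_gens_def zz_def intro!: poly_vs.span_base)
next
  case (Suc k)
  then obtain v where v: "v \<in> vars B n" "lookup m v \<noteq> 0"
    by (metis nat.distinct(1) sum.neutral)
  define m' where "m' = m - single v 1"
  have eq: "m = single v 1 + m'"
    using v by (intro poly_mapping_eqI)
      (auto simp: m'_def lookup_add lookup_minus lookup_single when_def)
  have "Suc k = (\<Sum>w\<in>vars B n. (if v = w then Suc 0 else 0) + lookup m' w)"
    using Suc.hyps(2) by (simp add: eq lookup_add lookup_single when_def)
  hence "k = (\<Sum>w\<in>vars B n. lookup m' w)"
    using v finite_B by (simp add: sum.distrib)
  moreover have "keys m' \<subseteq> vars B n"
    using Suc.prems by (auto simp: m'_def in_keys_iff lookup_minus)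
  ultimately have "single m' 1 \<in> poly_vs.span (taylor_gens (bdeg n m'))"
    by (rule Suc.hyps(1))
  from taylor_mult_Var[OF v(1) this]
  have "single m 1 \<in>
      poly_vs.span (taylor_gens ((bdeg n m')(fst v := Suc (bdeg n m' (fst v)))))"
    by (simp add: Var_def mult_single eq)
  also have "(bdeg n m')(fst v := Suc (bdeg n m' (fst v))) = bdeg n m"
    using v(1) by (cases v) (auto simp: eq bdeg_add bdeg_single vars_def fun_eq_iff)
  finally show ?case .
qed

lemma form_taylor:
  assumes F: "F \<in> forms B n d"
  shows "F \<in> poly_vs.span (taylor_gens d)"
proof -
  have "F = (\<Sum>m\<in>keys F. scale_poly (lookup F m) (single m 1))"
    by (subst mpoly_eq_sum) (simp add: scale_poly_def mult_single)
  also have "\<dots> \<in> poly_vs.span (taylor_gens d)"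
  proof (intro poly_vs.span_sum poly_vs.span_scale)
    fix m assume "m \<in> keys F"
    hence m: "m \<in> monoms B n d" using F by (auto simp: forms_iff)
    show "single m 1 \<in> poly_vs.span (taylor_gens d)"
      using single_taylor[of m] m taylor_gens_cong[of "bdeg n m" d] by (auto simp: monoms_def)
  qed
  finally show ?thesis .
qed

text \<open>Generators with the same \<open>v\<close> coincide, because on \<open>B\<close> the
  exponent \<open>f\<close> is determined by \<open>d\<close>; hence their coefficients can be
  collected into one \<open>\<beta> v\<close>.\<close>

lemma taylor_expansion:
  assumes "F \<in> poly_vs.span (taylor_gens d)"
  shows "\<exists>\<alpha> \<beta> Q. Q \<in> J \<and> F = scale_poly \<alpha> (zz d) +
    (\<Sum>v\<in>nvars. scale_poly (\<beta> v) (yv v * zz (d(fst v := d (fst v) - 1)))) + Q"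
  using assms
proof (induction rule: poly_vs.span_induct_alt)
  case base
  show ?case by (intro exI[of _ 0] exI[of _ "\<lambda>_. 0"]) (simp add: J_zero)
next
  case (step t F G)
  let ?S = "\<lambda>\<beta>. \<Sum>v\<in>nvars. scale_poly (\<beta> v) (yv v * zz (d(fst v := d (fst v) - 1)))"
  obtain \<alpha> \<beta> Q where G: "Q \<in> J" "G = scale_poly \<alpha> (zz d) + ?S \<beta> + Q"
    using step.IH by blast
  have "\<exists>\<alpha> \<beta> Q. Q \<in> J \<and> F = scale_poly \<alpha> (zz d) + ?S \<beta> + Q"
  proof -
    from step.hyps consider "F = zz d"
      | v f where "v \<in> vars B n" "\<forall>i\<in>B. (f(fst v := Suc (f (fst v)))) i = d i" "F = yv v * zz f"
      | "F \<in> J"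
      by (auto simp: taylor_gens_def)
    thus ?thesis
    proof cases
      case 1
      thus ?thesis by (intro exI[of _ 1] exI[of _ "\<lambda>_. 0"] exI[of _ 0]) (simp add: J_zero)
    next
      case 3
      thus ?thesis by (intro exI[of _ 0] exI[of _ "\<lambda>_. 0"] exI[of _ F]) simp
    next
      case 2
      show ?thesis
      proof (cases "v \<in> nvars")
        case False
        \<comment> \<open>For the distinguished coordinate \<open>(i, c i)\<close> the two terms of
          \<open>yv\<close> cancel, so only the chart variables enter the sum.\<close>
        hence "yv v = 0" using 2(1) by (auto simp: nvars_def yv_def)
        thus ?thesis
          by (intro exI[of _ 0] exI[of _ "\<lambda>_. 0"] exI[of _ 0]) (simp add: J_zero 2)
      next
        case True
        have "f i = (d(fst v := d (fst v) - 1)) i" if "i \<in> B" for i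
          using 2(2) that by (cases "i = fst v") (auto dest: bspec[of B _ i])
        hence "zz f = zz (d(fst v := d (fst v) - 1))" by (rule zz_cong)
        hence "F = ?S (\<lambda>w. if w = v then 1 else 0)"
          using True finite_nvars
          by (simp add: 2 if_distrib[of "\<lambda>t. scale_poly t _"] sum.delta cong: if_cong)
        thus ?thesis
          by (intro exI[of _ 0] exI[of _ "\<lambda>w. if w = v then 1 else 0"] exI[of _ 0])
            (simp add: J_zero)
      qed
    qed
  qed
  then obtain \<alpha>' \<beta>' Q' where F: "Q' \<in> J" "F = scale_poly \<alpha>' (zz d) + ?S \<beta>' + Q'" by blast
  have "?S (\<lambda>v. t * \<beta>' v + \<beta> v) = scale_poly t (?S \<beta>') + ?S \<beta>"
    by (simp add: poly_vs.scale_sum_right poly_vs.scale_left_distrib sum.distrib)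
  hence "scale_poly t F + G = scale_poly (t * \<alpha>' + \<alpha>) (zz d) + ?S (\<lambda>v. t * \<beta>' v + \<beta> v)
      + (scale_poly t Q' + Q)"
    by (simp add: F G poly_vs.scale_left_distrib poly_vs.scale_right_distrib)
  moreover have "scale_poly t Q' + Q \<in> J"
    using F G by (intro J_add J_scale)
  ultimately show ?case
    by (intro exI[of _ "t * \<alpha>' + \<alpha>"] exI[of _ "\<lambda>v. t * \<beta>' v + \<beta> v"]
        exI[of _ "scale_poly t Q' + Q"] conjI)
qed

text \<open>In the Taylor expansion the value at \<open>x\<close> isolates \<open>\<alpha>\<close>
  and the derivative along \<open>w\<close> isolates \<open>\<beta> w\<close>, as elements of
  \<open>J\<close> contribute to neither. Only the part in \<open>J\<close> remains.\<close>

lemma sing_in_J: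
  assumes F: "F \<in> forms B n d" and s: "sing B n x F"
  shows "F \<in> J"
proof -
  let ?z = "\<lambda>v. zz (d(fst v := d (fst v) - 1))"
  from taylor_expansion[OF form_taylor[OF F]] obtain \<alpha> \<beta> Q where Q: "Q \<in> J"
    and eq: "F = scale_poly \<alpha> (zz d) + (\<Sum>v\<in>nvars. scale_poly (\<beta> v) (yv v * ?z v)) + Q"
    by (elim exE conjE)
  have y0: "eval_poly (yv v) x = 0" if "v \<in> nvars" for v
    using yv_I I_eval that by (auto simp: nvars_def)
  have "0 = \<alpha> * eval_poly (zz d) x"
    using sing_eval[OF F s] J_eval[OF Q] by (simp add: eq y0)
  hence \<alpha>: "\<alpha> = 0" using eval_zz by simp
  have "\<beta> w = 0" if w: "w \<in> nvars" for w
  proof -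
    have iw: "fst w \<in> B" using w by (auto simp: nvars_def vars_def)
    have nw: "(fst v, c (fst v)) \<noteq> w" if "v \<in> nvars" for v
      using w that by (auto simp: nvars_def vars_def)
    have yd: "eval_poly (pd w (yv v)) x = (if v = w then x (fst w, c (fst w)) else 0)"
      if "v \<in> nvars" for v
      using nw[OF that] by (auto simp: yv_def)
    have "0 = eval_poly (pd w F) x"
      using s w by (simp add: sing_def nvars_def)
    also have "\<dots> = (\<Sum>v\<in>nvars. \<beta> v * (eval_poly (pd w (yv v)) x * eval_poly (?z v) x))"
      using J_eval[OF Q] by (simp add: eq \<alpha> y0)
    also have "\<dots> = (\<Sum>v\<in>nvars. if v = w then \<beta> w * (x (fst w, c (fst w)) * eval_poly (?z w) x) else 0)"
      by (rule sum.cong) (simp_all add: yd)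
    also have "\<dots> = \<beta> w * (x (fst w, c (fst w)) * eval_poly (?z w) x)"
      using w finite_nvars by simp
    finally have "\<beta> w * (x (fst w, c (fst w)) * eval_poly (?z w) x) = 0" by simp
    thus ?thesis using x_c[of "fst w"] iw eval_zz by simp
  qed
  with \<alpha> Q eq show ?thesis by simp
qed

text \<open>The converse direction for sections of the ideal sheaf: at a zero of \<open>F\<close>
  the derivative of \<open>H * F\<close> is that of \<open>F\<close> times the nonzero value of
  \<open>H\<close>.\<close>

lemma sing_mult_cancel:
  assumes F: "F \<in> forms B n d" and H: "eval_poly H x \<noteq> 0" "H * F \<in> J"
  shows "sing B n x F"
proof -
  have "eval_poly F x = 0" using J_eval[OF H(2)] H(1) by simp
  moreover have "eval_poly (pd v (H * F)) x = 0" for v using J_eval[OF H(2)] by blast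
  ultimately show ?thesis using H(1) by (simp add: sing_def)
qed

end

subsection \<open>Renaming blocks\<close>

definition rmon :: "('b \<Rightarrow> 'c) \<Rightarrow> 'b monom \<Rightarrow> 'c monom" where
  "rmon g m = (\<Sum>v\<in>keys m. single (g (fst v), snd v) (lookup m v))"

text \<open>Used in two ways: with \<open>Pair t\<close> it turns a polynomial in one point into a
  polynomial in the \<open>t\<close>-th entry of a tuple, and with an injection of blocks it
  compares two multiprojective spaces.\<close>

definition ren :: "('b \<Rightarrow> 'c) \<Rightarrow> 'b mpoly \<Rightarrow> 'c mpoly" where
  "ren g F = (\<Sum>m\<in>keys F. single (rmon g m) (lookup F m))"

lemma monom_val_sum: "monom_val (sum f A) x = (\<Prod>a\<in>A. monom_val (f a) x)"
  by (induction A rule: infinite_finite_induct) (simp_all add: monom_val_add)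

lemma monom_val_rmon: "monom_val (rmon g m) x = monom_val m (\<lambda>(i, j). x (g i, j))"
  by (simp add: rmon_def monom_val_sum monom_val_single) (simp add: monom_val_def split_def)

lemma ren_single: "ren g (single m c) = single (rmon g m) c"
  by (cases "c = 0") (simp_all add: ren_def)

lemma ren_add [simp]: "ren g (F + G) = ren g F + ren g G"
  unfolding ren_def
  by (rule setsum_keys_plus_distrib) (simp_all add: single_add)

lemma ren_zero [simp]: "ren g 0 = 0"
  by (simp add: ren_def)

lemma eval_ren [simp]: "eval_poly (ren g F) x = eval_poly F (\<lambda>(i, j). x (g i, j))"
  by (induction F rule: mpoly_induct) (simp_all add: ren_single eval_poly_single' monom_val_rmon)

lemma lookup_rmon:
  assumes "keys m \<subseteq> vars B n" "inj_on g B" "i \<in> B"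
  shows "lookup (rmon g m) (g i, j) = lookup m (i, j)"
proof -
  have "lookup (rmon g m) (g i, j) = (\<Sum>v\<in>keys m. if v = (i, j) then lookup m v else 0)"
    unfolding rmon_def lookup_sum
  proof (rule sum.cong)
    fix v assume "v \<in> keys m"
    hence "fst v \<in> B" using assms(1) by (auto simp: vars_def)
    hence "(g (fst v), snd v) = (g i, j) \<longleftrightarrow> v = (i, j)"
      using assms(2,3) by (cases v) (auto dest: inj_onD)
    thus "lookup (single (g (fst v), snd v) (lookup m v)) (g i, j) =
        (if v = (i, j) then lookup m v else 0)"
      by (simp add: lookup_single when_def)
  qed simp
  thus ?thesis by (simp add: in_keys_iff)
qed

lemma lookup_rmon_outside:
  assumes "keys m \<subseteq> vars B n" "i' \<notin> g ` B"
  shows "lookup (rmon g m) (i', j) = 0"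
  unfolding rmon_def lookup_sum
proof (rule sum.neutral, rule ballI)
  fix v assume "v \<in> keys m"
  hence "fst v \<in> B" using assms(1) by (auto simp: vars_def)
  thus "lookup (single (g (fst v), snd v) (lookup m v)) (i', j) = 0"
    using assms(2) by (auto simp: lookup_single when_def)
qed

lemma rmon_monoms:
  assumes m: "m \<in> monoms B n d" and g: "inj_on g B" "g ` B \<subseteq> B'"
    and n: "\<And>i. i \<in> B \<Longrightarrow> n i \<le> n' (g i)"
    and d: "\<And>i. i \<in> B \<Longrightarrow> d' (g i) = d i" "\<And>i'. i' \<in> B' - g ` B \<Longrightarrow> d' i' = 0"
  shows "rmon g m \<in> monoms B' n' d'"
proof -
  have k: "keys m \<subseteq> vars B n" using m by (simp add: monoms_def)
  have z: "lookup m (i, j) = 0" if "n i < j" for i j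
  proof (rule ccontr)
    assume "lookup m (i, j) \<noteq> 0"
    hence "(i, j) \<in> vars B n" using k by (auto simp: in_keys_iff)
    with that show False by (simp add: vars_def)
  qed
  have "keys (rmon g m) \<subseteq> vars B' n'"
  proof
    fix v assume v: "v \<in> keys (rmon g m)"
    hence "fst v \<in> g ` B"
      using lookup_rmon_outside[OF k, of "fst v" g "snd v"] by (cases v) (auto simp: in_keys_iff)
    then obtain i where i: "i \<in> B" "fst v = g i" by blast
    hence "lookup m (i, snd v) \<noteq> 0"
      using v lookup_rmon[OF k g(1) i(1), of "snd v"] by (cases v) (auto simp: in_keys_iff)
    hence "snd v \<le> n i" using z[of i "snd v"] by (cases "n i < snd v") auto
    thus "v \<in> vars B' n'"
      using i n[OF i(1)] g(2) by (cases v) (auto simp: vars_def)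
  qed
  moreover have "bdeg n' (rmon g m) i' = d' i'" if "i' \<in> B'" for i'
  proof (cases "i' \<in> g ` B")
    case True
    then obtain i where i: "i \<in> B" "i' = g i" by blast
    have "bdeg n' (rmon g m) i' = (\<Sum>j\<le>n' (g i). lookup m (i, j))"
      using i by (simp add: bdeg_def lookup_rmon[OF k g(1)])
    also have "\<dots> = bdeg n m i"
      unfolding bdeg_def using n[OF i(1)] z by (intro sum.mono_neutral_right) auto
    finally show ?thesis using i m d(1) by (simp add: monoms_def)
  next
    case False
    thus ?thesis using that d(2) by (simp add: bdeg_def lookup_rmon_outside[OF k])
  qed
  ultimately show ?thesis by (simp add: monoms_def)
qed

lemma ren_form:
  assumes F: "F \<in> forms B n d" and g: "inj_on g B" "g ` B \<subseteq> B'"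
    and n: "\<And>i. i \<in> B \<Longrightarrow> n i \<le> n' (g i)"
    and d: "\<And>i. i \<in> B \<Longrightarrow> d' (g i) = d i" "\<And>i'. i' \<in> B' - g ` B \<Longrightarrow> d' i' = 0"
  shows "ren g F \<in> forms B' n' d'"
  unfolding ren_def
proof (rule forms_sum)
  fix m assume "m \<in> keys F"
  hence "m \<in> monoms B n d" using F by (auto simp: forms_iff)
  from rmon_monoms[OF this g, of n' d'] n d show "single (rmon g m) (lookup F m) \<in> forms B' n' d'"
    by (simp add: forms_single)
qed

section \<open>Semicontinuity\<close>

definition sing_forms ::
    "'b set \<Rightarrow> ('b \<Rightarrow> nat) \<Rightarrow> ('b \<Rightarrow> nat) \<Rightarrow> nat \<Rightarrow> (nat \<Rightarrow> 'b \<times> nat \<Rightarrow> complex) \<Rightarrow> 'b mpoly set" where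
  "sing_forms B n d s P = {F \<in> forms B n d. \<forall>t<s. sing B n (P t) F}"

lemma points_chart:
  assumes "finite B" "B \<noteq> {}" "\<forall>i\<in>B. d i > 0" "x \<in> points B n"
  obtains c where "chart_point B n d c x"
proof -
  have "\<forall>i\<in>B. \<exists>j. j \<le> n i \<and> x (i, j) \<noteq> 0" using assms(4) by (auto simp: points_def)
  then obtain c where "\<forall>i\<in>B. c i \<le> n i \<and> x (i, c i) \<noteq> 0" by metis
  with assms(1-3) show thesis by (intro that[of c]) (simp add: chart_point_def)
qed

text \<open>One inclusion uses the local condition at the points \<open>P t\<close> themselves. For
  the other, a singular form lies in every factor of the intersection, so the denominator 1 works at
  all points.\<close>

lemma ideal_sections_double_points:
  assumes B: "finite B" "B \<noteq> {}" "\<forall>i\<in>B. d i > 0"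
    and P: "\<And>t. t < s \<Longrightarrow> P t \<in> points B n"
  shows "ideal_sections B n
      (carrier (coord_ring B n) \<inter> (\<Inter>t<s. double_point_ideal B n (P t))) d = sing_forms B n d s P"
    (is "ideal_sections B n ?I d = _")
proof (intro subset_antisym subsetI)
  fix F assume F: "F \<in> ideal_sections B n ?I d"
  have "sing B n (P t) F" if t: "t < s" for t
  proof -
    obtain c where "chart_point B n d c (P t)" using points_chart[OF B P[OF t]] by blast
    then interpret chart_point B n d c "P t" .
    obtain H where "eval_poly H (P t) \<noteq> 0" "H * F \<in> ?I"
      using F P[OF t] by (auto simp: ideal_sections_def)
    with t F show ?thesis by (intro sing_mult_cancel) (auto simp: ideal_sections_def)
  qed
  with F show "F \<in> sing_forms B n d s P"
    by (simp add: ideal_sections_def sing_forms_def)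
next
  fix F assume F: "F \<in> sing_forms B n d s P"
  have "F \<in> double_point_ideal B n (P t)" if t: "t < s" for t
  proof -
    obtain c where "chart_point B n d c (P t)" using points_chart[OF B P[OF t]] by blast
    then interpret chart_point B n d c "P t" .
    show ?thesis using F t by (intro sing_in_J) (auto simp: sing_forms_def)
  qed
  moreover have "F \<in> carrier (coord_ring B n)"
    using F by (simp add: sing_forms_def forms_def)
  ultimately have "F \<in> ?I" by blast
  moreover have "1 \<in> (\<Union>d. forms B n d)"
    using forms_one[of B "\<lambda>_. 0"] by blast
  ultimately show "F \<in> ideal_sections B n ?I d"
    using F by (auto simp: ideal_sections_def sing_forms_def intro!: bexI[of _ 1])
qed

text \<open>Each double point is cut out by the jets of a chart adapted to it; the chart may change
  from point to point, the number of jets does not.\<close>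

lemma dim_forms_le_sing_forms:
  assumes B: "finite B" "B \<noteq> {}" "\<forall>i\<in>B. d i > 0"
    and P: "\<And>t. t < s \<Longrightarrow> P t \<in> points B n"
  shows "poly_vs.dim (forms B n d) \<le>
    poly_vs.dim (sing_forms B n d s P) + s * (1 + (\<Sum>i\<in>B. n i))"
proof -
  have "\<forall>t\<in>{..<s}. \<exists>c. chart_point B n d c (P t)"
  proof
    fix t assume "t \<in> {..<s}"
    hence "P t \<in> points B n" using P by simp
    with points_chart[of B d "P t" n] B show "\<exists>c. chart_point B n d c (P t)" by metis
  qed
  then obtain c where "\<forall>t\<in>{..<s}. chart_point B n d (c t) (P t)" by metis
  hence c: "chart_point B n d (c t) (P t)" if "t < s" for t using that by simp
  define I where "I = (SIGMA t:{..<s}. jet_index B n (c t))"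
  define l where "l = (\<lambda>(t, u). jet (P t) u)"
  have fin: "finite I"
    unfolding I_def using chart_point.finite_jet_index[OF c] by auto
  have "kernel_on (forms B n d) I l = sing_forms B n d s P"
    using chart_point.sing_iff_jets[OF c]
    by (auto simp: kernel_on_def I_def l_def sing_forms_def)
  moreover have "functional (l i)" if "i \<in> I" for i
    using functional_jet by (cases i) (simp add: l_def)
  moreover have "card I = s * (1 + (\<Sum>i\<in>B. n i))"
    unfolding I_def using chart_point.finite_jet_index[OF c] chart_point.card_jet_index[OF c]
    by (subst card_SigmaI) auto
  ultimately show ?thesis
    using dim_le_dim_kernel[OF subspace_forms[of B n d] forms_finite_dim[OF B(1)] fin, of l] by simp
qed

section \<open>Minors as forms in the coordinates of a tuple of points\<close>

lemma comm_ring_hom_eval: "comm_ring_hom (\<lambda>F. eval_poly F x)"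
  by unfold_locales simp_all

lemma eval_det: "eval_poly (det A) x = det (map_mat (\<lambda>F. eval_poly F x) A)"
  by (rule comm_ring_hom.hom_det[OF comm_ring_hom_eval, symmetric])

text \<open>All entries of row \<open>i\<close> have the same degree, so every term of the Leibniz
  expansion has the same degree.\<close>

lemma det_form:
  assumes A: "A \<in> carrier_mat r r"
    and e: "\<And>i j. i < r \<Longrightarrow> j < r \<Longrightarrow> A $$ (i, j) \<in> forms B n (e i)"
  shows "det A \<in> forms B n (\<lambda>v. \<Sum>i<r. e i v)"
proof -
  have "signof p * (\<Prod>i = 0..<r. A $$ (i, p i)) \<in> forms B n (\<lambda>v. \<Sum>i<r. e i v)"
    if "p permutes {0..<r}" for p
  proof -
    have "(\<Prod>i = 0..<r. A $$ (i, p i)) \<in> forms B n (\<lambda>v. \<Sum>i\<in>{0..<r}. e i v)"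
      using permutes_in_image[OF that] by (intro forms_prod e) auto
    thus ?thesis
      using forms_uminus[of "\<Prod>i = 0..<r. A $$ (i, p i)" B n]
      by (simp add: sign_def lessThan_atLeast0)
  qed
  thus ?thesis
    unfolding det_def'[OF A] by (intro forms_sum) auto
qed

text \<open>
  A dual system for the partial derivatives at one tuple of points yields a minor that does not
  vanish there.  The minor is a multihomogeneous form in the coordinates of the tuple, and it
  bounds the number of singular forms wherever it does not vanish.
\<close>

lemma rank_open:
  fixes P0 :: "nat \<Rightarrow> 'b \<times> nat \<Rightarrow> complex"
  assumes B: "finite B"
  obtains D e r where "D \<in> forms ({..<s} \<times> B) (\<lambda>(t, i). n i) e"
    "eval_poly D (\<lambda>((t, i), j). P0 t (i, j)) \<noteq> 0"
    "poly_vs.dim (forms B n d) = poly_vs.dim (sing_forms B n d s P0) + r"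
    "\<And>p. eval_poly D p \<noteq> 0 \<Longrightarrow>
      poly_vs.dim (sing_forms B n d s (\<lambda>t (i, j). p ((t, i), j))) + r \<le> poly_vs.dim (forms B n d)"
proof -
  define I where "I = {..<s} \<times> vars B n"
  define l where "l = (\<lambda>(P :: nat \<Rightarrow> 'b \<times> nat \<Rightarrow> complex) (t, v) F. eval_poly (pd v F) (P t))"
  have ker: "kernel_on (forms B n d) I (l P) = sing_forms B n d s P" for P
    by (auto simp: kernel_on_def I_def l_def sing_forms_def sing_def)
  have fl: "functional (l P i)" for P i
    using functional_pd by (cases i) (simp add: l_def)
  have finI: "finite I" using B by (simp add: I_def)
  obtain J F where J: "J \<subseteq> I" "\<And>i. i \<in> J \<Longrightarrow> F i \<in> forms B n d"
    "\<And>i j. i \<in> J \<Longrightarrow> j \<in> J \<Longrightarrow> l P0 i (F j) = (if i = j then 1 else 0)"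
    "kernel_on (forms B n d) J (l P0) = kernel_on (forms B n d) I (l P0)"
    by (rule dual_system_exists[OF subspace_forms finI, of "l P0"]) (rule fl, rule that)
  have finJ: "finite J" using J(1) finI finite_subset by blast
  then obtain js where js: "set js = J" "distinct js" using finite_distinct_list by blast
  define r where "r = length js"
  have cJ: "card J = r" using js distinct_card[of js] by (simp add: r_def)
  have jsJ: "js ! i \<in> J" if "i < r" for i using that js by (auto simp: r_def)
  define A :: "(nat \<times> 'b) mpoly mat" where
    "A = mat r r (\<lambda>(i, j). ren (Pair (fst (js ! i))) (pd (snd (js ! i)) (F (js ! j))))"
  \<comment> \<open>The degree of row \<open>i\<close>: its entries involve only the copy of the
    blocks that belongs to the point at which this row evaluates.\<close>
  define e :: "nat \<Rightarrow> nat \<times> 'b \<Rightarrow> nat" where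
    "e = (\<lambda>i (t, b). if t = fst (js ! i)
      then (d(fst (snd (js ! i)) := d (fst (snd (js ! i))) - 1)) b else 0)"
  have A: "A \<in> carrier_mat r r" by (simp add: A_def)
  have entry: "A $$ (i, j) \<in> forms ({..<s} \<times> B) (\<lambda>(t, i). n i) (e i)" if ij: "i < r" "j < r" for i j
  proof -
    obtain t b b' where tb: "js ! i = (t, (b, b'))" by (metis prod_cases3)
    hence "t < s" "(b, b') \<in> vars B n"
      using jsJ[OF ij(1)] J(1) by (auto simp: I_def)
    thus ?thesis
      using ij tb pd_form[OF J(2)[OF jsJ[OF ij(2)]]]
      by (auto simp: A_def e_def intro!: ren_form[of _ B n "d(b := d b - 1)"] inj_onI)
  qed
  have evA: "map_mat (\<lambda>F. eval_poly F p) A =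
      mat r r (\<lambda>(i, j). l (\<lambda>t (i, j). p ((t, i), j)) (js ! i) (F (js ! j)))" for p
    by (rule eq_matI) (auto simp: A_def l_def split_def)
  \<comment> \<open>At \<open>P0\<close> duality says that the matrix is the identity, so its
    determinant is 1.\<close>
  have "mat r r (\<lambda>(i, j). l P0 (js ! i) (F (js ! j))) = (1\<^sub>m r :: complex mat)"
    using jsJ js by (intro eq_matI) (auto simp: J(3) r_def nth_eq_iff_index_eq)
  hence nz: "eval_poly (det A) (\<lambda>((t, i), j). P0 t (i, j)) \<noteq> 0"
    by (simp add: eval_det evA split_def)
  have bound: "poly_vs.dim (sing_forms B n d s (\<lambda>t (i, j). p ((t, i), j))) + r
      \<le> poly_vs.dim (forms B n d)" if p: "eval_poly (det A) p \<noteq> 0" for p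
  proof -
    define P :: "nat \<Rightarrow> 'b \<times> nat \<Rightarrow> complex" where "P = (\<lambda>t (i, j). p ((t, i), j))"
    define M where "M = mat r r (\<lambda>(i, j). l P (js ! i) (F (js ! j)))"
    have M: "M \<in> carrier_mat r r" by (simp add: M_def)
    have dM: "det M \<noteq> 0"
      using p by (simp add: eval_det evA M_def P_def)
    \<comment> \<open>The forms dual at \<open>P0\<close> are recombined by the columns of the
      inverse of \<open>M\<close>, written with the adjugate, and become dual at
      \<open>P\<close>.\<close>
    define G where "G = (\<lambda>j. \<Sum>k<r. scale_poly (adj_mat M $$ (k, j) / det M) (F (js ! k)))"
    have lG: "l P (js ! i) (G j) = (if i = j then 1 else 0)" if ij: "i < r" "j < r" for i j
    proof -
      have "l P (js ! i) (G j) = (\<Sum>k<r. M $$ (i, k) * adj_mat M $$ (k, j)) / det M"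
        using ij by (simp add: G_def functional_sum[OF fl] functional_scale[OF fl] M_def
            sum_divide_distrib mult.commute)
      also have "(\<Sum>k<r. M $$ (i, k) * adj_mat M $$ (k, j)) = (M * adj_mat M) $$ (i, j)"
        using ij M adj_mat(1)[OF M] by (simp add: scalar_prod_def lessThan_atLeast0)
      also have "\<dots> = (if i = j then det M else 0)"
        using ij by (simp add: adj_mat(2)[OF M])
      finally show ?thesis using dM by auto
    qed
    have "poly_vs.dim (forms B n d) =
        poly_vs.dim (kernel_on (forms B n d) {..<r} (\<lambda>i. l P (js ! i))) + card {..<r}"
    proof (rule dim_kernel_dual[OF subspace_forms forms_finite_dim[OF B]])
      show "G j \<in> forms B n d" if "j \<in> {..<r}" for j
        unfolding G_def using J(2) jsJ by (intro forms_sum forms_scale) auto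
    qed (auto simp: fl lG)
    moreover have "poly_vs.dim (sing_forms B n d s P) \<le>
        poly_vs.dim (kernel_on (forms B n d) {..<r} (\<lambda>i. l P (js ! i)))"
    proof (rule dim_mono_finite[OF forms_finite_dim(1)[OF B]])
      show "kernel_on (forms B n d) {..<r} (\<lambda>i. l P (js ! i)) \<subseteq>
          poly_vs.span (monomial_basis B n d)"
        using forms_subset_span by (auto simp: kernel_on_def)
      show "sing_forms B n d s P \<subseteq> kernel_on (forms B n d) {..<r} (\<lambda>i. l P (js ! i))"
        using jsJ J(1) by (auto simp: kernel_on_def simp flip: ker)
    qed
    ultimately show ?thesis by (simp add: P_def)
  qed
  show thesis
  proof (rule that[OF det_form[OF A entry] nz _ bound])
    have "poly_vs.dim (forms B n d) = poly_vs.dim (kernel_on (forms B n d) J (l P0)) + card J"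
      by (rule dim_kernel_dual[OF subspace_forms forms_finite_dim[OF B] finJ])
        (rule fl, erule J(2), erule (1) J(3))
    thus "poly_vs.dim (forms B n d) = poly_vs.dim (sing_forms B n d s P0) + r"
      by (simp add: J(4) ker cJ)
  qed
qed

lemma hilbert_fun_double_points:
  assumes "n \<noteq> []" "\<forall>i<length n. a ! i > 0"
    and P: "\<And>t. t < s \<Longrightarrow> tuple_entry p t \<in> points {..<length n} ((!) n)"
  shows "hilbert_fun {..<length n} ((!) n) (double_points_ideal n s p) ((!) a) =
    int (poly_vs.dim (forms {..<length n} ((!) n) ((!) a))) -
    int (poly_vs.dim (sing_forms {..<length n} ((!) n) ((!) a) s (tuple_entry p)))"
proof -
  have "{..<length n} \<noteq> {}" using assms(1) by auto
  thus ?thesis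
    unfolding hilbert_fun_def double_points_ideal_def
    using assms(2) P by (subst ideal_sections_double_points) auto
qed

text \<open>One tuple with the expected number of singular forms suffices: \<open>rank_open\<close>
  carries its upper bound to a nonempty open set, and \<open>dim_forms_le_sing_forms\<close> gives
  the lower bound at every tuple.\<close>

lemma T_iff:
  assumes n: "n \<noteq> []" and a: "\<forall>i<length n. a ! i > 0"
  shows "T n a s \<longleftrightarrow> (\<exists>P. (\<forall>t<s. P t \<in> points {..<length n} ((!) n)) \<and>
    poly_vs.dim (sing_forms {..<length n} ((!) n) ((!) a) s P) +
      min (s * (1 + (\<Sum>i<length n. n ! i))) (\<Prod>i<length n. (n ! i + a ! i) choose (a ! i)) =
    (\<Prod>i<length n. (n ! i + a ! i) choose (a ! i)))"
    (is "_ \<longleftrightarrow> (\<exists>P. ?pts P \<and> ?k P + ?m = ?N)")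
proof -
  let ?B = "{..<length n}"
  have dN: "poly_vs.dim (forms ?B ((!) n) ((!) a)) = ?N"
    by (simp add: dim_forms)
  have hilb: "hilbert_fun ?B ((!) n) (double_points_ideal n s p) ((!) a) = int ?m \<longleftrightarrow>
      ?k (tuple_entry p) + ?m = ?N" if "?pts (tuple_entry p)" for p
  proof -
    have "int A - int K = int M \<longleftrightarrow> K + M = A" for A K M :: nat by linarith
    thus ?thesis using that by (subst hilbert_fun_double_points[OF n a]) (simp_all only: dN)
  qed
  have pts: "?pts (tuple_entry p)" if "p \<in> points ({..<s} \<times> ?B) (\<lambda>(t, i). n ! i)" for p
    using that by (force simp: points_def tuple_entry_def vars_def)
  show ?thesis
  proof
    assume "T n a s"
    then obtain U where U: "zariski_open ({..<s} \<times> ?B) (\<lambda>(t, i). n ! i) U" "U \<noteq> {}"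
      "\<forall>p\<in>U. hilbert_fun ?B ((!) n) (double_points_ideal n s p) ((!) a) = int ?m"
      unfolding T_def by blast
    then obtain p where p: "p \<in> U" by blast
    hence "p \<in> points ({..<s} \<times> ?B) (\<lambda>(t, i). n ! i)"
      using U(1) by (auto simp: zariski_open_def)
    from pts[OF this] hilb[of p] U(3) p show "\<exists>P. ?pts P \<and> ?k P + ?m = ?N" by blast
  next
    assume "\<exists>P. ?pts P \<and> ?k P + ?m = ?N"
    then obtain P where P: "?pts P" "?k P + ?m = ?N" by blast
    obtain D e r where D: "D \<in> forms ({..<s} \<times> ?B) (\<lambda>(t, i). n ! i) e"
      "eval_poly D (\<lambda>((t, i), j). P t (i, j)) \<noteq> 0"
      "poly_vs.dim (forms ?B ((!) n) ((!) a)) = ?k P + r"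
      "\<And>p. eval_poly D p \<noteq> 0 \<Longrightarrow>
        ?k (\<lambda>t (i, j). p ((t, i), j)) + r \<le> poly_vs.dim (forms ?B ((!) n) ((!) a))"
      by (rule rank_open[of ?B s "(!) n" P "(!) a"]) auto
    have r: "r = ?m" using D(3) P(2) dN by simp
    define U where "U = points ({..<s} \<times> ?B) (\<lambda>(t, i). n ! i) - {x. \<forall>G\<in>{D}. eval_poly G x = 0}"
    have "zariski_open ({..<s} \<times> ?B) (\<lambda>(t, i). n ! i) U"
      unfolding zariski_open_def U_def using D(1) by (intro exI[of _ "{D}"]) auto
    moreover have "U \<noteq> {}"
    proof -
      \<comment> \<open>Beyond index \<open>s\<close> the family \<open>P\<close> is arbitrary,
        whereas a point must have zero entries outside the variables.\<close>
      define p where "p = (\<lambda>v. if v \<in> vars ({..<s} \<times> ?B) (\<lambda>(t, i). n ! i)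
        then (case v of ((t, i), j) \<Rightarrow> P t (i, j)) else 0)"
      have "p \<in> points ({..<s} \<times> ?B) (\<lambda>(t, i). n ! i)"
        using P(1) by (fastforce simp: points_def p_def vars_def)
      moreover have "eval_poly D p = eval_poly D (\<lambda>((t, i), j). P t (i, j))"
        unfolding eval_poly_def using D(1)
        by (intro sum.cong refl arg_cong2[of _ _ _ _ "(*)"] prod.cong)
          (auto simp: forms_iff monoms_def p_def subset_iff)
      ultimately show ?thesis using D(2) by (auto simp: U_def)
    qed
    moreover have "hilbert_fun ?B ((!) n) (double_points_ideal n s p) ((!) a) = int ?m"
      if p: "p \<in> U" for p
    proof -
      have pp: "?pts (tuple_entry p)" using p pts by (simp add: U_def)
      have "?k (tuple_entry p) + ?m \<le> ?N"
        using D(4)[of p] p dN r by (simp add: U_def tuple_entry_def[abs_def] fun_eq_iff)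
      moreover have "?N \<le> ?k (tuple_entry p) + s * (1 + (\<Sum>i<length n. n ! i))"
        using dim_forms_le_sing_forms[of ?B "(!) a" s "tuple_entry p" "(!) n"] pp n a dN by auto
      ultimately have "?k (tuple_entry p) + ?m = ?N" by linarith
      thus ?thesis using hilb[OF pp] by simp
    qed
    ultimately show "T n a s" unfolding T_def by blast
  qed
qed

section \<open>Monotonicity\<close>

lemma eval_poly_cong:
  assumes F: "F \<in> forms B n d" and xy: "\<And>v. v \<in> vars B n \<Longrightarrow> x v = y v"
  shows "eval_poly F x = eval_poly F y"
  unfolding eval_poly_def using F
  by (intro sum.cong refl arg_cong2[of _ _ _ _ "(*)"] prod.cong)
    (auto simp: forms_iff monoms_def xy subset_iff)

lemma rmon_add: "rmon g (m + m') = rmon g m + rmon g m'"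
  unfolding rmon_def by (rule setsum_keys_plus_distrib) (simp_all add: single_add)

lemma rmon_single: "rmon g (single (i, j) e) = single (g i, j) e"
  by (cases "e = 0") (simp_all add: rmon_def)

lemma ren_sum: "ren g (sum f A) = (\<Sum>a\<in>A. ren g (f a))"
  by (induction A rule: infinite_finite_induct) simp_all

lemma pd_ren:
  assumes F: "F \<in> forms B n d" and g: "inj_on g B" and i: "i \<in> B"
  shows "pd (g i, j) (ren g F) = ren g (pd (i, j) F)"
proof -
  have mono: "pd (g i, j) (ren g (single m c)) = ren g (pd (i, j) (single m c))"
    if m: "m \<in> monoms B n d" for m c
  proof -
    have k: "keys m \<subseteq> vars B n" using m by (simp add: monoms_def)
    show ?thesis
    proof (cases "lookup m (i, j) = 0")
      case True
      thus ?thesis by (simp add: ren_single pd_single lookup_rmon[OF k g i])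
    next
      case False
      define m' where "m' = m - single (i, j) 1"
      have eq: "m = m' + single (i, j) 1"
        using False by (intro poly_mapping_eqI)
          (auto simp: m'_def lookup_add lookup_minus lookup_single when_def)
      have "rmon g m - single (g i, j) 1 = rmon g m'"
        unfolding eq rmon_add rmon_single by simp
      thus ?thesis by (simp add: ren_single pd_single lookup_rmon[OF k g i] m'_def)
    qed
  qed
  have "pd (g i, j) (ren g F) = (\<Sum>m\<in>keys F. pd (g i, j) (ren g (single m (lookup F m))))"
    by (subst mpoly_eq_sum[of F]) (simp add: ren_sum)
  also have "\<dots> = (\<Sum>m\<in>keys F. ren g (pd (i, j) (single m (lookup F m))))"
    using F by (intro sum.cong refl mono) (auto simp: forms_iff)
  also have "\<dots> = ren g (pd (i, j) F)"
    by (subst (2) mpoly_eq_sum[of F]) (simp add: ren_sum)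
  finally show ?thesis .
qed

lemma pd_ren_outside:
  assumes F: "F \<in> forms B n d" and g: "i' \<notin> g ` B"
  shows "pd (i', j) (ren g F) = 0"
proof -
  have "pd (i', j) (single (rmon g m) c) = 0" if "m \<in> monoms B n d" for m c
    using lookup_rmon_outside[of m B n i' g j] that g by (simp add: pd_single monoms_def)
  thus ?thesis
    using F unfolding ren_def pd_sum by (intro sum.neutral) (auto simp: forms_iff)
qed

lemma ren_eq_0:
  assumes F: "F \<in> forms B n d" and g: "inj_on g B" and 0: "ren g F = 0"
  shows "F = 0"
proof (rule poly_mapping_eqI)
  fix m0
  show "lookup F m0 = lookup 0 m0"
  proof (cases "m0 \<in> keys F")
    case True
    have k: "keys m \<subseteq> vars B n" if "m \<in> keys F" for m
      using F that by (auto simp: forms_iff monoms_def)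
    have inj: "m = m0" if m: "m \<in> keys F" and e: "rmon g m = rmon g m0" for m
    proof (rule poly_mapping_eqI)
      fix v
      show "lookup m v = lookup m0 v"
        using lookup_rmon[OF k[OF m] g, of "fst v" "snd v"]
          lookup_rmon[OF k[OF True] g, of "fst v" "snd v"] e
          lookup_zero_notin_vars[OF k[OF m], of "fst v" "snd v"]
          lookup_zero_notin_vars[OF k[OF True], of "fst v" "snd v"]
        by (cases "fst v \<in> B") simp_all
    qed
    have "0 = lookup (ren g F) (rmon g m0)" by (simp add: 0)
    also have "\<dots> = (\<Sum>m\<in>keys F. if m = m0 then lookup F m else 0)"
      unfolding ren_def lookup_sum
      by (rule sum.cong) (auto simp: lookup_single when_def dest: inj)
    also have "\<dots> = lookup F m0" by (simp add: True)
    finally show ?thesis by simp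
  qed (simp add: in_keys_iff)
qed

lemma pd_power_eq_0: "pd v F = 0 \<Longrightarrow> pd v (F ^ e) = 0"
  by (induction e) simp_all

lemma pd_prod_eq_0: "(\<And>a. a \<in> A \<Longrightarrow> pd v (f a) = 0) \<Longrightarrow> pd v (prod f A) = 0"
  by (induction A rule: infinite_finite_induct) simp_all

text \<open>Normalised representatives: the chart with \<open>c = 0\<close> serves for all points at
  once, and powers of the first coordinates take the value 1.\<close>

definition affine :: "'b set \<Rightarrow> ('b \<Rightarrow> nat) \<Rightarrow> ('b \<times> nat \<Rightarrow> complex) \<Rightarrow> bool" where
  "affine B n x \<longleftrightarrow> (\<forall>i\<in>B. x (i, 0) = 1) \<and> (\<forall>v. v \<notin> vars B n \<longrightarrow> x v = 0)"

abbreviation affine_jets :: "'b set \<Rightarrow> ('b \<Rightarrow> nat) \<Rightarrow> ('b \<times> nat) option set" where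
  "affine_jets B n \<equiv> jet_index B n (\<lambda>_. 0)"

lemma affine_jets_iff:
  "u \<in> affine_jets B n \<longleftrightarrow> u = None \<or> (\<exists>i j. u = Some (i, j) \<and> i \<in> B \<and> 0 < j \<and> j \<le> n i)"
  by (auto simp: jet_index_def chart_vars_def vars_def image_iff)

lemma affine_points: "affine B n x \<Longrightarrow> x \<in> points B n"
  by (auto simp: affine_def points_def intro!: exI[of _ 0])

lemma affine_chart:
  "finite B \<Longrightarrow> B \<noteq> {} \<Longrightarrow> \<forall>i\<in>B. d i > 0 \<Longrightarrow> affine B n x \<Longrightarrow> chart_point B n d (\<lambda>_. 0) x"
  by (simp add: chart_point_def affine_def)

text \<open>
  The double points impose independent conditions iff every jet functional has a dual form.
\<close>

definition separates ::
    "'b set \<Rightarrow> ('b \<Rightarrow> nat) \<Rightarrow> ('b \<Rightarrow> nat) \<Rightarrow> nat \<Rightarrow> (nat \<Rightarrow> 'b \<times> nat \<Rightarrow> complex) \<Rightarrow> bool" where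
  "separates B n d s P \<longleftrightarrow> (\<forall>t<s. affine B n (P t)) \<and>
     (\<forall>t<s. \<forall>u\<in>affine_jets B n. \<exists>F\<in>forms B n d. \<forall>t'<s. \<forall>u'\<in>affine_jets B n.
        jet (P t') u' F = (if t' = t \<and> u' = u then 1 else 0))"

definition kills ::
    "'b set \<Rightarrow> ('b \<Rightarrow> nat) \<Rightarrow> ('b \<Rightarrow> nat) \<Rightarrow> nat \<Rightarrow> (nat \<Rightarrow> 'b \<times> nat \<Rightarrow> complex) \<Rightarrow> bool" where
  "kills B n d s P \<longleftrightarrow> (\<forall>t<s. affine B n (P t)) \<and> sing_forms B n d s P = {0}"

lemma sing_forms_affine:
  assumes B: "finite B" "B \<noteq> {}" "\<forall>i\<in>B. d i > 0" and P: "\<forall>t<s. affine B n (P t)"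
  shows "sing_forms B n d s P =
    {F \<in> forms B n d. \<forall>t<s. \<forall>u\<in>affine_jets B n. jet (P t) u F = 0}"
proof -
  have "sing B n (P t) F \<longleftrightarrow> (\<forall>u\<in>affine_jets B n. jet (P t) u F = 0)"
    if "t < s" "F \<in> forms B n d" for t F
    using chart_point.sing_iff_jets[OF affine_chart[OF B]] P that by blast
  thus ?thesis by (auto simp: sing_forms_def)
qed

lemma zero_sing_forms: "0 \<in> sing_forms B n d s P"
  by (simp add: sing_forms_def sing_def)

lemma dim_eq_0_imp:
  assumes "poly_vs.dim V = 0" "finite W" "V \<subseteq> poly_vs.span W"
  shows "V \<subseteq> {0}"
proof -
  obtain A where A: "A \<subseteq> V" "poly_vs.independent A" "V \<subseteq> poly_vs.span A"
    using poly_vs.maximal_independent_subset by blast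
  hence "finite A" "card A = 0"
    using independent_card_le_dim_subset[OF assms(2,3) A(1,2)] assms(1) by auto
  hence "A = {}" by simp
  thus ?thesis using A(3) by (simp add: poly_vs.span_empty)
qed

lemma separates_dim:
  assumes B: "finite B" "B \<noteq> {}" "\<forall>i\<in>B. d i > 0" and S: "separates B n d s P"
  shows "poly_vs.dim (forms B n d) =
    poly_vs.dim (sing_forms B n d s P) + s * (1 + (\<Sum>i\<in>B. n i))"
proof (cases "s = 0")
  case True
  thus ?thesis by (simp add: sing_forms_def)
next
  case False
  have aff: "affine B n (P t)" if "t < s" for t using S that by (simp add: separates_def)
  interpret p0: chart_point B n d "\<lambda>_. 0" "P 0"
    using affine_chart[OF B aff] False by simp
  define I where "I = {..<s} \<times> affine_jets B n"
  define l where "l = (\<lambda>(t, u). jet (P t) u)"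
  have "\<forall>i\<in>I. \<exists>F\<in>forms B n d. \<forall>i'\<in>I. l i' F = (if i' = i then 1 else 0)"
  proof
    fix i assume "i \<in> I"
    then obtain t u where i: "i = (t, u)" "t < s" "u \<in> affine_jets B n" by (auto simp: I_def)
    then obtain F where "F \<in> forms B n d"
      "\<forall>t'<s. \<forall>u'\<in>affine_jets B n. jet (P t') u' F = (if t' = t \<and> u' = u then 1 else 0)"
      using S unfolding separates_def by metis
    thus "\<exists>F\<in>forms B n d. \<forall>i'\<in>I. l i' F = (if i' = i then 1 else 0)"
      using i by (intro bexI[of _ F]) (auto simp: I_def l_def)
  qed
  then obtain F where F: "\<And>i. i \<in> I \<Longrightarrow> F i \<in> forms B n d"
    "\<And>i i'. i \<in> I \<Longrightarrow> i' \<in> I \<Longrightarrow> l i' (F i) = (if i' = i then 1 else 0)"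
    by metis
  have "finite I" using p0.finite_jet_index by (simp add: I_def)
  hence "poly_vs.dim (forms B n d) = poly_vs.dim (kernel_on (forms B n d) I l) + card I"
  proof (rule dim_kernel_dual[OF subspace_forms forms_finite_dim[OF B(1)], where F = F])
    show "functional (l i)" for i by (cases i) (simp add: l_def functional_jet)
    show "l i (F j) = (if i = j then 1 else 0)" if "i \<in> I" "j \<in> I" for i j
      using F(2)[OF that(2,1)] .
  qed (rule F(1))
  moreover have "kernel_on (forms B n d) I l = sing_forms B n d s P"
    using sing_forms_affine[OF B, of s n P] aff by (auto simp: kernel_on_def I_def l_def)
  moreover have "card I = s * (1 + (\<Sum>i\<in>B. n i))"
    using p0.card_jet_index by (simp add: I_def card_cartesian_product)
  ultimately show ?thesis by simp
qed

lemma separates_square_kills: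
  assumes B: "finite B" "B \<noteq> {}" "\<forall>i\<in>B. d i > 0" and S: "separates B n d s P"
    and N: "(\<Prod>i\<in>B. (n i + d i) choose d i) = s * (1 + (\<Sum>i\<in>B. n i))"
  shows "kills B n d s P"
proof -
  have "poly_vs.dim (sing_forms B n d s P) = 0"
    using separates_dim[OF B S] N by (simp add: dim_forms[OF B(1)])
  moreover have "sing_forms B n d s P \<subseteq> poly_vs.span (monomial_basis B n d)"
    using forms_subset_span by (auto simp: sing_forms_def)
  ultimately have "sing_forms B n d s P \<subseteq> {0}"
    by (rule dim_eq_0_imp[OF _ forms_finite_dim(1)[OF B(1)]])
  thus ?thesis using S zero_sing_forms[of B n d s P] by (auto simp: kills_def separates_def)
qed

lemma T_separates:
  assumes n: "n \<noteq> []" and a: "\<forall>i<length n. a ! i > 0"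
    and S: "separates {..<length n} ((!) n) ((!) a) s P"
  shows "T n a s"
proof -
  have B: "finite {..<length n}" "{..<length n} \<noteq> {}" "\<forall>i\<in>{..<length n}. a ! i > 0"
    using n a by auto
  show ?thesis
    unfolding T_iff[OF n a] using separates_dim[OF B S] affine_points S
    by (intro exI[of _ P]) (auto simp: dim_forms separates_def)
qed

lemma T_kills:
  assumes n: "n \<noteq> []" and a: "\<forall>i<length n. a ! i > 0"
    and K: "kills {..<length n} ((!) n) ((!) a) s P"
  shows "T n a s"
proof -
  have B: "finite {..<length n}" "{..<length n} \<noteq> {}" "\<forall>i\<in>{..<length n}. a ! i > 0"
    using n a by auto
  have pts: "P t \<in> points {..<length n} ((!) n)" if "t < s" for t
    using K that by (auto simp: kills_def intro: affine_points)
  have "poly_vs.dim {0 :: nat mpoly} = 0"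
    using poly_vs.dim_le_card[of "{0}" "{}"] by simp
  hence "poly_vs.dim (sing_forms {..<length n} ((!) n) ((!) a) s P) = 0"
    using K by (simp add: kills_def)
  thus ?thesis
    unfolding T_iff[OF n a] using dim_forms_le_sing_forms[OF B, of s P "(!) n"] pts
    by (intro exI[of _ P]) (auto simp: dim_forms min_def)
qed

section \<open>Embeddings of a smaller case into a larger one\<close>

locale block_embedding =
  fixes B0 :: "'c set" and n0 d0 :: "'c \<Rightarrow> nat" and B :: "'b set" and n d :: "'b \<Rightarrow> nat"
    and g :: "'c \<Rightarrow> 'b"
  assumes fin: "finite B" and ne: "B0 \<noteq> {}" and d0_pos: "\<forall>i\<in>B0. d0 i > 0"
    and d_pos: "\<forall>i\<in>B. d i > 0"
    and inj: "inj_on g B0" and img: "g ` B0 \<subseteq> B"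
    and n_le: "\<And>i. i \<in> B0 \<Longrightarrow> n0 i \<le> n (g i)" and d_le: "\<And>i. i \<in> B0 \<Longrightarrow> d0 i \<le> d (g i)"
begin

lemma fin0: "finite B0"
  using inj img fin by (rule inj_on_finite)

lemma B_ne: "B \<noteq> {}"
  using ne img by blast

definition d1 :: "'b \<Rightarrow> nat" where
  "d1 i = (if i \<in> g ` B0 then d0 (inv_into B0 g i) else 0)"

lemma d1_g: "i \<in> B0 \<Longrightarrow> d1 (g i) = d0 i"
  using inj by (simp add: d1_def)

lemma d1_le: "i \<in> B \<Longrightarrow> d1 i \<le> d i"
  using d_le inj by (auto simp: d1_def)

text \<open>The monomial of the missing degree in the first coordinates. It is 1 at affine points
  and constant along the chart directions, so multiplication by it leaves the affine jets
  unchanged.\<close>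

definition W :: "'b mpoly" where
  "W = (\<Prod>i\<in>B. Var (i, 0) ^ (d i - d1 i))"

definition lift :: "'c mpoly \<Rightarrow> 'b mpoly" where
  "lift F = ren g F * W"

lemma W_form: "W \<in> forms B n (\<lambda>i. d i - d1 i)"
proof -
  have "W \<in> forms B n (\<lambda>i. \<Sum>i'\<in>B. (d i' - d1 i') * (if i = i' then 1 else 0))"
    unfolding W_def by (intro forms_prod forms_power forms_Var) auto
  also have "\<dots> = forms B n (\<lambda>i. d i - d1 i)"
    by (rule forms_cong) (simp add: fin if_distrib[of "(*) _"] cong: if_cong)
  finally show ?thesis .
qed

lemma lift_form:
  assumes "F \<in> forms B0 n0 d0"
  shows "lift F \<in> forms B n d"
proof -
  have "ren g F \<in> forms B n d1"
    by (rule ren_form[OF assms inj img]) (auto simp: n_le d1_g, simp add: d1_def)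
  hence "lift F \<in> forms B n (\<lambda>i. d1 i + (d i - d1 i))"
    unfolding lift_def by (rule forms_mult[OF _ W_form])
  also have "\<dots> = forms B n d" by (rule forms_cong) (simp add: d1_le)
  finally show ?thesis .
qed

lemma eval_W: "affine B n x \<Longrightarrow> eval_poly W x = 1"
  by (auto simp: W_def affine_def intro!: prod.neutral)

lemma pd_W: "j > 0 \<Longrightarrow> pd (i, j) W = 0"
  unfolding W_def by (intro pd_prod_eq_0 pd_power_eq_0) simp

definition restrict_point :: "('b \<times> nat \<Rightarrow> complex) \<Rightarrow> 'c \<times> nat \<Rightarrow> complex" where
  "restrict_point x v = (if v \<in> vars B0 n0 then x (g (fst v), snd v) else 0)"

lemma affine_restrict: "affine B n x \<Longrightarrow> affine B0 n0 (restrict_point x)"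
  using img by (auto simp: affine_def restrict_point_def vars_def)

lemma eval_ren_restrict:
  "F \<in> forms B0 n0 e \<Longrightarrow> eval_poly (ren g F) x = eval_poly F (restrict_point x)"
  unfolding eval_ren
  by (rule eval_poly_cong) (auto simp: restrict_point_def)

lemma jet_lift:
  assumes x: "affine B n x" and F: "F \<in> forms B0 n0 d0"
  shows "jet x None (lift F) = jet (restrict_point x) None F"
    and "i \<in> B0 \<Longrightarrow> 0 < j \<Longrightarrow> j \<le> n0 i \<Longrightarrow>
      jet x (Some (g i, j)) (lift F) = jet (restrict_point x) (Some (i, j)) F"
    and "0 < j \<Longrightarrow> \<not> (\<exists>i\<in>B0. i' = g i \<and> j \<le> n0 i) \<Longrightarrow> jet x (Some (i', j)) (lift F) = 0"
proof -
  show "jet x None (lift F) = jet (restrict_point x) None F"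
    using eval_ren_restrict[OF F] by (simp add: lift_def eval_W[OF x])
  show "jet x (Some (g i, j)) (lift F) = jet (restrict_point x) (Some (i, j)) F"
    if "i \<in> B0" "0 < j" "j \<le> n0 i"
  proof -
    have "(i, j) \<in> vars B0 n0" using that by (simp add: vars_def)
    from eval_ren_restrict[OF pd_form[OF F this]] that show ?thesis
      by (simp add: lift_def eval_W[OF x] pd_W pd_ren[OF F inj] del: eval_ren)
  qed
  show "jet x (Some (i', j)) (lift F) = 0" if "0 < j" "\<not> (\<exists>i\<in>B0. i' = g i \<and> j \<le> n0 i)"
  proof -
    have "pd (i', j) (ren g F) = 0"
    proof (cases "i' \<in> g ` B0")
      case True
      then obtain i where i: "i \<in> B0" "i' = g i" by blast
      with that have "(i, j) \<notin> vars B0 n0" by (auto simp: vars_def)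
      hence "pd (i, j) F = 0" by (rule pd_form_outside[OF F])
      thus ?thesis using pd_ren[OF F inj i(1), of j] i by simp
    qed (rule pd_ren_outside[OF F])
    thus ?thesis using that by (simp add: lift_def pd_W)
  qed
qed

lemma lift_jets_zero:
  assumes x: "affine B n x" and F: "F \<in> forms B0 n0 d0"
    and z: "\<forall>u\<in>affine_jets B0 n0. jet (restrict_point x) u F = 0" and u: "u \<in> affine_jets B n"
  shows "jet x u (lift F) = 0"
proof (cases u)
  case None
  thus ?thesis using jet_lift(1)[OF x F] bspec[OF z, of None] by (simp add: affine_jets_iff)
next
  case (Some v)
  then obtain i' j where v: "v = (i', j)" "0 < j" using u by (auto simp: affine_jets_iff)
  show ?thesis
  proof (cases "\<exists>i\<in>B0. i' = g i \<and> j \<le> n0 i")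
    case True
    then obtain i where "i \<in> B0" "i' = g i" "j \<le> n0 i" by blast
    moreover from this v have "Some (i, j) \<in> affine_jets B0 n0" by (simp add: affine_jets_iff)
    ultimately show ?thesis using jet_lift(2)[OF x F, of i j] z v Some by auto
  next
    case False
    thus ?thesis using jet_lift(3)[OF x F v(2)] v Some by simp
  qed
qed

end

text \<open>A form singular at the projected points lifts to a form singular at the original ones,
  because its jets in the directions new to the larger space vanish. The order on the blocks induces
  one on monomials and thereby excludes zero divisors, which allows \<open>W\<close> to be
  cancelled.\<close>

lemma kills_restrict:
  fixes B :: "'b::linorder set"
  assumes "block_embedding B0 n0 d0 B n d g" and K: "kills B n d s P"
  shows "\<exists>P0. kills B0 n0 d0 s P0"
proof -
  interpret block_embedding B0 n0 d0 B n d g by fact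
  define P0 where "P0 t = restrict_point (P t)" for t
  have aff: "affine B n (P t)" if "t < s" for t using K that by (simp add: kills_def)
  have aff0: "affine B0 n0 (P0 t)" if "t < s" for t
    unfolding P0_def by (rule affine_restrict[OF aff[OF that]])
  have "F = 0" if F: "F \<in> sing_forms B0 n0 d0 s P0" for F
  proof -
    have F': "F \<in> forms B0 n0 d0" "\<forall>t<s. \<forall>u\<in>affine_jets B0 n0. jet (P0 t) u F = 0"
      using F sing_forms_affine[OF fin0 ne d0_pos, of s n0 P0] aff0 by auto
    have "jet (P t) u (lift F) = 0" if "t < s" "u \<in> affine_jets B n" for t u
      using F'(2) that unfolding P0_def by (intro lift_jets_zero[OF aff F'(1)]) auto
    hence "lift F \<in> sing_forms B n d s P"
      using sing_forms_affine[OF fin B_ne d_pos, of s n P] aff lift_form[OF F'(1)] by simp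
    hence "ren g F * W = 0" using K by (simp add: kills_def lift_def)
    moreover have "W \<noteq> 0"
    proof
      assume "W = 0"
      hence "eval_poly W (\<lambda>_. 1) = 0" by simp
      thus False by (simp add: W_def)
    qed
    ultimately have "ren g F = 0" by simp
    thus "F = 0" by (rule ren_eq_0[OF F'(1) inj])
  qed
  thus ?thesis
    using aff0 zero_sing_forms[of B0 n0 d0 s P0]
    by (intro exI[of _ P0]) (auto simp: kills_def)
qed

text \<open>
  In a direction \<open>(i, j)\<close> that is new in the larger space, the product of the coordinate with a
  derivative of the form dual to the value at a point is the required dual form, by Euler's formula.
\<close>

lemma separates_extend:
  assumes "block_embedding B0 n0 d0 B n d g" and S: "separates B0 n0 d0 s P0"
  shows "\<exists>P. separates B n d s P"
proof -
  interpret block_embedding B0 n0 d0 B n d g by fact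
  \<comment> \<open>The old points are placed in the larger space with all new coordinates 0, except
    for the first coordinate 1 of each new block.\<close>
  define P where "P t v = (if v \<in> vars B n then
      (if fst v \<in> g ` B0 then P0 t (inv_into B0 g (fst v), snd v)
       else if snd v = 0 then 1 else 0) else 0)" for t v
  have aff0: "affine B0 n0 (P0 t)" if "t < s" for t using S that by (simp add: separates_def)
  have aff: "affine B n (P t)" if t: "t < s" for t
  proof -
    have "P t (i, 0) = 1" if "i \<in> B" for i
      using aff0[OF t] that inj by (auto simp: P_def vars_def affine_def)
    thus ?thesis by (simp add: affine_def P_def)
  qed
  have res: "restrict_point (P t) = P0 t" if t: "t < s" for t
  proof
    fix v
    show "restrict_point (P t) v = P0 t v"
    proof (cases "v \<in> vars B0 n0")
      case True
      hence "fst v \<in> B0" "snd v \<le> n0 (fst v)" by (auto simp: vars_def)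
      hence "(g (fst v), snd v) \<in> vars B n"
        using img n_le[of "fst v"] by (auto simp: vars_def)
      thus ?thesis using True \<open>fst v \<in> B0\<close> inj by (simp add: restrict_point_def P_def)
    next
      case False
      thus ?thesis using aff0[OF t] by (cases v) (simp add: restrict_point_def affine_def)
    qed
  qed
  have new0: "P t (i', j) = 0"
    if "t < s" "0 < j" "\<not> (\<exists>i\<in>B0. i' = g i \<and> j \<le> n0 i)" for t i' j
  proof (cases "i' \<in> g ` B0")
    case True
    then obtain i where i: "i \<in> B0" "i' = g i" by blast
    with that have "(i, j) \<notin> vars B0 n0" by (auto simp: vars_def)
    thus ?thesis using aff0[OF that(1)] i inj by (simp add: P_def affine_def)
  qed (use that in \<open>simp add: P_def\<close>)
  have dual0: "\<exists>F\<in>forms B0 n0 d0. \<forall>t'<s. \<forall>u'\<in>affine_jets B0 n0.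
      jet (P0 t') u' F = (if t' = t \<and> u' = u then 1 else 0)"
    if "t < s" "u \<in> affine_jets B0 n0" for t u
    using S that unfolding separates_def by blast
  \<comment> \<open>For a direction of the small space the lifted dual form works, since its jets in
    all new directions are 0.\<close>
  have old: "\<exists>F\<in>forms B n d. \<forall>t'<s. \<forall>u'\<in>affine_jets B n.
      jet (P t') u' F = (if t' = t \<and> u' = map_option (map_prod g id) u then 1 else 0)"
    if t: "t < s" and u: "u \<in> affine_jets B0 n0" for t u
  proof -
    obtain F where F: "F \<in> forms B0 n0 d0" "\<forall>t'<s. \<forall>u'\<in>affine_jets B0 n0.
        jet (P0 t') u' F = (if t' = t \<and> u' = u then 1 else 0)"
      using dual0[OF t u] by blast
    have "jet (P t') u' (lift F) =
        (if t' = t \<and> u' = map_option (map_prod g id) u then 1 else 0)"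
      if t': "t' < s" and u': "u' \<in> affine_jets B n" for t' u'
    proof (cases u')
      case None
      have "jet (P0 t') None F = (if t' = t \<and> None = u then 1 else 0)"
        using F(2)[rule_format, OF t', of None] by (simp add: affine_jets_iff)
      thus ?thesis
        using jet_lift(1)[OF aff[OF t'] F(1)] t' None by (cases u) (simp_all add: res)
    next
      case (Some v)
      then obtain i' j where v: "v = (i', j)" "0 < j" using u' by (auto simp: affine_jets_iff)
      show ?thesis
      proof (cases "\<exists>i\<in>B0. i' = g i \<and> j \<le> n0 i")
        case True
        then obtain i where i: "i \<in> B0" "i' = g i" "j \<le> n0 i" by blast
        with v have m: "Some (i, j) \<in> affine_jets B0 n0" by (simp add: affine_jets_iff)
        have "Some (i, j) = u \<longleftrightarrow> Some (g i, j) = map_option (map_prod g id) u"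
          using u i inj by (cases u) (auto simp: affine_jets_iff dest: inj_onD)
        moreover have "jet (P0 t') (Some (i, j)) F = (if t' = t \<and> Some (i, j) = u then 1 else 0)"
          using F(2) t' m by blast
        ultimately show ?thesis
          using jet_lift(2)[OF aff[OF t'] F(1) i(1) v(2) i(3)] v i Some t' by (simp only: res)
      next
        case False
        hence "u' \<noteq> map_option (map_prod g id) u"
          using u v Some by (auto simp: affine_jets_iff)
        thus ?thesis using jet_lift(3)[OF aff[OF t'] F(1) v(2) False] v Some by simp
      qed
    qed
    thus ?thesis using lift_form[OF F(1)] by blast
  qed
  have "\<exists>F\<in>forms B n d. \<forall>t'<s. \<forall>u'\<in>affine_jets B n.
      jet (P t') u' F = (if t' = t \<and> u' = u then 1 else 0)"
    if t: "t < s" and u: "u \<in> affine_jets B n" for t u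
  proof (cases "\<exists>u0\<in>affine_jets B0 n0. u = map_option (map_prod g id) u0")
    case True
    thus ?thesis using old[OF t] by blast
  next
    case False
    have None0: "None \<in> affine_jets B0 n0" by (simp add: affine_jets_iff)
    have "u \<noteq> None"
    proof
      assume "u = None"
      hence "u = map_option (map_prod g id) None" by simp
      with None0 False show False by blast
    qed
    then obtain i' j where ij: "u = Some (i', j)" "i' \<in> B" "0 < j" "j \<le> n i'"
      using u by (auto simp: affine_jets_iff)
    have new: "\<not> (\<exists>i\<in>B0. i' = g i \<and> j \<le> n0 i)"
    proof
      assume "\<exists>i\<in>B0. i' = g i \<and> j \<le> n0 i"
      then obtain i where "i \<in> B0" "i' = g i" "j \<le> n0 i" by blast
      hence "Some (i, j) \<in> affine_jets B0 n0" "u = map_option (map_prod g id) (Some (i, j))"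
        using ij by (auto simp: affine_jets_iff)
      thus False using False by blast
    qed
    obtain E where E: "E \<in> forms B n d" "\<forall>t'<s. \<forall>u'\<in>affine_jets B n.
        jet (P t') u' E = (if t' = t \<and> u' = None then 1 else 0)"
      using old[OF t None0] unfolding option.map by blast
    define G where "G = scale_poly (1 / of_nat (d i')) (pd (i', 0) E)"
    have G: "G \<in> forms B n (d(i' := d i' - 1))"
      unfolding G_def using ij by (intro forms_scale pd_form[OF E(1)]) (simp add: vars_def)
    have evG: "eval_poly G (P t') = (if t' = t then 1 else 0)" if t': "t' < s" for t'
    proof -
      have "of_nat (d i') * eval_poly E (P t') =
          (\<Sum>l\<le>n i'. P t' (i', l) * eval_poly (pd (i', l) E) (P t'))"
        using euler_eval[OF E(1) ij(2)] by simp
      also have "\<dots> = (\<Sum>l\<in>{0}. P t' (i', l) * eval_poly (pd (i', l) E) (P t'))"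
      proof (rule sum.mono_neutral_right)
        show "\<forall>l\<in>{..n i'} - {0}. P t' (i', l) * eval_poly (pd (i', l) E) (P t') = 0"
        proof
          fix l assume "l \<in> {..n i'} - {0}"
          hence "Some (i', l) \<in> affine_jets B n" using ij by (simp add: affine_jets_iff)
          hence "jet (P t') (Some (i', l)) E = 0"
            using E(2)[rule_format, OF t', of "Some (i', l)"] by simp
          thus "P t' (i', l) * eval_poly (pd (i', l) E) (P t') = 0" by simp
        qed
      qed auto
      also have "\<dots> = eval_poly (pd (i', 0) E) (P t')"
        using aff[OF t'] ij by (simp add: affine_def)
      finally have "eval_poly G (P t') = eval_poly E (P t')"
        using d_pos ij by (auto simp: G_def field_simps)
      moreover have "jet (P t') None E = (if t' = t then 1 else 0)"
        using E(2)[rule_format, OF t', of None] by (simp add: affine_jets_iff)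
      ultimately show ?thesis by simp
    qed
    \<comment> \<open>\<open>Var (i', j)\<close> vanishes at every point, so of all jets of
      \<open>H\<close> only the derivative along \<open>(i', j)\<close> survives, and it equals the
      value of \<open>G\<close>.\<close>
    define H where "H = Var (i', j) * G"
    have "H \<in> forms B n (\<lambda>i. (if i = i' then 1 else 0) + (d(i' := d i' - 1)) i)"
      unfolding H_def using ij by (intro forms_mult[OF _ G] forms_Var) auto
    also have "\<dots> = forms B n d"
      using d_pos ij by (intro forms_cong) auto
    finally have "H \<in> forms B n d" .
    moreover have "jet (P t') u' H = (if t' = t \<and> u' = u then 1 else 0)"
      if t': "t' < s" and u': "u' \<in> affine_jets B n" for t' u'
      using new0[OF t' ij(3) new] evG[OF t'] ij by (cases u') (auto simp: H_def)
    ultimately show ?thesis by blast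
  qed
  thus ?thesis using aff by (intro exI[of _ P]) (simp add: separates_def)
qed

text \<open>
  If a block has degree one, the derivatives of a singular form in the directions of that block
  are forms in the other blocks vanishing at the points.
\<close>

lemma kills_linear_block:
  assumes B: "finite B" and b: "b \<in> B" "d b = 1"
    and P: "\<And>t. t < s \<Longrightarrow> affine B n (P t)"
    and dim: "(\<Prod>i\<in>B - {b}. (n i + d i) choose d i) = s"
    and G: "\<And>t. t < s \<Longrightarrow> \<exists>G\<in>forms B n (d(b := 0)).
      \<forall>t'<s. eval_poly G (P t') = (if t' = t then 1 else 0)"
  shows "kills B n d s P"
proof -
  let ?V = "forms B n (d(b := 0))"
  obtain H where H: "\<And>t. t < s \<Longrightarrow> H t \<in> ?V"
    "\<And>t t'. t < s \<Longrightarrow> t' < s \<Longrightarrow> eval_poly (H t) (P t') = (if t' = t then 1 else 0)"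
    using G by metis
  define l where "l = (\<lambda>t F. eval_poly F (P t))"
  have "poly_vs.dim ?V = s"
  proof -
    have "poly_vs.dim ?V = (\<Prod>i\<in>B. (n i + (d(b := 0)) i) choose (d(b := 0)) i)"
      by (rule dim_forms[OF B])
    also have "\<dots> = (\<Prod>i\<in>B - {b}. (n i + d i) choose d i)"
      using b by (simp add: prod.remove[OF B])
    finally show ?thesis using dim by simp
  qed
  moreover have "poly_vs.dim ?V = poly_vs.dim (kernel_on ?V {..<s} l) + card {..<s}"
    using H by (intro dim_kernel_dual[OF subspace_forms forms_finite_dim[OF B], where F = H])
      (auto simp: l_def functional_eval)
  ultimately have "poly_vs.dim (kernel_on ?V {..<s} l) = 0" by simp
  moreover have "kernel_on ?V {..<s} l \<subseteq> poly_vs.span (monomial_basis B n (d(b := 0)))"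
    using forms_subset_span by (auto simp: kernel_on_def)
  ultimately have ker: "kernel_on ?V {..<s} l \<subseteq> {0}"
    by (rule dim_eq_0_imp[OF _ forms_finite_dim(1)[OF B]])
  have "F = 0" if F: "F \<in> sing_forms B n d s P" for F
  proof -
    have Ff: "F \<in> forms B n d" using F by (simp add: sing_forms_def)
    have "pd (b, j) F = 0" if j: "j \<le> n b" for j
    proof -
      have v: "(b, j) \<in> vars B n" using b j by (simp add: vars_def)
      have "pd (b, j) F \<in> ?V" using pd_form[OF Ff v] b by simp
      moreover have "eval_poly (pd (b, j) F) (P t) = 0" if "t < s" for t
        using F v that by (simp add: sing_forms_def sing_def)
      ultimately have "pd (b, j) F \<in> kernel_on ?V {..<s} l"
        by (simp add: kernel_on_def l_def)
      thus ?thesis using ker by blast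
    qed
    hence "scale_poly (of_nat (d b)) F = 0"
      using euler[OF Ff b(1)] by simp
    thus "F = 0" using b by simp
  qed
  thus ?thesis
    using P zero_sing_forms[of B n d s P] by (auto simp: kills_def)
qed

section \<open>The exceptional cases\<close>

text \<open>A repeated member would give the nontrivial relation \<open>F i - F j = 0\<close>, so
  the hypothesis on relations also yields injectivity.\<close>

lemma dim_ge_family:
  assumes I: "finite I" and F: "\<And>i. i \<in> I \<Longrightarrow> F i \<in> V" and V: "finite W" "V \<subseteq> poly_vs.span W"
    and indep: "\<And>c. (\<Sum>i\<in>I. scale_poly (c i) (F i)) = 0 \<Longrightarrow> \<forall>i\<in>I. c i = 0"
  shows "card I \<le> poly_vs.dim V"
proof -
  have inj: "inj_on F I"
  proof (rule inj_onI, rule ccontr)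
    fix i j assume ij: "i \<in> I" "j \<in> I" "F i = F j" "i \<noteq> j"
    define c :: "'a \<Rightarrow> complex" where "c k = (if k = i then 1 else 0) - (if k = j then 1 else 0)" for k
    have "(\<Sum>k\<in>I. scale_poly (c k) (F k)) =
        (\<Sum>k\<in>I. if k = i then F k else 0) - (\<Sum>k\<in>I. if k = j then F k else 0)"
      unfolding sum_subtractf[symmetric]
      by (intro sum.cong) (auto simp: c_def poly_vs.scale_left_diff_distrib)
    also have "\<dots> = 0" using I ij by simp
    finally show False using indep[of c] ij by (auto simp: c_def)
  qed
  have "poly_vs.independent (F ` I)"
  proof (rule poly_vs.independent_if_scalars_zero)
    fix f x assume "(\<Sum>x\<in>F ` I. scale_poly (f x) x) = 0" "x \<in> F ` I"
    thus "f x = 0" using indep[of "f \<circ> F"] by (auto simp: sum.reindex[OF inj])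
  qed (simp add: I)
  thus ?thesis
    using independent_card_le_dim_subset[OF V, of "F ` I"] F by (auto simp: card_image[OF inj])
qed

lemma exists_independent_kernel:
  assumes B: "finite B" and I: "finite I" "\<And>i. i \<in> I \<Longrightarrow> functional (l i)"
    and q: "q + card I \<le> (\<Prod>i\<in>B. (n i + d i) choose d i)"
  obtains S where "S \<subseteq> forms B n d" "poly_vs.independent S" "finite S" "card S = q"
    "\<And>F i. F \<in> S \<Longrightarrow> i \<in> I \<Longrightarrow> l i F = 0"
proof -
  let ?K = "kernel_on (forms B n d) I l"
  have "poly_vs.dim (forms B n d) \<le> poly_vs.dim ?K + card I"
    using I(2) by (rule dim_le_dim_kernel[OF subspace_forms forms_finite_dim[OF B] I(1)])
  hence "q \<le> poly_vs.dim ?K" using q by (simp add: dim_forms[OF B])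
  moreover have "?K \<subseteq> poly_vs.span (monomial_basis B n d)"
    using forms_subset_span by (auto simp: kernel_on_def)
  ultimately obtain S where "S \<subseteq> ?K" "poly_vs.independent S" "finite S" "card S = q"
    by (rule obtain_independent_subset[OF _ forms_finite_dim(1)[OF B]])
  thus thesis by (intro that[of S]) (auto simp: kernel_on_def)
qed

lemma exists_vanishing_forms:
  assumes B: "finite B" and q: "q + s \<le> (\<Prod>i\<in>B. (n i + d i) choose d i)"
  obtains S where "S \<subseteq> forms B n d" "poly_vs.independent S" "finite S" "card S = q"
    "\<And>F t. F \<in> S \<Longrightarrow> t < s \<Longrightarrow> eval_poly F (P t) = 0"
proof -
  obtain S where "S \<subseteq> forms B n d" "poly_vs.independent S" "finite S" "card S = q"
    "\<And>F t. F \<in> S \<Longrightarrow> t \<in> {..<s} \<Longrightarrow> eval_poly F (P t) = 0"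
    using q by (rule_tac exists_independent_kernel[OF B finite_lessThan[of s], of "\<lambda>t F. eval_poly F (P t)" q n d])
      (auto simp: functional_eval)
  thus thesis by (intro that[of S]) auto
qed

lemma singleton_independent_nonzero: "poly_vs.independent S \<Longrightarrow> F \<in> S \<Longrightarrow> F \<noteq> 0"
  using poly_vs.dependent_zero by blast

lemma single_eq_0: "single k x = 0 \<longleftrightarrow> x = 0"
  by (metis lookup_single_eq lookup_zero single_zero)

lemma sing_mult:
  "eval_poly F x = 0 \<Longrightarrow> eval_poly G x = 0 \<Longrightarrow> sing B n x (F * G)"
  by (simp add: sing_def)

lemma forms_subset_blocks:
  assumes F: "F \<in> forms B' n d" and B: "B' \<subseteq> B"
    and d: "\<And>i. i \<in> B' \<Longrightarrow> d' i = d i" "\<And>i. i \<in> B - B' \<Longrightarrow> d' i = 0"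
  shows "F \<in> forms B n d'"
proof -
  have "m \<in> monoms B n d'" if m: "m \<in> monoms B' n d" for m
  proof -
    have k: "keys m \<subseteq> vars B' n" using m by (simp add: monoms_def)
    have "bdeg n m i = d' i" if "i \<in> B" for i
      using m d that bdeg_outside[OF k, of i] by (cases "i \<in> B'") (auto simp: monoms_def)
    moreover have "keys m \<subseteq> vars B n" using k B by (auto simp: vars_def)
    ultimately show ?thesis by (simp add: monoms_def)
  qed
  with F show ?thesis by (auto simp: forms_iff)
qed

lemma forms_degree_0:
  assumes F: "F \<in> forms B n d" and d: "\<And>i. i \<in> B \<Longrightarrow> d i = 0"
  shows "F = single 0 (lookup F 0)"
proof -
  have "m = 0" if m: "m \<in> monoms B n d" for m
  proof (rule poly_mapping_eqI)
    fix v :: "'a \<times> nat"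
    show "lookup m v = lookup 0 v"
    proof (cases "v \<in> vars B n")
      case True
      then obtain i j where v: "v = (i, j)" "i \<in> B" "j \<le> n i" by (auto simp: vars_def)
      have "(\<Sum>j\<le>n i. lookup m (i, j)) = 0" using m d v by (simp add: monoms_def bdeg_def)
      thus ?thesis using v by simp
    next
      case False
      thus ?thesis using m by (auto simp: monoms_def in_keys_iff)
    qed
  qed
  hence "keys F \<subseteq> {0}" using F by (auto simp: forms_iff)
  thus ?thesis
    by (intro poly_mapping_eqI) (auto simp: lookup_single when_def in_keys_iff)
qed

section \<open>Linear forms of one block and their products\<close>

definition unit_deg :: "'b \<Rightarrow> 'b \<Rightarrow> nat" where
  "unit_deg b i = (if i = b then 1 else 0)"

definition lin :: "('b \<Rightarrow> nat) \<Rightarrow> 'b \<Rightarrow> (nat \<Rightarrow> complex) \<Rightarrow> 'b mpoly" where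
  "lin n b c = (\<Sum>j\<le>n b. scale_poly (c j) (Var (b, j)))"

lemma eval_lin: "eval_poly (lin n b c) x = (\<Sum>j\<le>n b. c j * x (b, j))"
  by (simp add: lin_def)

lemma pd_lin: "j \<le> n b \<Longrightarrow> pd (b, j) (lin n b c) = single 0 (c j)"
  by (simp add: lin_def if_distrib[of "scale_poly _"] cong: if_cong)
    (simp add: scale_poly_def)

text \<open>The derivatives are forms of degree 0, hence constants, and Euler's formula reassembles
  the form from them.\<close>

lemma linear_form_eq_lin:
  assumes L: "L \<in> forms B n (unit_deg b)" and b: "b \<in> B"
  obtains c where "L = lin n b c"
proof -
  have "pd (b, j) L = single 0 (lookup (pd (b, j) L) 0)" if "j \<le> n b" for j
    using pd_form[OF L, of b j] b that unit_deg_def[of b]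
    by (intro forms_degree_0[of _ B n "(unit_deg b)(b := 0)"]) (auto simp: vars_def unit_deg_def)
  hence "(\<Sum>j\<le>n b. Var (b, j) * pd (b, j) L) = lin n b (\<lambda>j. lookup (pd (b, j) L) 0)"
    unfolding lin_def scale_poly_def by (intro sum.cong) (auto simp: mult.commute)
  moreover have "(\<Sum>j\<le>n b. Var (b, j) * pd (b, j) L) = L"
    using euler[OF L b] by (simp add: unit_deg_def)
  ultimately show thesis using that by metis
qed

lemma pd_other_block:
  assumes "F \<in> forms B n d" "b \<in> B" "d b = 0"
  shows "pd (b, j) F = 0"
proof (rule pd_notin, rule ballI)
  fix m assume "m \<in> keys F"
  hence m: "m \<in> monoms B n d" using assms(1) by (auto simp: forms_iff)
  show "(b, j) \<notin> keys m"
  proof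
    assume k: "(b, j) \<in> keys m"
    hence "(b, j) \<in> vars B n" using m by (auto simp: monoms_def)
    moreover have "(\<Sum>j\<le>n b. lookup m (b, j)) = 0"
      using m assms(2,3) by (simp add: monoms_def bdeg_def)
    ultimately show False using k by (auto simp: vars_def in_keys_iff)
  qed
qed

text \<open>The members of \<open>S\<close> live in block \<open>b\<close>, those of
  \<open>S'\<close> are free of it. Differentiating a relation along \<open>(b, j)\<close> replaces
  each \<open>L\<close> by its \<open>j\<close>-th coefficient and leaves a relation in
  \<open>S'\<close>; the vanishing of its coefficients for all \<open>j\<close> is, for each
  \<open>M\<close>, a relation in \<open>S\<close>.\<close>

lemma tensor_independent:
  assumes b: "b \<in> B" and S: "S \<subseteq> forms B n (unit_deg b)" "finite S" "poly_vs.independent S"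
    and S': "finite S'" "poly_vs.independent S'" "\<And>M j. M \<in> S' \<Longrightarrow> pd (b, j) M = 0"
    and 0: "(\<Sum>(L, M)\<in>S \<times> S'. scale_poly (c (L, M)) (L * M)) = 0"
  shows "\<forall>p\<in>S \<times> S'. c p = 0"
proof -
  have "\<forall>L\<in>S. \<exists>e. L = lin n b e" using S(1) b linear_form_eq_lin by (metis subsetD)
  then obtain e where e: "\<And>L. L \<in> S \<Longrightarrow> L = lin n b (e L)" by metis
  have coef: "(\<Sum>L\<in>S. c (L, M) * e L j) = 0" if j: "j \<le> n b" and M: "M \<in> S'" for j M
  proof -
    have "pd (b, j) (L * M) = scale_poly (e L j) M" if "L \<in> S" "M \<in> S'" for L M
    proof -
      have "pd (b, j) L = single 0 (e L j)"
        by (subst e[OF that(1)]) (rule pd_lin[where b = b and n = n, OF j])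
      thus ?thesis using S'(3)[OF that(2)] by (simp add: scale_poly_def)
    qed
    hence "pd (b, j) (\<Sum>(L, M)\<in>S \<times> S'. scale_poly (c (L, M)) (L * M)) =
        (\<Sum>(L, M)\<in>S \<times> S'. scale_poly (c (L, M)) (scale_poly (e L j) M))"
      unfolding pd_sum by (intro sum.cong) (auto simp del: pd_mult poly_vs.scale_scale)
    hence "0 = (\<Sum>(L, M)\<in>S \<times> S'. scale_poly (c (L, M)) (scale_poly (e L j) M))"
      by (simp only: 0 pd_zero)
    also have "\<dots> = (\<Sum>M\<in>S'. scale_poly (\<Sum>L\<in>S. c (L, M) * e L j) M)"
      by (simp add: sum.cartesian_product[symmetric] poly_vs.scale_sum_left
          sum.swap[of _ S' S])
    finally show ?thesis
      using poly_vs.independentD[OF S'(2,1) order_refl _ M, of "\<lambda>M. \<Sum>L\<in>S. c (L, M) * e L j"] by simp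
  qed
  have "c (L, M) = 0" if LM: "L \<in> S" "M \<in> S'" for L M
  proof -
    have "(\<Sum>L\<in>S. scale_poly (c (L, M)) L) = (\<Sum>L\<in>S. scale_poly (c (L, M)) (lin n b (e L)))"
      using e by (intro sum.cong refl) simp
    also have "\<dots> = (\<Sum>j\<le>n b. scale_poly (\<Sum>L\<in>S. c (L, M) * e L j) (Var (b, j)))"
      by (simp add: lin_def poly_vs.scale_sum_right poly_vs.scale_sum_left sum.swap[of _ S])
    also have "\<dots> = 0" using coef LM(2) by (intro sum.neutral) auto
    finally show ?thesis
      using poly_vs.independentD[OF S(3,2) order_refl _ LM(1), of "\<lambda>L. c (L, M)"] by simp
  qed
  thus ?thesis by auto
qed

lemma dim_sing_tensor:
  assumes B: "finite B" and b: "b \<in> B"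
    and S: "S \<subseteq> forms B n (unit_deg b)" "finite S" "poly_vs.independent S"
    and S': "S' \<subseteq> forms B n d'" "d' b = 0" "finite S'" "poly_vs.independent S'"
    and d: "\<And>i. i \<in> B \<Longrightarrow> unit_deg b i + d' i = d i"
    and sing: "\<And>L M t. L \<in> S \<Longrightarrow> M \<in> S' \<Longrightarrow> t < s \<Longrightarrow> sing B n (P t) (L * M)"
  shows "card S * card S' \<le> poly_vs.dim (sing_forms B n d s P)"
proof -
  have "card (S \<times> S') \<le> poly_vs.dim (sing_forms B n d s P)"
  proof (rule dim_ge_family[where F = "\<lambda>(L, M). L * M"])
    fix p assume p: "p \<in> S \<times> S'"
    then obtain L M where LM: "p = (L, M)" "L \<in> S" "M \<in> S'" by auto
    hence "L * M \<in> forms B n (\<lambda>i. unit_deg b i + d' i)"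
      using S S' by (intro forms_mult) auto
    also have "\<dots> = forms B n d" using d by (rule forms_cong)
    finally show "(case p of (L, M) \<Rightarrow> L * M) \<in> sing_forms B n d s P"
      using LM sing by (simp add: sing_forms_def)
  next
    show "finite (monomial_basis B n d)" by (rule forms_finite_dim[OF B])
    show "sing_forms B n d s P \<subseteq> poly_vs.span (monomial_basis B n d)"
      using forms_subset_span by (auto simp: sing_forms_def)
  next
    fix c assume "(\<Sum>p\<in>S \<times> S'. scale_poly (c p) (case p of (L, M) \<Rightarrow> L * M)) = 0"
    hence 0: "(\<Sum>(L, M)\<in>S \<times> S'. scale_poly (c (L, M)) (L * M)) = 0" by (simp add: split_def)
    show "\<forall>p\<in>S \<times> S'. c p = 0"
    proof (rule tensor_independent[OF b S S'(3,4) _ 0])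
      show "pd (b, j) M = 0" if "M \<in> S'" for M j
        by (rule pd_other_block[where d = d' and B = B and n = n]) (use that S'(1,2) b in auto)
    qed
  qed (use S S' in auto)
  thus ?thesis by (simp add: card_cartesian_product)
qed

text \<open>
  More singular forms than expected at every tuple: the expected number is the maximum of \<open>0\<close> and
  \<open>N - s (1 + n\<^sub>1 + \<dots> + n\<^sub>k)\<close>, where \<open>N\<close> is the number of monomials.
\<close>

definition excess :: "'b set \<Rightarrow> ('b \<Rightarrow> nat) \<Rightarrow> ('b \<Rightarrow> nat) \<Rightarrow> nat \<Rightarrow> bool" where
  "excess B n d s \<longleftrightarrow> (\<forall>P. (\<forall>t<s. P t \<in> points B n) \<longrightarrow>
     0 < poly_vs.dim (sing_forms B n d s P) \<and>
     (\<Prod>i\<in>B. (n i + d i) choose d i) <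
       poly_vs.dim (sing_forms B n d s P) + s * (1 + (\<Sum>i\<in>B. n i)))"

lemma excess_not_T:
  assumes n: "n \<noteq> []" and a: "\<forall>i<length n. a ! i > 0"
    and E: "excess {..<length n} ((!) n) ((!) a) s"
  shows "\<not> T n a s"
proof
  assume "T n a s"
  then obtain P where P: "\<forall>t<s. P t \<in> points {..<length n} ((!) n)"
    and eq: "poly_vs.dim (sing_forms {..<length n} ((!) n) ((!) a) s P) +
      min (s * (1 + (\<Sum>i<length n. n ! i))) (\<Prod>i<length n. (n ! i + a ! i) choose (a ! i)) =
      (\<Prod>i<length n. (n ! i + a ! i) choose (a ! i))"
    unfolding T_iff[OF n a] by blast
  from E P have "0 < poly_vs.dim (sing_forms {..<length n} ((!) n) ((!) a) s P) \<and>
      (\<Prod>i<length n. (n ! i + a ! i) choose (a ! i)) <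
      poly_vs.dim (sing_forms {..<length n} ((!) n) ((!) a) s P) + s * (1 + (\<Sum>i<length n. n ! i))"
    unfolding excess_def by blast
  with eq show False by (auto simp: min_def split: if_splits)
qed

lemma sing_forms_nonzero_dim:
  assumes B: "finite B" and F: "F \<in> sing_forms B n d s P" "F \<noteq> 0"
  shows "0 < poly_vs.dim (sing_forms B n d s P)"
proof (rule ccontr)
  assume "\<not> ?thesis"
  moreover have "sing_forms B n d s P \<subseteq> poly_vs.span (monomial_basis B n d)"
    using forms_subset_span by (auto simp: sing_forms_def)
  ultimately have "sing_forms B n d s P \<subseteq> {0}"
    using dim_eq_0_imp[OF _ forms_finite_dim(1)[OF B]] by blast
  with F show False by blast
qed

subsection \<open>Segre varieties with two or three factors\<close>

text \<open>The forms are products of a linear form of each factor, both through the four points.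
  With \<open>n i1 = x + 4\<close> and \<open>n i2 = y + 4\<close> there are
  \<open>(x + 1) * (y + 1)\<close> of them, twelve more than the number of forms minus the number of
  conditions, \<open>x * y + x + y - 11\<close>.\<close>

lemma sing_forms_segre2:
  fixes P :: "nat \<Rightarrow> 'b \<times> nat \<Rightarrow> complex"
  assumes "i1 \<noteq> i2" "d i1 = 1" "d i2 = 1" "n i1 \<ge> 4" "n i2 \<ge> 4"
  shows "(n i1 - 3) * (n i2 - 3) \<le> poly_vs.dim (sing_forms {i1, i2} n d 4 P)"
proof -
  have q: "(n b - 3) + 4 \<le> (\<Prod>i\<in>{i1, i2}. (n i + unit_deg b i) choose unit_deg b i)" if "b \<in> {i1, i2}" for b
    using that assms by (auto simp: unit_deg_def)
  obtain S1 where S1: "S1 \<subseteq> forms {i1, i2} n (unit_deg i1)" "poly_vs.independent S1" "finite S1"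
    "card S1 = n i1 - 3" "\<And>F t. F \<in> S1 \<Longrightarrow> t < 4 \<Longrightarrow> eval_poly F (P t) = 0"
    by (rule exists_vanishing_forms[OF _ q[of i1], of P]) (simp, simp, rule that)
  obtain S2 where S2: "S2 \<subseteq> forms {i1, i2} n (unit_deg i2)" "poly_vs.independent S2" "finite S2"
    "card S2 = n i2 - 3" "\<And>F t. F \<in> S2 \<Longrightarrow> t < 4 \<Longrightarrow> eval_poly F (P t) = 0"
    by (rule exists_vanishing_forms[OF _ q[of i2], of P]) (simp, simp, rule that)
  have "card S1 * card S2 \<le> poly_vs.dim (sing_forms {i1, i2} n d 4 P)"
    by (rule dim_sing_tensor[OF _ _ S1(1,3,2) S2(1) _ S2(3,2)])
      (use assms S1(5) S2(5) in \<open>auto simp: unit_deg_def intro!: sing_mult\<close>)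
  thus ?thesis using S1 S2 by simp
qed

text \<open>Products of the \<open>n i3 - 3\<close> linear forms through the points with the pencil
  of forms of degree (1, 1) on the first two factors, a space of dimension 6 cut by four points. For
  \<open>n i3 = m\<close> this gives \<open>2 * m - 6\<close>, whereas forms minus conditions is
  \<open>2 * m - 10\<close>.\<close>

lemma sing_forms_segre_12m:
  fixes P :: "nat \<Rightarrow> 'b \<times> nat \<Rightarrow> complex"
  assumes i: "distinct [i1, i2, i3]" and d: "d i1 = 1" "d i2 = 1" "d i3 = 1"
    and n: "n i1 = 1" "n i2 = 2" "n i3 \<ge> 4"
  shows "(n i3 - 3) * 2 \<le> poly_vs.dim (sing_forms {i1, i2, i3} n d 4 P)"
proof -
  let ?e' = "\<lambda>i. 1 - unit_deg i3 i"
  have q: "(n i3 - 3) + 4 \<le> (\<Prod>i\<in>{i1, i2, i3}. (n i + unit_deg i3 i) choose unit_deg i3 i)"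
    "2 + 4 \<le> (\<Prod>i\<in>{i1, i2, i3}. (n i + ?e' i) choose ?e' i)"
    using i n by (auto simp: unit_deg_def)
  obtain S1 where S1: "S1 \<subseteq> forms {i1, i2, i3} n (unit_deg i3)" "poly_vs.independent S1" "finite S1"
    "card S1 = n i3 - 3" "\<And>F t. F \<in> S1 \<Longrightarrow> t < 4 \<Longrightarrow> eval_poly F (P t) = 0"
    by (rule exists_vanishing_forms[OF _ q(1), of P]) (simp, rule that)
  obtain S2 where S2: "S2 \<subseteq> forms {i1, i2, i3} n ?e'" "poly_vs.independent S2" "finite S2"
    "card S2 = 2" "\<And>F t. F \<in> S2 \<Longrightarrow> t < 4 \<Longrightarrow> eval_poly F (P t) = 0"
    by (rule exists_vanishing_forms[OF _ q(2), of P]) (simp, rule that)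
  have "card S1 * card S2 \<le> poly_vs.dim (sing_forms {i1, i2, i3} n d 4 P)"
    by (rule dim_sing_tensor[OF _ _ S1(1,3,2) S2(1) _ S2(3,2)])
      (use i d S1(5) S2(5) in \<open>auto simp: unit_deg_def intro!: sing_mult\<close>)
  thus ?thesis using S1 S2 by simp
qed

lemma quadratic_factor:
  fixes A :: "'a::comm_ring_1"
  shows "a * ((A - p * B) * (A - q * B)) =
    a * (A * A) + - (a * (p + q)) * (A * B) + a * (p * q) * (B * B)"
  by (simp add: algebra_simps)

text \<open>Square of the pencil of forms of degree \<open>(1, 1)\<close> through the four points.\<close>

lemma sing_forms_12_22:
  fixes P :: "nat \<Rightarrow> 'b::linorder \<times> nat \<Rightarrow> complex"
  assumes "i1 \<noteq> i2" and d: "d i1 = 2" "d i2 = 2" and n: "n i1 = 1" "n i2 = 2"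
  shows "3 \<le> poly_vs.dim (sing_forms {i1, i2} n d 4 P)"
proof -
  have q: "2 + 4 \<le> (\<Prod>i\<in>{i1, i2}. (n i + 1) choose 1)"
    using assms by auto
  obtain S where S: "S \<subseteq> forms {i1, i2} n (\<lambda>_. 1)" "poly_vs.independent S" "finite S"
    "card S = 2" "\<And>F t. F \<in> S \<Longrightarrow> t < 4 \<Longrightarrow> eval_poly F (P t) = 0"
    by (rule exists_vanishing_forms[OF _ q, of P]) (simp, rule that)
  then obtain A B where AB: "S = {A, B}" "A \<noteq> B" by (meson card_2_iff)
  have indep: "u = 0 \<and> v = 0" if "scale_poly u A + scale_poly v B = 0" for u v
  proof -
    have "(\<Sum>F\<in>S. scale_poly (if F = A then u else v) F) = 0"
      using that AB by simp
    from poly_vs.independentD[OF S(2,3) order_refl this, of A]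
      poly_vs.independentD[OF S(2,3) order_refl this, of B] show ?thesis
      using AB by simp
  qed
  have B0: "B \<noteq> 0" using singleton_independent_nonzero[OF S(2), of B] AB by simp
  define F where "F k = (if k = 0 then A * A else if k = 1 then A * B else B * B)" for k :: nat
  have "card {..<3 :: nat} \<le> poly_vs.dim (sing_forms {i1, i2} n d 4 P)"
  proof (rule dim_ge_family[where F = F])
    fix k :: nat
    have "G * H \<in> forms {i1, i2} n d" if "G \<in> S" "H \<in> S" for G H
    proof -
      have "G * H \<in> forms {i1, i2} n (\<lambda>i. 1 + 1)" using that S(1) by (intro forms_mult) auto
      also have "\<dots> = forms {i1, i2} n d" using d by (intro forms_cong) auto
      finally show ?thesis .
    qed
    thus "F k \<in> sing_forms {i1, i2} n d 4 P"
      using S(5) AB by (auto simp: F_def sing_forms_def intro!: sing_mult)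
  next
    show "finite (monomial_basis {i1, i2} n d)" by (rule forms_finite_dim) simp
    show "sing_forms {i1, i2} n d 4 P \<subseteq> poly_vs.span (monomial_basis {i1, i2} n d)"
      using forms_subset_span by (auto simp: sing_forms_def)
  next
    fix c :: "nat \<Rightarrow> complex" assume 0: "(\<Sum>k<3. scale_poly (c k) (F k)) = 0"
    hence eq: "scale_poly (c 0) (A * A) + scale_poly (c 1) (A * B) + scale_poly (c 2) (B * B) = 0"
      by (simp add: numeral_3_eq_3 F_def numeral_2_eq_2)
    \<comment> \<open>The relation is a binary quadratic form in \<open>A\<close> and
      \<open>B\<close>. Over the complex numbers it splits into linear factors, and one of these
      would have to be 0, against the independence of \<open>A\<close> and \<open>B\<close>.\<close>
    have "c 0 = 0"
    proof (rule ccontr)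
      assume c0: "c 0 \<noteq> 0"
      define D where "D = csqrt ((c 1)\<^sup>2 - 4 * c 0 * c 2)"
      define r where "r = (- c 1 + D) / (2 * c 0)"
      define r' where "r' = (- c 1 - D) / (2 * c 0)"
      have "c 0 * (r + r') = - c 1" using c0 by (simp add: r_def r'_def field_simps)
      moreover have "c 0 * (r * r') = c 2"
      proof -
        have "D * D = (c 1)\<^sup>2 - 4 * c 0 * c 2"
          using power2_csqrt[of "(c 1)\<^sup>2 - 4 * c 0 * c 2"] by (simp add: D_def power2_eq_square)
        hence "(- c 1 + D) * (- c 1 - D) = 4 * c 0 * c 2"
          by (simp add: algebra_simps power2_eq_square)
        moreover have "c 0 * (r * r') = (- c 1 + D) * (- c 1 - D) / (4 * c 0)"
          using c0 by (simp add: r_def r'_def)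
        ultimately show ?thesis using c0 by simp
      qed
      moreover have "scale_poly (c 0) ((A - scale_poly r B) * (A - scale_poly r' B)) =
          scale_poly (c 0) (A * A) + scale_poly (- (c 0 * (r + r'))) (A * B) +
          scale_poly (c 0 * (r * r')) (B * B)"
      proof -
        have "single 0 (- (c 0 * (r + r'))) = - (single 0 (c 0) * (single 0 r + single 0 r') :: 'b mpoly)"
          "single 0 (c 0 * (r * r')) = (single 0 (c 0) * (single 0 r * single 0 r') :: 'b mpoly)"
          by (simp_all add: mult_single single_uminus flip: single_add)
        note eqs = this
        show ?thesis unfolding scale_poly_def eqs by (rule quadratic_factor)
      qed
      ultimately have "scale_poly (c 0) ((A - scale_poly r B) * (A - scale_poly r' B)) = 0"
        using eq by simp
      hence "A - scale_poly r B = 0 \<or> A - scale_poly r' B = 0" using c0 by simp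
      hence "\<exists>r. scale_poly 1 A + scale_poly (- r) B = 0" by auto
      thus False using indep by fastforce
    qed
    moreover from this eq have "(scale_poly (c 1) A + scale_poly (c 2) B) * B = 0"
      by (simp add: scale_poly_def algebra_simps)
    with B0 indep have "c 1 = 0 \<and> c 2 = 0" by simp
    ultimately show "\<forall>k\<in>{..<3}. c k = 0"
      by (auto simp: numeral_3_eq_3 less_Suc_eq numeral_2_eq_2)
  qed simp
  thus ?thesis by simp
qed

text \<open>
  The pencils of forms of degree \<open>(1, 0, 1)\<close> and \<open>(0, 1, 1)\<close> through the four points have four
  products.  If the points \<open>u\<^sub>t\<close> of the first plane lie on a line, its equation is used instead.
\<close>

lemma sing_forms_221_112:
  fixes P :: "nat \<Rightarrow> 'b::linorder \<times> nat \<Rightarrow> complex"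
  assumes i: "distinct [i1, i2, i3]" and d: "d i1 = 1" "d i2 = 1" "d i3 = 2"
    and n: "n i1 = 2" "n i2 = 2" "n i3 = 1"
    and P: "\<forall>t<4. P t \<in> points {i1, i2, i3} n"
  shows "4 \<le> poly_vs.dim (sing_forms {i1, i2, i3} n d 4 P)"
proof -
  let ?B = "{i1, i2, i3}"
  have ne: "i1 \<noteq> i2" "i1 \<noteq> i3" "i2 \<noteq> i3" using i by auto
  let ?V = "forms ?B n (unit_deg i1)"
  define l where "l = (\<lambda>t F. eval_poly F (P t))"
  have fl: "functional (l t)" for t by (simp add: l_def functional_eval)
  obtain J f where J: "J \<subseteq> {..<4}" "\<And>t. t \<in> J \<Longrightarrow> f t \<in> ?V"
    "\<And>t t'. t \<in> J \<Longrightarrow> t' \<in> J \<Longrightarrow> l t (f t') = (if t = t' then 1 else 0)"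
    "kernel_on ?V J l = kernel_on ?V {..<4} l"
    by (rule dual_system_exists[OF subspace_forms finite_lessThan[of "4::nat"], of l])
      (rule fl, rule that)
  have finJ: "finite J" using J(1) finite_subset by blast
  have dV: "poly_vs.dim ?V = 3"
    using ne n by (simp add: dim_forms unit_deg_def)
  have dJ: "poly_vs.dim ?V = poly_vs.dim (kernel_on ?V J l) + card J"
    by (rule dim_kernel_dual[OF subspace_forms forms_finite_dim finJ])
      (simp, simp, rule fl, erule J(2), erule (1) J(3))
  show ?thesis
  proof (cases "kernel_on ?V {..<4} l \<subseteq> {0}")
    case False
    then obtain L where L: "L \<in> ?V" "L \<noteq> 0" "\<And>t. t < 4 \<Longrightarrow> eval_poly L (P t) = 0"
      by (auto simp: kernel_on_def l_def)
    let ?e = "\<lambda>i. d i - unit_deg i1 i"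
    \<comment> \<open>The collinear case: the complementary degree is (0, 1, 2), with nine forms, so
      four independent ones pass through the four points.\<close>
    have q: "4 + 4 \<le> (\<Prod>i\<in>?B. (n i + ?e i) choose ?e i)"
      using ne n d by (simp add: unit_deg_def numeral_eq_Suc)
    obtain S where S: "S \<subseteq> forms ?B n ?e" "poly_vs.independent S" "finite S"
      "card S = 4" "\<And>F t. F \<in> S \<Longrightarrow> t < 4 \<Longrightarrow> eval_poly F (P t) = 0"
      by (rule exists_vanishing_forms[OF _ q, of P]) (simp, rule that)
    have "card {L} * card S \<le> poly_vs.dim (sing_forms ?B n d 4 P)"
      by (rule dim_sing_tensor[OF _ _ _ _ _ S(1) _ S(3,2), of i1])
        (use L S(5) d ne in \<open>auto simp: unit_deg_def intro!: sing_mult\<close>)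
    thus ?thesis using S(4) by simp
  next
    case True
    hence "poly_vs.dim (kernel_on ?V J l) \<le> card ({} :: 'b mpoly set)"
      using J(4) by (intro poly_vs.dim_le_card) auto
    hence "card J = 3" using dJ dV by simp
    then obtain a b k where abk: "J = {a, b, k}" "a \<noteq> b" "b \<noteq> k" "a \<noteq> k"
      by (auto simp: card_3_iff)
    have "card ({..<4} - J) = 1" using J(1) finJ \<open>card J = 3\<close> by (simp add: card_Diff_subset)
    then obtain r where r: "{..<4} - J = {r}" by (auto simp: card_1_singleton_iff)
    have tJ: "t \<in> J \<or> t = r" if "t < 4" for t using r that by blast
    have lt: "a < 4" "b < 4" "k < 4" using J(1) abk by auto
    have f: "f t \<in> ?V" if "t \<in> {a, b, k}" for t using J(2) abk(1) that by simp
    have fv: "eval_poly (f t') (P t) = (if t = t' then 1 else 0)"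
      if "t \<in> {a, b, k}" "t' \<in> {a, b, k}" for t t'
      using J(3) abk(1) that by (simp add: l_def)
    \<comment> \<open>The linear form on the projective line whose zero is the third component of
      \<open>P t\<close>. The product \<open>f t * br t\<close> vanishes at the three points of
      \<open>J\<close>: at \<open>P t\<close> because of \<open>br t\<close>, at the other two
      because of \<open>f t\<close>.\<close>
    define br where "br t = scale_poly (P t (i3, 1)) (Var (i3, 0)) -
      scale_poly (P t (i3, 0)) (Var (i3, 1))" for t
    have br_form: "br t \<in> forms ?B n (unit_deg i3)" for t
      unfolding br_def using n by (intro forms_diff forms_scale forms_Var) (auto simp: unit_deg_def)
    have br_self: "eval_poly (br t) (P t) = 0" for t by (simp add: br_def)
    have br0: "br t \<noteq> 0" if "t < 4" for t
    proof
      assume "br t = 0"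
      hence "pd (i3, 0) (br t) = 0" "pd (i3, 1) (br t) = 0" by simp_all
      hence "P t (i3, 0) = 0" "P t (i3, 1) = 0"
        by (simp_all add: br_def scale_poly_def single_eq_0)
      moreover have "\<exists>j\<le>n i3. P t (i3, j) \<noteq> 0" using P that by (auto simp: points_def)
      ultimately show False using n(3) by (auto simp: le_Suc_eq)
    qed
    define w where "w t = eval_poly (f t * br t) (P r)" for t
    \<comment> \<open>\<open>w\<close> records the values of the three products at the remaining
      point \<open>P r\<close>. A point with nonzero value is taken as pivot \<open>k'\<close>, to
      be eliminated from the other two; without such a point the products already pass through
      \<open>P r\<close>.\<close>
    have "\<exists>a' b' k'. {a', b', k'} = {a, b, k} \<and> a' \<noteq> b' \<and> b' \<noteq> k' \<and> a' \<noteq> k' \<and>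
        (w k' \<noteq> 0 \<or> w a' = 0 \<and> w b' = 0 \<and> w k' = 0)"
    proof -
      consider "w k \<noteq> 0" | "w a \<noteq> 0" | "w b \<noteq> 0" | "w a = 0" "w b = 0" "w k = 0" by blast
      thus ?thesis
      proof cases
        case 2
        show ?thesis by (rule exI[of _ k], rule exI[of _ b], rule exI[of _ a]) (use 2 abk in auto)
      next
        case 3
        show ?thesis by (rule exI[of _ a], rule exI[of _ k], rule exI[of _ b]) (use 3 abk in auto)
      qed (use abk in blast)+
    qed
    then obtain a' b' k' where s: "{a', b', k'} = {a, b, k}" "a' \<noteq> b'" "b' \<noteq> k'" "a' \<noteq> k'"
      and w: "w k' \<noteq> 0 \<or> w a' = 0 \<and> w b' = 0 \<and> w k' = 0" by blast
    \<comment> \<open>When \<open>w k' = 0\<close> all three values are 0 and any nonzero factor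
      serves, so that \<open>A\<close> needs no second definition.\<close>
    define \<omega> where "\<omega> = (if w k' = 0 then 1 else w k')"
    have \<omega>: "\<omega> \<noteq> 0" by (simp add: \<omega>_def)
    define A where "A t = scale_poly \<omega> (f t * br t) - scale_poly (w t) (f k' * br k')" for t
    have in3: "a' \<in> {a, b, k}" "b' \<in> {a, b, k}" "k' \<in> {a, b, k}" using s(1) by auto
    have A_form: "A t \<in> forms ?B n (\<lambda>i. unit_deg i1 i + unit_deg i3 i)" if "t \<in> {a', b'}" for t
      unfolding A_def using f in3 br_form that by (intro forms_diff forms_scale forms_mult) auto
    have A_zero: "eval_poly (A t) (P t') = 0" if "t \<in> {a', b'}" "t' < 4" for t t'
    proof (cases "t' = r")
      case True
      have "eval_poly (A t) (P r) = \<omega> * w t - w t * w k'" by (simp add: A_def w_def)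
      also have "\<dots> = 0" using w that by (auto simp: \<omega>_def)
      finally show ?thesis using True by simp
    next
      case False
      hence t': "t' \<in> {a, b, k}" using tJ[OF that(2)] abk(1) by simp
      have z: "eval_poly (f t'' * br t'') (P t') = 0" if "t'' \<in> {a, b, k}" for t''
        using fv[OF t' that] br_self by auto
      show ?thesis using z[of t] z[of k'] in3 that by (auto simp: A_def)
    qed
    have q: "2 + 4 \<le> (\<Prod>i\<in>?B. (n i + (unit_deg i2 i + unit_deg i3 i)) choose (unit_deg i2 i + unit_deg i3 i))"
      using ne n by (simp add: unit_deg_def)
    obtain S where S: "S \<subseteq> forms ?B n (\<lambda>i. unit_deg i2 i + unit_deg i3 i)"
      "poly_vs.independent S" "finite S" "card S = 2"
      "\<And>F t. F \<in> S \<Longrightarrow> t < 4 \<Longrightarrow> eval_poly F (P t) = 0"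
      by (rule exists_vanishing_forms[OF _ q, of P]) (simp, rule that)
    have S1: "pd (i1, j) M = 0" if "M \<in> S" for M j
      by (rule pd_other_block[OF subsetD[OF S(1) that]]) (use ne in \<open>auto simp: unit_deg_def\<close>)
    \<comment> \<open>The directional derivative in block \<open>i1\<close> along the first
      component of \<open>P t\<close>. It maps \<open>f t'\<close> to the constant 1 or 0 and treats
      factors free of block \<open>i1\<close> as constants, so it isolates the terms with
      \<open>A t\<close> in a linear relation.\<close>
    define D where "D t G = (\<Sum>j\<le>n i1. scale_poly (P t (i1, j)) (pd (i1, j) G))" for t G
    have D_mult: "D t (G * H) = D t G * H" if "\<And>j. pd (i1, j) H = 0" for t G H
      by (simp add: D_def that sum_distrib_right scale_poly_def mult.assoc)
    have D_lin: "D t (scale_poly x G) = scale_poly x (D t G)"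
      "D t (G - H) = D t G - D t H" "D t (sum h X) = (\<Sum>y\<in>X. D t (h y))" for t x G H h and X :: "'c set"
      by (simp_all add: D_def poly_vs.scale_sum_right poly_vs.scale_right_diff_distrib sum_subtractf
          mult.commute sum.swap[of _ "{..n i1}"])
    have D_f: "D t (f t') = (if t = t' then 1 else 0)" if "t \<in> {a, b, k}" "t' \<in> {a, b, k}" for t t'
    proof -
      have "f t' \<in> ?V" by (rule f) (rule that(2))
      then obtain e where e: "f t' = lin n i1 e"
        by (rule linear_form_eq_lin) (simp, rule that)
      have "D t (f t') = single 0 (\<Sum>j\<le>n i1. e j * P t (i1, j))"
        unfolding D_def e single_sum
        by (intro sum.cong refl) (simp add: pd_lin scale_poly_def mult_single mult.commute)
      also have "(\<Sum>j\<le>n i1. e j * P t (i1, j)) = eval_poly (f t') (P t)"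
        by (simp add: e eval_lin)
      finally show ?thesis using fv[OF that] by simp
    qed
    have br1: "pd (i1, j) (br t) = 0" for t j
      using ne by (simp add: br_def scale_poly_def)
    have D_A: "D t (A t') = (if t = t' then scale_poly \<omega> (br t) else 0)"
      if "t \<in> {a', b'}" "t' \<in> {a', b'}" for t t'
    proof -
      have t: "t \<in> {a, b, k}" "t' \<in> {a, b, k}" "t \<noteq> k'" using that in3 s by blast+
      have "D t (A t') = scale_poly \<omega> (D t (f t') * br t') - scale_poly (w t') (D t (f k') * br k')"
        unfolding A_def D_lin(1,2) D_mult[OF br1] ..
      also have "D t (f k') = 0" using D_f[OF t(1) in3(3)] t(3) by simp
      also have "D t (f t') = (if t = t' then 1 else 0)" by (rule D_f[OF t(1,2)])
      finally show ?thesis by (auto simp: poly_vs.scale_zero_right)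
    qed
    have "card ({a', b'} \<times> S) \<le> poly_vs.dim (sing_forms ?B n d 4 P)"
    proof (rule dim_ge_family[where F = "\<lambda>(t, M). A t * M"])
      fix p assume p: "p \<in> {a', b'} \<times> S"
      then obtain t M where tM: "p = (t, M)" "t \<in> {a', b'}" "M \<in> S" by auto
      hence "A t * M \<in> forms ?B n (\<lambda>i. (unit_deg i1 i + unit_deg i3 i) + (unit_deg i2 i + unit_deg i3 i))"
        using S(1) by (intro forms_mult A_form) auto
      also have "\<dots> = forms ?B n d" using d ne by (intro forms_cong) (auto simp: unit_deg_def)
      finally have "A t * M \<in> forms ?B n d" .
      moreover have "sing ?B n (P t') (A t * M)" if "t' < 4" for t'
        by (rule sing_mult[OF A_zero[OF tM(2) that] S(5)[OF tM(3) that]])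
      ultimately show "(case p of (t, M) \<Rightarrow> A t * M) \<in> sing_forms ?B n d 4 P"
        by (simp add: tM(1) sing_forms_def)
    next
      show "finite (monomial_basis ?B n d)" by (rule forms_finite_dim) simp
      show "sing_forms ?B n d 4 P \<subseteq> poly_vs.span (monomial_basis ?B n d)"
        using forms_subset_span by (auto simp: sing_forms_def)
    next
      fix c assume 0: "(\<Sum>p\<in>{a', b'} \<times> S. scale_poly (c p) (case p of (t, M) \<Rightarrow> A t * M)) = 0"
      have "c (t, M) = 0" if tM: "t \<in> {a', b'}" "M \<in> S" for t M
      proof -
        let ?X = "\<lambda>M'. scale_poly (c (t, M')) (scale_poly \<omega> (br t) * M')"
        have step: "D t (scale_poly (c p) (case p of (t, M) \<Rightarrow> A t * M)) =
            (case p of (t', M') \<Rightarrow> if t' = t then ?X M' else 0)" if p: "p \<in> {a', b'} \<times> S" for p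
        proof -
          obtain t' M' where p': "p = (t', M')" "t' \<in> {a', b'}" "M' \<in> S" using p by auto
          have "D t (A t' * M') = (if t = t' then scale_poly \<omega> (br t) else 0) * M'"
            by (simp only: D_mult[OF S1[OF p'(3)]] D_A[OF tM(1) p'(2)])
          thus ?thesis by (simp add: p'(1) D_lin(1))
        qed
        have "D t (\<Sum>p\<in>{a', b'} \<times> S. scale_poly (c p) (case p of (t, M) \<Rightarrow> A t * M)) =
            (\<Sum>p\<in>{a', b'} \<times> S. D t (scale_poly (c p) (case p of (t, M) \<Rightarrow> A t * M)))"
          by (rule D_lin(3))
        also have "\<dots> = (\<Sum>(t', M')\<in>{a', b'} \<times> S. if t' = t then ?X M' else 0)"
          by (rule sum.cong) (rule refl, erule step)
        also have "\<dots> = (\<Sum>t'\<in>{a', b'}. \<Sum>M'\<in>S. if t' = t then ?X M' else 0)"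
          by (rule sum.cartesian_product[symmetric])
        also have "\<dots> = (\<Sum>t'\<in>{a', b'}. if t' = t then (\<Sum>M'\<in>S. ?X M') else 0)"
          by (rule sum.cong) simp_all
        also have "\<dots> = (\<Sum>M'\<in>S. scale_poly (c (t, M')) (scale_poly \<omega> (br t) * M'))"
          using tM(1) by (subst sum.delta) auto
        also have "\<dots> = scale_poly \<omega> (br t) * (\<Sum>M'\<in>S. scale_poly (c (t, M')) M')"
          by (simp add: sum_distrib_left scale_poly_def mult.left_commute)
        finally have "scale_poly \<omega> (br t) * (\<Sum>M'\<in>S. scale_poly (c (t, M')) M') = 0"
          by (simp add: 0 D_def)
        moreover have "t < 4" using tM(1) s(1) lt by auto
        ultimately have "(\<Sum>M'\<in>S. scale_poly (c (t, M')) M') = 0"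
          using br0[of t] \<omega> by simp
        from poly_vs.independentD[OF S(2,3) order_refl this tM(2)] show ?thesis .
      qed
      thus "\<forall>p\<in>{a', b'} \<times> S. c p = 0" by auto
    qed (use S(3) in simp)
    thus ?thesis using s S(4) by (simp add: card_cartesian_product)
  qed
qed

lemma eval_linear_cong:
  assumes "L \<in> forms B n (unit_deg b)" "b \<in> B" "\<And>j. x (b, j) = y (b, j)"
  shows "eval_poly L x = eval_poly L y"
proof -
  obtain c where "L = lin n b c" by (rule linear_form_eq_lin[OF assms(1,2)])
  thus ?thesis by (simp add: eval_lin assms(3))
qed

text \<open>\<open>L\<close> is multiplied by a form \<open>G\<close> of degree (1, 1) on the two
  other planes that is singular at \<open>P t0\<close> and vanishes at the three remaining points.
  These are 5 + 3 conditions on nine forms, so \<open>G\<close> can be chosen nonzero.\<close>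

lemma sing_forms_222_degenerate:
  fixes P :: "nat \<Rightarrow> 'b::linorder \<times> nat \<Rightarrow> complex"
  assumes i: "distinct [b, b1, b2]" and d: "d b = 1" "d b1 = 1" "d b2 = 1"
    and n: "n b = 2" "n b1 = 2" "n b2 = 2"
    and P: "\<forall>t<4. P t \<in> points {b, b1, b2} n" and t0: "t0 < 4"
    and L: "L \<in> forms {b, b1, b2} n (unit_deg b)" "L \<noteq> 0"
    and L0: "\<And>t. t < 4 \<Longrightarrow> t \<noteq> t0 \<Longrightarrow> eval_poly L (P t) = 0"
  shows "0 < poly_vs.dim (sing_forms {b, b1, b2} n d 4 P)"
proof -
  let ?C = "{b1, b2}"
  have ne: "b \<noteq> b1" "b \<noteq> b2" "b1 \<noteq> b2" using i by auto
  have "\<forall>i\<in>?C. \<exists>j. j \<le> n i \<and> P t0 (i, j) \<noteq> 0" using P t0 by (auto simp: points_def)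
  then obtain c where c: "\<forall>i\<in>?C. c i \<le> n i \<and> P t0 (i, c i) \<noteq> 0" by metis
  interpret chart_point ?C n "\<lambda>_. 1" c "P t0"
    by unfold_locales (use c in auto)
  \<comment> \<open>The left summand indexes the three values, the right one the five jets at
    \<open>P t0\<close>.\<close>
  define I :: "(nat + ('b \<times> nat) option) set" where
    "I = ({..<4} - {t0}) <+> jet_index ?C n c"
  define l where "l u = (case u of Inl t \<Rightarrow> (\<lambda>F. eval_poly F (P t)) | Inr v \<Rightarrow> jet (P t0) v)"
    for u :: "nat + ('b \<times> nat) option"
  have finI: "finite I" unfolding I_def using finite_jet_index by simp
  have "card I = card ({..<4} - {t0}) + card (jet_index ?C n c)"
    unfolding I_def using finite_jet_index by (simp add: card_Plus)
  also have "\<dots> = 8" using t0 ne n card_jet_index by simp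
  finally have q: "1 + card I \<le> (\<Prod>i\<in>?C. (n i + 1) choose 1)" using ne n by simp
  obtain S where S: "S \<subseteq> forms ?C n (\<lambda>_. 1)" "poly_vs.independent S" "card S = 1"
    "\<And>F u. F \<in> S \<Longrightarrow> u \<in> I \<Longrightarrow> l u F = 0"
  proof (rule exists_independent_kernel[OF finite_B finI _ q])
    show "functional (l u)" for u
      by (cases u) (simp_all add: l_def functional_eval functional_jet)
  qed (rule that)
  obtain G where G: "S = {G}" using S(3) by (auto simp: card_1_singleton_iff)
  have GC: "G \<in> forms ?C n (\<lambda>_. 1)" using S(1) G by simp
  have G_t: "eval_poly G (P t) = 0" if "t < 4" "t \<noteq> t0" for t
  proof -
    have "Inl t \<in> I" using that by (auto simp: I_def)
    from S(4)[OF _ this, of G] show ?thesis by (simp add: G l_def)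
  qed
  have jets: "\<forall>u\<in>jet_index ?C n c. jet (P t0) u G = 0"
  proof
    fix u assume "u \<in> jet_index ?C n c"
    hence "Inr u \<in> I" by (auto simp: I_def)
    from S(4)[OF _ this, of G] show "jet (P t0) u G = 0" by (simp add: G l_def)
  qed
  have singC: "sing ?C n (P t0) G" using sing_iff_jets[OF GC] jets by blast
  have G_t0: "eval_poly G (P t0) = 0" by (rule sing_eval[OF GC singC])
  have GB: "G \<in> forms {b, b1, b2} n (\<lambda>i. d i - unit_deg b i)"
    by (rule forms_subset_blocks[OF GC]) (use ne d in \<open>auto simp: unit_deg_def\<close>)
  have singB: "sing {b, b1, b2} n (P t0) G"
    unfolding sing_def
  proof
    fix v assume v: "v \<in> vars {b, b1, b2} n"
    show "eval_poly (pd v G) (P t0) = 0"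
    proof (cases "fst v = b")
      case True
      have "pd (b, snd v) G = 0"
        by (rule pd_other_block[OF GB]) (use d in \<open>auto simp: unit_deg_def\<close>)
      thus ?thesis using True by (metis eval_poly_zero prod.collapse)
    next
      case False
      hence "v \<in> vars ?C n" using v by (auto simp: vars_def)
      thus ?thesis using singC by (simp add: sing_def)
    qed
  qed
  have "L * G \<in> forms {b, b1, b2} n (\<lambda>i. unit_deg b i + (d i - unit_deg b i))"
    by (rule forms_mult[OF L(1) GB])
  also have "\<dots> = forms {b, b1, b2} n d"
    using d by (intro forms_cong) (auto simp: unit_deg_def)
  finally have "L * G \<in> forms {b, b1, b2} n d" .
  moreover have "sing {b, b1, b2} n (P t) (L * G)" if t: "t < 4" for t
  proof (cases "t = t0")
    case True
    thus ?thesis using singB G_t0 by (simp add: sing_def)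
  qed (rule sing_mult[OF L0[OF t] G_t[OF t]])
  ultimately have "L * G \<in> sing_forms {b, b1, b2} n d 4 P" by (simp add: sing_forms_def)
  moreover have "G \<noteq> 0" using singleton_independent_nonzero[OF S(2)] G by simp
  hence "L * G \<noteq> 0" using L(2) by simp
  ultimately show ?thesis by (intro sing_forms_nonzero_dim) simp
qed

text \<open>
  In general position the four points are projectively equivalent to the coordinate points and the
  unit point in each plane, and the determinant is singular on the diagonal.
\<close>

lemma sing_forms_222:
  fixes P :: "nat \<Rightarrow> 'b::linorder \<times> nat \<Rightarrow> complex"
  assumes i: "distinct [i1, i2, i3]" and d: "d i1 = 1" "d i2 = 1" "d i3 = 1"
    and n: "n i1 = 2" "n i2 = 2" "n i3 = 2"
    and P: "\<forall>t<4. P t \<in> points {i1, i2, i3} n"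
  shows "0 < poly_vs.dim (sing_forms {i1, i2, i3} n d 4 P)"
proof (rule ccontr)
  assume not: "\<not> ?thesis"
  let ?B = "{i1, i2, i3}"
  have ne: "i1 \<noteq> i2" "i1 \<noteq> i3" "i2 \<noteq> i3" using i by auto
  \<comment> \<open>A nonzero linear form through three of the four points already gives a singular
    form by the degenerate case. Hence in each plane no three of the four components are
    collinear.\<close>
  have deg: "L = 0" if b: "b \<in> ?B" and L: "L \<in> forms ?B n (unit_deg b)" and t0: "t0 < 4"
    and L0: "\<And>t. t < 4 \<Longrightarrow> t \<noteq> t0 \<Longrightarrow> eval_poly L (P t) = 0" for b L t0
  proof (rule ccontr)
    assume L': "L \<noteq> 0"
    have perm: "{i2, i1, i3} = ?B" "{i3, i1, i2} = ?B" by auto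
    consider "b = i1" | "b = i2" | "b = i3" using b by auto
    thus False
    proof cases
      case 1
      have "0 < poly_vs.dim (sing_forms {i1, i2, i3} n d 4 P)"
        by (rule sing_forms_222_degenerate[of i1 i2 i3 d n P t0 L, OF i d n P t0 _ L' L0])
          (use L 1 in simp_all)
      thus False using not by simp
    next
      case 2
      have "0 < poly_vs.dim (sing_forms {i2, i1, i3} n d 4 P)"
        by (rule sing_forms_222_degenerate[of i2 i1 i3 d n P t0 L, OF _ d(2,1,3) n(2,1,3) _ t0 _ L' L0])
          (use L 2 ne P in \<open>simp_all add: perm\<close>)
      thus False using not by (simp add: perm)
    next
      case 3
      have "0 < poly_vs.dim (sing_forms {i3, i1, i2} n d 4 P)"
        by (rule sing_forms_222_degenerate[of i3 i1 i2 d n P t0 L, OF _ d(3,1,2) n(3,1,2) _ t0 _ L' L0])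
          (use L 3 ne P in \<open>simp_all add: perm\<close>)
      thus False using not by (simp add: perm)
    qed
  qed
  \<comment> \<open>Coordinates in which the first three points are the coordinate points, scaled so
    that the fourth is the unit point.\<close>
  have coords: "\<exists>X. \<forall>i<3. X i \<in> forms ?B n (unit_deg b) \<and> eval_poly (X i) (P 3) = 1 \<and>
      eval_poly (X i) (P i) \<noteq> 0 \<and> (\<forall>j<3. j \<noteq> i \<longrightarrow> eval_poly (X i) (P j) = 0)" if b: "b \<in> ?B" for b
  proof -
    have "\<exists>X. X \<in> forms ?B n (unit_deg b) \<and> eval_poly X (P 3) = 1 \<and>
        eval_poly X (P i) \<noteq> 0 \<and> (\<forall>j<3. j \<noteq> i \<longrightarrow> eval_poly X (P j) = 0)" if i: "i < 3" for i :: nat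
    proof -
      have "card ({..<3} - {i}) = 2" using i by simp
      moreover have "(\<Prod>i\<in>?B. (n i + unit_deg b i) choose unit_deg b i) = 3"
        using b ne n by (auto simp: unit_deg_def)
      ultimately have q: "1 + card ({..<3} - {i}) \<le> (\<Prod>i\<in>?B. (n i + unit_deg b i) choose unit_deg b i)"
        by linarith
      obtain S where S: "S \<subseteq> forms ?B n (unit_deg b)" "poly_vs.independent S" "card S = 1"
        "\<And>F t. F \<in> S \<Longrightarrow> t \<in> {..<3} - {i} \<Longrightarrow> eval_poly F (P t) = 0"
        by (rule exists_independent_kernel[OF _ _ _ q, of "\<lambda>t F. eval_poly F (P t)"])
          (simp, simp, rule functional_eval, rule that)
      obtain X where X: "S = {X}" using S(3) by (auto simp: card_1_singleton_iff)
      have Xf: "X \<in> forms ?B n (unit_deg b)" using S(1) X by simp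
      have Xj: "eval_poly X (P j) = 0" if "j < 3" "j \<noteq> i" for j using S(4) X that by simp
      have X0: "X \<noteq> 0" using singleton_independent_nonzero[OF S(2)] X by simp
      have X3: "eval_poly X (P 3) \<noteq> 0"
      proof
        assume z: "eval_poly X (P 3) = 0"
        have "eval_poly X (P t) = 0" if "t < 4" "t \<noteq> i" for t
          using Xj[of t] z that by (cases "t = 3") auto
        hence "X = 0" using i by (intro deg[OF b Xf, of i]) auto
        thus False using X0 by simp
      qed
      have Xi: "eval_poly X (P i) \<noteq> 0"
      proof
        assume z: "eval_poly X (P i) = 0"
        have "eval_poly X (P t) = 0" if "t < 4" "t \<noteq> 3" for t
          using Xj[of t] z that by (cases "t = i") auto
        hence "X = 0" by (intro deg[OF b Xf, of 3]) auto
        thus False using X0 by simp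
      qed
      show ?thesis
        by (rule exI[of _ "scale_poly (1 / eval_poly X (P 3)) X"])
          (use Xf Xj X3 Xi in \<open>simp add: forms_scale\<close>)
    qed
    thus ?thesis by metis
  qed
  obtain X where X: "\<forall>i<3. X i \<in> forms ?B n (unit_deg i1) \<and> eval_poly (X i) (P 3) = 1 \<and>
      eval_poly (X i) (P i) \<noteq> 0 \<and> (\<forall>j<3. j \<noteq> i \<longrightarrow> eval_poly (X i) (P j) = 0)"
    using coords[of i1] by auto
  obtain Y where Y: "\<forall>i<3. Y i \<in> forms ?B n (unit_deg i2) \<and> eval_poly (Y i) (P 3) = 1 \<and>
      eval_poly (Y i) (P i) \<noteq> 0 \<and> (\<forall>j<3. j \<noteq> i \<longrightarrow> eval_poly (Y i) (P j) = 0)"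
    using coords[of i2] by auto
  obtain Z where Z: "\<forall>i<3. Z i \<in> forms ?B n (unit_deg i3) \<and> eval_poly (Z i) (P 3) = 1 \<and>
      eval_poly (Z i) (P i) \<noteq> 0 \<and> (\<forall>j<3. j \<noteq> i \<longrightarrow> eval_poly (Z i) (P j) = 0)"
    using coords[of i3] by auto
  \<comment> \<open>The determinant with rows \<open>X\<close>, \<open>Y\<close>, \<open>Z\<close>.
    At the first three points each of its terms contains two vanishing factors; at the fourth all
    rows equal (1, 1, 1), and differentiating one row leaves two equal rows.\<close>
  define F where "F = X 0 * (Y 1 * Z 2 - Y 2 * Z 1) - X 1 * (Y 0 * Z 2 - Y 2 * Z 0)
      + X 2 * (Y 0 * Z 1 - Y 1 * Z 0)"
  have prod: "X a * (Y b * Z c) \<in> forms ?B n d" if "a < 3" "b < 3" "c < 3" for a b c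
  proof -
    have "X a * (Y b * Z c) \<in> forms ?B n (\<lambda>i. unit_deg i1 i + (unit_deg i2 i + unit_deg i3 i))"
      using X Y Z that by (intro forms_mult) auto
    also have "\<dots> = forms ?B n d" using ne d by (intro forms_cong) (auto simp: unit_deg_def)
    finally show ?thesis .
  qed
  have "F \<in> forms ?B n d"
    unfolding F_def right_diff_distrib by (intro forms_add forms_diff prod) simp_all
  moreover have "sing ?B n (P t) F" if t: "t < 4" for t
  proof -
    consider "t = 0" | "t = 1" | "t = 2" | "t = 3" using t by linarith
    thus ?thesis
    proof cases
      case 1
      have "eval_poly (X 1) (P t) = 0" "eval_poly (X 2) (P t) = 0" "eval_poly (Y 1) (P t) = 0"
        "eval_poly (Y 2) (P t) = 0" "eval_poly (Z 1) (P t) = 0" "eval_poly (Z 2) (P t) = 0"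
        using X Y Z 1 by simp_all
      thus ?thesis by (simp add: sing_def F_def)
    next
      case 2
      have "eval_poly (X 0) (P t) = 0" "eval_poly (X 2) (P t) = 0" "eval_poly (Y 0) (P t) = 0"
        "eval_poly (Y 2) (P t) = 0" "eval_poly (Z 0) (P t) = 0" "eval_poly (Z 2) (P t) = 0"
        using X Y Z 2 by simp_all
      thus ?thesis by (simp add: sing_def F_def)
    next
      case 3
      have "eval_poly (X 0) (P t) = 0" "eval_poly (X 1) (P t) = 0" "eval_poly (Y 0) (P t) = 0"
        "eval_poly (Y 1) (P t) = 0" "eval_poly (Z 0) (P t) = 0" "eval_poly (Z 1) (P t) = 0"
        using X Y Z 3 by simp_all
      thus ?thesis by (simp add: sing_def F_def)
    next
      case 4
      have "eval_poly (X a) (P t) = 1" "eval_poly (Y a) (P t) = 1" "eval_poly (Z a) (P t) = 1"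
        if "a < 3" for a using X Y Z 4 that by simp_all
      thus ?thesis by (simp add: sing_def F_def)
    qed
  qed
  ultimately have "F \<in> sing_forms ?B n d 4 P" by (simp add: sing_forms_def)
  moreover have "F \<noteq> 0"
  proof
    assume F0: "F = 0"
    \<comment> \<open>A test point that takes its first component from \<open>P 0\<close>, its
      second from \<open>P 1\<close> and its third from \<open>P 2\<close>: there the determinant
      reduces to the product of its diagonal.\<close>
    define x where "x = (\<lambda>(b, j). P (if b = i1 then 0 else if b = i2 then 1 else 2) (b, j))"
    have "eval_poly (X a) x = eval_poly (X a) (P 0)" "eval_poly (Y a) x = eval_poly (Y a) (P 1)"
      "eval_poly (Z a) x = eval_poly (Z a) (P 2)" if "a < 3" for a
      using X Y Z that ne
      by (auto intro!: eval_linear_cong[of _ ?B n] simp: x_def)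
    hence "eval_poly F x = eval_poly (X 0) (P 0) * (eval_poly (Y 1) (P 1) * eval_poly (Z 2) (P 2))"
      using X Y Z by (simp add: F_def)
    thus False using F0 X Y Z by simp
  qed
  ultimately show False using not sing_forms_nonzero_dim[of ?B F n d 4 P] by simp
qed

subsection \<open>Quadrics\<close>

lemma pd_commute: "pd v (pd w F) = pd w (pd v F)"
proof (induction F rule: mpoly_induct)
  case (single m c)
  have "m - single w 1 - single v 1 = m - single v 1 - single w 1"
    by (intro poly_mapping_eqI) (simp add: lookup_minus)
  thus ?case
    by (cases "v = w") (simp_all add: pd_single lookup_minus lookup_single mult.commute mult.left_commute)
qed simp

text \<open>Both sides are the polar bilinear form of the quadric, symmetric because second
  derivatives commute.\<close>

lemma quadric_polarity:
  assumes F: "F \<in> forms {i} n d" and d: "d i = 2"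
  shows "(\<Sum>j\<le>n i. y (i, j) * eval_poly (pd (i, j) F) x) =
    (\<Sum>j\<le>n i. x (i, j) * eval_poly (pd (i, j) F) y)"
proof -
  have "\<exists>c. pd (i, j) F = lin n i c" if j: "j \<le> n i" for j
  proof -
    have "pd (i, j) F \<in> forms {i} n (d(i := d i - 1))"
      using j by (intro pd_form[OF F]) (simp add: vars_def)
    also have "\<dots> = forms {i} n (unit_deg i)"
      using d by (intro forms_cong) (simp add: unit_deg_def)
    finally obtain c where "pd (i, j) F = lin n i c" by (rule linear_form_eq_lin) (simp, rule that)
    thus ?thesis by blast
  qed
  then obtain c where c: "\<And>j. j \<le> n i \<Longrightarrow> pd (i, j) F = lin n i (c j)" by metis
  have sym: "c j k = c k j" if "j \<le> n i" "k \<le> n i" for j k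
  proof -
    have "single 0 (c j k) = pd (i, k) (pd (i, j) F)" using that by (simp add: c pd_lin)
    also have "\<dots> = single 0 (c k j)" using that by (subst pd_commute) (simp add: c pd_lin)
    finally show ?thesis by (metis lookup_single_eq)
  qed
  have "(\<Sum>j\<le>n i. y (i, j) * eval_poly (pd (i, j) F) x) =
      (\<Sum>j\<le>n i. \<Sum>k\<le>n i. y (i, j) * (c j k * x (i, k)))"
    by (intro sum.cong refl) (simp add: c eval_lin sum_distrib_left)
  also have "\<dots> = (\<Sum>k\<le>n i. \<Sum>j\<le>n i. y (i, j) * (c j k * x (i, k)))" by (rule sum.swap)
  also have "\<dots> = (\<Sum>k\<le>n i. x (i, k) * eval_poly (pd (i, k) F) y)"
    by (intro sum.cong refl) (simp add: c eval_lin sum_distrib_left sym mult_ac)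
  finally show ?thesis .
qed

text \<open>The first bound comes from the square of a hyperplane through the four points, which
  exists for \<open>n i \<ge> 4\<close>. For the second, polarity between \<open>P 0\<close> and
  \<open>P 1\<close> is a linear relation among the \<open>4 * (1 + n i)\<close> derivatives, so the
  one at \<open>P 0\<close> along \<open>j0\<close> follows from the others.\<close>

lemma sing_forms_quadric:
  fixes P :: "nat \<Rightarrow> 'b::linorder \<times> nat \<Rightarrow> complex"
  assumes d: "d i = 2" and n: "n i \<ge> 4" and P: "\<forall>t<4. P t \<in> points {i} n"
  shows "0 < poly_vs.dim (sing_forms {i} n d 4 P)"
    and "(n i + 2) choose 2 < poly_vs.dim (sing_forms {i} n d 4 P) + 4 * (1 + n i)"
proof -
  have q: "1 + 4 \<le> (\<Prod>i'\<in>{i}. (n i' + unit_deg i i') choose unit_deg i i')"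
    using n by (simp add: unit_deg_def)
  obtain S where S: "S \<subseteq> forms {i} n (unit_deg i)" "poly_vs.independent S" "finite S"
    "card S = 1" "\<And>F t. F \<in> S \<Longrightarrow> t < 4 \<Longrightarrow> eval_poly F (P t) = 0"
    by (rule exists_vanishing_forms[OF _ q, of P]) (simp, rule that)
  obtain L where L: "S = {L}" using S(4) by (auto simp: card_1_singleton_iff)
  have "L * L \<in> forms {i} n (\<lambda>j. unit_deg i j + unit_deg i j)"
    using S(1) L by (intro forms_mult) auto
  also have "\<dots> = forms {i} n d" using d by (intro forms_cong) (simp add: unit_deg_def)
  finally have "L * L \<in> sing_forms {i} n d 4 P"
    using S(5) L by (simp add: sing_forms_def sing_mult)
  moreover have "L * L \<noteq> 0" using singleton_independent_nonzero[OF S(2)] L by simp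
  ultimately show "0 < poly_vs.dim (sing_forms {i} n d 4 P)"
    by (intro sing_forms_nonzero_dim) simp
  have "P 1 \<in> points {i} n" using P by simp
  then obtain j0 where j0: "j0 \<le> n i" "P 1 (i, j0) \<noteq> 0"
    by (auto simp: points_def)
  define I where "I = {..<4 :: nat} \<times> {..n i} - {(0, j0)}"
  define l where "l = (\<lambda>(t, j) F. eval_poly (pd (i, j) F) (P t))"
  have "kernel_on (forms {i} n d) I l \<subseteq> sing_forms {i} n d 4 P"
  proof
    fix F assume F: "F \<in> kernel_on (forms {i} n d) I l"
    hence Ff: "F \<in> forms {i} n d" by (simp add: kernel_on_def)
    have z: "eval_poly (pd (i, j) F) (P t) = 0" if "t < 4" "j \<le> n i" "(t, j) \<noteq> (0, j0)" for t j
    proof -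
      have "(t, j) \<in> I" using that by (simp add: I_def)
      thus ?thesis using F by (auto simp: kernel_on_def l_def)
    qed
    have "0 = (\<Sum>j\<le>n i. P 0 (i, j) * eval_poly (pd (i, j) F) (P 1))" using z[of 1] by simp
    also have "\<dots> = (\<Sum>j\<le>n i. P 1 (i, j) * eval_poly (pd (i, j) F) (P 0))"
      by (rule quadric_polarity[OF Ff d])
    also have "\<dots> = (\<Sum>j\<in>{j0}. P 1 (i, j) * eval_poly (pd (i, j) F) (P 0))"
      using z[of 0] j0(1) by (intro sum.mono_neutral_right) auto
    finally have "eval_poly (pd (i, j0) F) (P 0) = 0" using j0 by simp
    with z have "sing {i} n (P t) F" if "t < 4" for t
      using that unfolding sing_def vars_def by (cases "t = 0") fastforce+
    with Ff show "F \<in> sing_forms {i} n d 4 P" by (simp add: sing_forms_def)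
  qed
  moreover have "sing_forms {i} n d 4 P \<subseteq> poly_vs.span (monomial_basis {i} n d)"
    using forms_subset_span by (auto simp: sing_forms_def)
  ultimately have "poly_vs.dim (kernel_on (forms {i} n d) I l) \<le>
      poly_vs.dim (sing_forms {i} n d 4 P)"
    by (intro dim_mono_finite[OF forms_finite_dim(1)[of "{i}" n d]]) auto
  moreover have "poly_vs.dim (forms {i} n d) \<le>
      poly_vs.dim (kernel_on (forms {i} n d) I l) + card I"
    by (rule dim_le_dim_kernel[OF subspace_forms forms_finite_dim])
      (auto simp: I_def l_def functional_pd)
  moreover have "card I + 1 = 4 * (1 + n i)"
    using j0 by (simp add: I_def card_cartesian_product)
  moreover have "poly_vs.dim (forms {i} n d) = (n i + 2) choose 2"
    using d by (simp add: dim_forms)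
  ultimately show "(n i + 2) choose 2 < poly_vs.dim (sing_forms {i} n d 4 P) + 4 * (1 + n i)"
    by linarith
qed

section \<open>Comparison with the expected number of singular forms\<close>

lemma excess_quadric:
  fixes n d :: "'b::linorder \<Rightarrow> nat"
  assumes "d i = 2" "n i \<ge> 4"
  shows "excess {i} n d 4"
  unfolding excess_def
proof (intro allI impI)
  fix P :: "nat \<Rightarrow> 'b \<times> nat \<Rightarrow> complex" assume P: "\<forall>t<4. P t \<in> points {i} n"
  show "0 < poly_vs.dim (sing_forms {i} n d 4 P) \<and>
    (\<Prod>i\<in>{i}. (n i + d i) choose d i) <
      poly_vs.dim (sing_forms {i} n d 4 P) + 4 * (1 + (\<Sum>i\<in>{i}. n i))"
    using sing_forms_quadric[of d i n P, OF assms P] assms by simp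
qed

lemma excess_segre2:
  fixes n d :: "'b::linorder \<Rightarrow> nat"
  assumes "i1 \<noteq> i2" "d i1 = 1" "d i2 = 1" "n i1 \<ge> 4" "n i2 \<ge> 4"
  shows "excess {i1, i2} n d 4"
  unfolding excess_def
proof (intro allI impI)
  fix P :: "nat \<Rightarrow> 'b \<times> nat \<Rightarrow> complex" assume P: "\<forall>t<4. P t \<in> points {i1, i2} n"
  obtain x y where xy: "n i1 = x + 4" "n i2 = y + 4"
    using assms(4,5) by (metis add.commute le_Suc_ex)
  have "(n i1 - 3) * (n i2 - 3) \<le> poly_vs.dim (sing_forms {i1, i2} n d 4 P)"
    by (rule sing_forms_segre2[OF assms])
  thus "0 < poly_vs.dim (sing_forms {i1, i2} n d 4 P) \<and>
    (\<Prod>i\<in>{i1, i2}. (n i + d i) choose d i) <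
      poly_vs.dim (sing_forms {i1, i2} n d 4 P) + 4 * (1 + (\<Sum>i\<in>{i1, i2}. n i))"
    using assms(1-3) by (simp add: xy algebra_simps)
qed

text \<open>Eighteen forms against sixteen conditions: two singular forms are expected and three
  exist.\<close>

lemma excess_12_22:
  fixes n d :: "'b::linorder \<Rightarrow> nat"
  assumes "i1 \<noteq> i2" "d i1 = 2" "d i2 = 2" "n i1 = 1" "n i2 = 2"
  shows "excess {i1, i2} n d 4"
  unfolding excess_def
proof (intro allI impI)
  fix P :: "nat \<Rightarrow> 'b \<times> nat \<Rightarrow> complex" assume P: "\<forall>t<4. P t \<in> points {i1, i2} n"
  show "0 < poly_vs.dim (sing_forms {i1, i2} n d 4 P) \<and>
    (\<Prod>i\<in>{i1, i2}. (n i + d i) choose d i) <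
      poly_vs.dim (sing_forms {i1, i2} n d 4 P) + 4 * (1 + (\<Sum>i\<in>{i1, i2}. n i))"
    using sing_forms_12_22[OF assms, of P] assms by (simp add: numeral_eq_Suc)
qed

text \<open>Twenty-seven forms against twenty-eight conditions: one nonzero singular form is already
  too many.\<close>

lemma excess_222:
  fixes n d :: "'b::linorder \<Rightarrow> nat"
  assumes "distinct [i1, i2, i3]" "d i1 = 1" "d i2 = 1" "d i3 = 1" "n i1 = 2" "n i2 = 2" "n i3 = 2"
  shows "excess {i1, i2, i3} n d 4"
  unfolding excess_def
proof (intro allI impI)
  fix P :: "nat \<Rightarrow> 'b \<times> nat \<Rightarrow> complex" assume P: "\<forall>t<4. P t \<in> points {i1, i2, i3} n"
  show "0 < poly_vs.dim (sing_forms {i1, i2, i3} n d 4 P) \<and>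
    (\<Prod>i\<in>{i1, i2, i3}. (n i + d i) choose d i) <
      poly_vs.dim (sing_forms {i1, i2, i3} n d 4 P) + 4 * (1 + (\<Sum>i\<in>{i1, i2, i3}. n i))"
    using sing_forms_222[OF assms P] assms by simp
qed

lemma excess_segre_12m:
  fixes n d :: "'b::linorder \<Rightarrow> nat"
  assumes "distinct [i1, i2, i3]" "d i1 = 1" "d i2 = 1" "d i3 = 1" "n i1 = 1" "n i2 = 2" "n i3 \<ge> 4"
  shows "excess {i1, i2, i3} n d 4"
  unfolding excess_def
proof (intro allI impI)
  fix P :: "nat \<Rightarrow> 'b \<times> nat \<Rightarrow> complex" assume P: "\<forall>t<4. P t \<in> points {i1, i2, i3} n"
  obtain x where x: "n i3 = x + 4" using assms(7) by (metis add.commute le_Suc_ex)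
  show "0 < poly_vs.dim (sing_forms {i1, i2, i3} n d 4 P) \<and>
    (\<Prod>i\<in>{i1, i2, i3}. (n i + d i) choose d i) <
      poly_vs.dim (sing_forms {i1, i2, i3} n d 4 P) + 4 * (1 + (\<Sum>i\<in>{i1, i2, i3}. n i))"
    using sing_forms_segre_12m[OF assms, of P] assms(1-6) by (simp add: x)
qed

text \<open>Twenty-seven forms against twenty-four conditions: three singular forms are expected and
  four exist.\<close>

lemma excess_221_112:
  fixes n d :: "'b::linorder \<Rightarrow> nat"
  assumes "distinct [i1, i2, i3]" "d i1 = 1" "d i2 = 1" "d i3 = 2" "n i1 = 2" "n i2 = 2" "n i3 = 1"
  shows "excess {i1, i2, i3} n d 4"
  unfolding excess_def
proof (intro allI impI)
  fix P :: "nat \<Rightarrow> 'b \<times> nat \<Rightarrow> complex" assume P: "\<forall>t<4. P t \<in> points {i1, i2, i3} n"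
  show "0 < poly_vs.dim (sing_forms {i1, i2, i3} n d 4 P) \<and>
    (\<Prod>i\<in>{i1, i2, i3}. (n i + d i) choose d i) <
      poly_vs.dim (sing_forms {i1, i2, i3} n d 4 P) + 4 * (1 + (\<Sum>i\<in>{i1, i2, i3}. n i))"
    using sing_forms_221_112[OF assms P] assms by (simp add: numeral_eq_Suc)
qed

section \<open>Certificates\<close>

text \<open>The exponent vectors of degree \<open>a\<close> in \<open>n + 1\<close> variables, with
  decreasing first exponent. The certificates refer to monomials by their position in this
  order.\<close>

fun compositions :: "nat \<Rightarrow> nat \<Rightarrow> nat list list" where
  "compositions 0 a = [[a]]"
| "compositions (Suc n) a =
    concat (map (\<lambda>x. map ((#) x) (compositions n (a - x))) (rev [0..<Suc a]))"

fun exponents :: "nat list \<Rightarrow> nat list \<Rightarrow> nat list list list" where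
  "exponents (n # ns) (a # as) =
    concat (map (\<lambda>e. map ((#) e) (exponents ns as)) (compositions n a))"
| "exponents _ _ = [[]]"

text \<open>Soundness suffices: a certificate exhibits forms, and whether a system of jets is
  complete is judged by the binomial count of \<open>dim_forms\<close>.\<close>

lemma compositions_sound: "e \<in> set (compositions n a) \<Longrightarrow> length e = Suc n \<and> sum_list e = a"
  by (induction n a arbitrary: e rule: compositions.induct) (fastforce simp: less_Suc_eq_le)+

lemma exponents_sound:
  assumes "length ns = length as" "E \<in> set (exponents ns as)"
  shows "length E = length ns \<and>
    (\<forall>i<length ns. length (E ! i) = Suc (ns ! i) \<and> sum_list (E ! i) = as ! i)"
  using assms
proof (induction ns as arbitrary: E rule: exponents.induct)
  case (1 n ns a as)
  then obtain e E' where "E = e # E'" "e \<in> set (compositions n a)" "E' \<in> set (exponents ns as)"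
    by auto
  with 1 compositions_sound[of e n a] show ?case by (auto simp: nth_Cons split: nat.splits)
qed auto

definition monom_at :: "int list list \<Rightarrow> nat list list \<Rightarrow> int" where
  "monom_at p E = prod_list (map2 (\<lambda>xs es. prod_list (map2 (^) xs es)) p E)"

text \<open>A zero exponent stays 0 under truncated subtraction, and the factor in front is then 0
  as well.\<close>

fun monom_jet :: "int list list \<Rightarrow> (nat \<times> nat) option \<Rightarrow> nat list list \<Rightarrow> int" where
  "monom_jet p None E = monom_at p E"
| "monom_jet p (Some (i, j)) E =
    int (E ! i ! j) * monom_at p (E[i := (E ! i)[j := E ! i ! j - 1]])"

definition all_jets :: "nat list \<Rightarrow> nat \<Rightarrow> (nat \<times> (nat \<times> nat) option) list" where
  "all_jets ns s = concat (map (\<lambda>t. map (Pair t) (None # concat (map (\<lambda>i. map (\<lambda>j. Some (i, j))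
     [1..<Suc (ns ! i)]) [0..<length ns]))) [0..<s])"

text \<open>
  A certificate lists, for each of the chosen jet functionals, a dual form: its common denominator
  and its coefficients, the latter indexed by the position of the monomial in \<open>exponents ns as\<close>.
\<close>

type_synonym certificate = "(int \<times> (nat \<times> int) list) list"

text \<open>A certificate is a right inverse of the matrix of jets against monomials, with
  denominators cleared so that all arithmetic is in the integers. Its entry \<open>k\<close>
  combines the columns of the listed monomials into \<open>d\<close> times the \<open>k\<close>-th
  unit vector. The test \<open>hd xs = 1\<close> makes the points affine.\<close>

definition check ::
    "nat list \<Rightarrow> nat list \<Rightarrow> int list list list \<Rightarrow> (nat \<times> (nat \<times> nat) option) list \<Rightarrow>
     certificate \<Rightarrow> bool" where
  "check ns as pts fs cert \<longleftrightarrow>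
    (let Es = exponents ns as; r = length fs;
         cols = map (\<lambda>E. map (\<lambda>(t, u). monom_jet (pts ! t) u E) fs) Es
     in length cert = r \<and> length ns = length as \<and>
        list_all (\<lambda>p. map length p = map Suc ns \<and> list_all (\<lambda>xs. hd xs = 1) p) pts \<and>
        list_all (\<lambda>(t, u). t < length pts) fs \<and>
        list_all (\<lambda>(k, d, cs). d \<noteq> 0 \<and> list_all (\<lambda>(m, c). m < length Es) cs \<and>
          foldr (\<lambda>(m, c). map2 (\<lambda>x y. c * x + y) (cols ! m)) cs (replicate r 0) =
          map (\<lambda>l. if k = l then d else 0) [0..<r]) (zip [0..<r] cert))"

definition cert_point :: "nat list \<Rightarrow> int list list \<Rightarrow> nat \<times> nat \<Rightarrow> complex" where
  "cert_point ns p v = (if v \<in> vars {..<length ns} ((!) ns) then of_int (p ! fst v ! snd v) else 0)"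

definition monom_of :: "nat list list \<Rightarrow> nat monom" where
  "monom_of E = (\<Sum>i<length E. \<Sum>j<length (E ! i). single (i, j) (E ! i ! j))"

lemma lookup_monom_of:
  "lookup (monom_of E) (i, j) = (if i < length E \<and> j < length (E ! i) then E ! i ! j else 0)"
proof -
  have "lookup (monom_of E) (i, j) = (\<Sum>i'<length E. \<Sum>j'<length (E ! i').
      if i' = i then (if j' = j then E ! i ! j else 0) else 0)"
    unfolding monom_of_def lookup_sum
    by (intro sum.cong refl) (auto simp: lookup_single when_def)
  also have "\<dots> = (\<Sum>i'<length E. if i' = i then
      (\<Sum>j'<length (E ! i). if j' = j then E ! i ! j else 0) else 0)"
    by (intro sum.cong refl) auto
  finally show ?thesis by simp
qed

lemma monom_of_monoms:
  assumes "length E = length ns"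
    and E: "\<And>i. i < length ns \<Longrightarrow> length (E ! i) = Suc (ns ! i) \<and> sum_list (E ! i) = as ! i"
  shows "monom_of E \<in> monoms {..<length ns} ((!) ns) ((!) as)"
proof -
  have "keys (monom_of E) \<subseteq> vars {..<length ns} ((!) ns)"
    using assms by (auto simp: in_keys_iff lookup_monom_of vars_def split: if_splits)
  moreover have "bdeg ((!) ns) (monom_of E) i = as ! i" if "i < length ns" for i
  proof -
    have "bdeg ((!) ns) (monom_of E) i = (\<Sum>j<length (E ! i). E ! i ! j)"
      using assms that by (auto simp: bdeg_def lookup_monom_of lessThan_Suc_atMost intro!: sum.cong)
    thus ?thesis
      using conjunct1[OF E[OF that]] conjunct2[OF E[OF that]]
      by (simp add: sum_list_sum_nth lessThan_atLeast0 del: sum.op_ivl_Suc)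
  qed
  ultimately show ?thesis by (simp add: monoms_def)
qed

lemma monom_at_correct:
  assumes "map length p = map Suc ns" "length E = length ns"
    and E: "\<And>i. i < length ns \<Longrightarrow> length (E ! i) = Suc (ns ! i)"
  shows "monom_val (monom_of E) (cert_point ns p) = of_int (monom_at p E)"
proof -
  have lp: "length p = length ns" using assms(1) by (metis length_map)
  have lpi: "length (p ! i) = Suc (ns ! i)" if "i < length ns" for i
    using arg_cong[OF assms(1), of "\<lambda>xs. xs ! i"] that lp by simp
  have "monom_val (monom_of E) (cert_point ns p) =
      (\<Prod>i<length E. \<Prod>j<length (E ! i). cert_point ns p (i, j) ^ (E ! i ! j))"
    by (simp add: monom_of_def monom_val_sum monom_val_single)
  also have "\<dots> = (\<Prod>i<length ns. of_int (prod_list (map2 (^) (p ! i) (E ! i))))"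
  proof (intro prod.cong)
    fix i assume "i \<in> {..<length ns}"
    hence i: "i < length ns" by simp
    have "(\<Prod>j<length (E ! i). cert_point ns p (i, j) ^ (E ! i ! j)) =
        (\<Prod>j<Suc (ns ! i). of_int (p ! i ! j ^ (E ! i ! j)))"
      using i E[OF i] by (intro prod.cong) (auto simp: cert_point_def vars_def)
    also have "\<dots> = of_int (prod_list (map2 (^) (p ! i) (E ! i)))"
      using lpi[OF i] E[OF i] by (simp add: prod.list_conv_set_nth lessThan_atLeast0)
    finally show "(\<Prod>j<length (E ! i). cert_point ns p (i, j) ^ (E ! i ! j)) =
        of_int (prod_list (map2 (^) (p ! i) (E ! i)))" .
  qed (simp add: assms)
  also have "\<dots> = of_int (monom_at p E)"
    using lp assms(2) by (simp add: monom_at_def prod.list_conv_set_nth lessThan_atLeast0)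
  finally show ?thesis .
qed

lemma monom_jet_correct:
  assumes p: "map length p = map Suc ns" and "length E = length ns"
    and E: "\<And>i. i < length ns \<Longrightarrow> length (E ! i) = Suc (ns ! i)"
    and u: "u \<in> affine_jets {..<length ns} ((!) ns)"
  shows "jet (cert_point ns p) u (single (monom_of E) 1) = of_int (monom_jet p u E)"
proof (cases u)
  case None
  thus ?thesis using monom_at_correct[OF p assms(2) E] by (simp add: eval_poly_single')
next
  case (Some v)
  then obtain i j where v: "u = Some (i, j)" "i < length ns" "j \<le> ns ! i"
    using u by (auto simp: affine_jets_iff)
  let ?E' = "E[i := (E ! i)[j := E ! i ! j - 1]]"
  have "monom_of E - single (i, j) 1 = monom_of ?E'"
  proof (rule poly_mapping_eqI)
    fix w :: "nat \<times> nat"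
    obtain a b where w: "w = (a, b)" by (cases w)
    show "lookup (monom_of E - single (i, j) 1) w = lookup (monom_of ?E') w"
      using v(2,3) assms(2) E[OF v(2)] unfolding w
      by (cases "a = i"; cases "b = j") (simp_all add: lookup_minus lookup_single lookup_monom_of)
  qed
  moreover have "monom_val (monom_of ?E') (cert_point ns p) = of_int (monom_at p ?E')"
  proof (rule monom_at_correct[OF p])
    show "length (?E' ! a) = Suc (ns ! a)" if "a < length ns" for a
      using that E v(2) assms(2) by (cases "a = i") simp_all
  qed (simp add: assms(2))
  ultimately show ?thesis
    using v assms(2) E[OF v(2)]
    by (simp add: pd_single eval_poly_single' lookup_monom_of)
qed

lemma cert_point_affine:
  assumes "map length p = map Suc ns" "\<forall>xs\<in>set p. hd xs = 1"
  shows "affine {..<length ns} ((!) ns) (cert_point ns p)"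
proof -
  have lp: "length p = length ns" using assms(1) by (metis length_map)
  have "p ! i ! 0 = 1" if "i < length ns" for i
  proof -
    have "length (p ! i) = Suc (ns ! i)"
      using arg_cong[OF assms(1), of "\<lambda>xs. xs ! i"] that lp by simp
    moreover have "hd (p ! i) = 1" using assms(2) that lp by simp
    ultimately show ?thesis by (cases "p ! i") simp_all
  qed
  thus ?thesis by (auto simp: affine_def cert_point_def vars_def)
qed

lemma check_dual:
  assumes c: "check ns as pts fs cert"
    and fs: "\<And>t u. (t, u) \<in> set fs \<Longrightarrow> u \<in> affine_jets {..<length ns} ((!) ns)"
    and k: "k < length fs"
  shows "\<exists>F\<in>forms {..<length ns} ((!) ns) ((!) as). \<forall>l<length fs.
    jet (cert_point ns (pts ! fst (fs ! l))) (snd (fs ! l)) F = (if k = l then 1 else 0)"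
proof -
  define Es where "Es = exponents ns as"
  define cols where "cols = map (\<lambda>E. map (\<lambda>(t, u). monom_jet (pts ! t) u E) fs) Es"
  obtain d cs where dcs: "cert ! k = (d, cs)" by (cases "cert ! k")
  have len: "length cert = length fs" "length ns = length as"
    and pts: "\<And>p. p \<in> set pts \<Longrightarrow> map length p = map Suc ns"
    and tl: "\<And>t u. (t, u) \<in> set fs \<Longrightarrow> t < length pts"
    using c by (auto simp: check_def Let_def list_all_iff)
  have "(k, d, cs) \<in> set (zip [0..<length fs] cert)"
    using k len dcs by (auto simp: set_zip intro!: exI[of _ k])
  hence d: "d \<noteq> 0" and m: "\<And>m c. (m, c) \<in> set cs \<Longrightarrow> m < length Es"
    and fold: "foldr (\<lambda>(m, c). map2 (\<lambda>x y. c * x + y) (cols ! m)) cs (replicate (length fs) 0) =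
      map (\<lambda>l. if k = l then d else 0) [0..<length fs]"
    using c by (fastforce simp: check_def Let_def list_all_iff Es_def cols_def)+
  define F where "F cs = (\<Sum>(m, c)\<leftarrow>cs. scale_poly (of_int c) (single (monom_of (Es ! m)) 1))" for cs
  have Ff: "F cs \<in> forms {..<length ns} ((!) ns) ((!) as)"
    if "\<And>m c. (m, c) \<in> set cs \<Longrightarrow> m < length Es" for cs
    using that
  proof (induction cs)
    case (Cons x cs)
    obtain m c where x: "x = (m, c)" by (cases x)
    have "m < length Es" using Cons.prems x by auto
    hence "Es ! m \<in> set (exponents ns as)" by (simp add: Es_def)
    from exponents_sound[OF len(2) this]
    have "monom_of (Es ! m) \<in> monoms {..<length ns} ((!) ns) ((!) as)"
      by (intro monom_of_monoms) auto
    hence "scale_poly (of_int c) (single (monom_of (Es ! m)) 1) \<in>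
        forms {..<length ns} ((!) ns) ((!) as)"
      by (intro forms_scale) (simp add: forms_single)
    moreover have "F cs \<in> forms {..<length ns} ((!) ns) ((!) as)"
      by (rule Cons.IH) (use Cons.prems in auto)
    ultimately show ?case by (simp add: F_def x forms_add)
  qed (simp add: F_def)
  have jets: "jet (cert_point ns (pts ! fst (fs ! l))) (snd (fs ! l)) (F cs) =
      of_int (foldr (\<lambda>(m, c). map2 (\<lambda>x y. c * x + y) (cols ! m)) cs (replicate (length fs) 0) ! l)
      \<and> length (foldr (\<lambda>(m, c). map2 (\<lambda>x y. c * x + y) (cols ! m)) cs (replicate (length fs) 0)) =
        length fs"
    if "\<And>m c. (m, c) \<in> set cs \<Longrightarrow> m < length Es" "l < length fs" for cs l
    using that
  proof (induction cs)
    case Nil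
    thus ?case by (simp add: F_def functional_zero[OF functional_jet])
  next
    case (Cons x cs)
    obtain m c where x: "x = (m, c)" by (cases x)
    obtain t u where tu: "fs ! l = (t, u)" by (cases "fs ! l")
    hence "(t, u) \<in> set fs" using Cons.prems(2) by (metis nth_mem)
    have mE: "m < length Es" using Cons.prems(1) x by auto
    hence "Es ! m \<in> set (exponents ns as)" by (simp add: Es_def)
    from exponents_sound[OF len(2) this]
    have "jet (cert_point ns (pts ! t)) u (single (monom_of (Es ! m)) 1) =
        of_int (monom_jet (pts ! t) u (Es ! m))"
      using fs[OF \<open>(t, u) \<in> set fs\<close>] pts[of "pts ! t"] tl[OF \<open>(t, u) \<in> set fs\<close>]
      by (intro monom_jet_correct) auto
    moreover have "cols ! m ! l = monom_jet (pts ! t) u (Es ! m)" "length (cols ! m) = length fs"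
      using mE Cons.prems(2) tu by (simp_all add: cols_def)
    moreover note Cons.IH[OF Cons.prems(1)[OF list.set_intros(2)] Cons.prems(2)]
    ultimately show ?case
      using Cons.prems(2) tu x
      by (simp add: F_def functional_add[OF functional_jet] functional_scale[OF functional_jet])
  qed
  show ?thesis
  proof (intro bexI allI impI)
    show "scale_poly (1 / of_int d) (F cs) \<in> forms {..<length ns} ((!) ns) ((!) as)"
      by (intro forms_scale Ff m)
    fix l assume l: "l < length fs"
    from jets[OF m l] show "jet (cert_point ns (pts ! fst (fs ! l))) (snd (fs ! l))
        (scale_poly (1 / of_int d) (F cs)) = (if k = l then 1 else 0)"
      using d l by (simp add: functional_scale[OF functional_jet] fold)
  qed
qed

lemma set_all_jets: "set (all_jets ns s) = {..<s} \<times> affine_jets {..<length ns} ((!) ns)"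
  by (auto simp: all_jets_def affine_jets_iff image_iff)

lemma check_affine:
  assumes "check ns as pts fs cert" "t < length pts"
  shows "affine {..<length ns} ((!) ns) (cert_point ns (pts ! t))"
  using assms by (intro cert_point_affine) (auto simp: check_def Let_def list_all_iff)

lemma check_separates:
  assumes c: "check ns as pts (all_jets ns (length pts)) cert"
  shows "separates {..<length ns} ((!) ns) ((!) as) (length pts) (\<lambda>t. cert_point ns (pts ! t))"
proof -
  let ?fs = "all_jets ns (length pts)"
  have "\<exists>F\<in>forms {..<length ns} ((!) ns) ((!) as). \<forall>t'<length pts.
      \<forall>u'\<in>affine_jets {..<length ns} ((!) ns).
        jet (cert_point ns (pts ! t')) u' F = (if t' = t \<and> u' = u then 1 else 0)"
    if tu: "t < length pts" "u \<in> affine_jets {..<length ns} ((!) ns)" for t u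
  proof -
    have "(t, u) \<in> set ?fs" using tu by (simp add: set_all_jets)
    then obtain k where k: "k < length ?fs" "?fs ! k = (t, u)" by (metis in_set_conv_nth)
    obtain F where F: "F \<in> forms {..<length ns} ((!) ns) ((!) as)"
      "\<forall>l<length ?fs. jet (cert_point ns (pts ! fst (?fs ! l))) (snd (?fs ! l)) F =
        (if k = l then 1 else 0)"
      using check_dual[OF c _ k(1)] by (auto simp: set_all_jets)
    have "jet (cert_point ns (pts ! t')) u' F = (if t' = t \<and> u' = u then 1 else 0)"
      if tu': "t' < length pts" "u' \<in> affine_jets {..<length ns} ((!) ns)" for t' u'
    proof -
      have "(t', u') \<in> set ?fs" using tu' by (simp add: set_all_jets)
      then obtain l where l: "l < length ?fs" "?fs ! l = (t', u')" by (metis in_set_conv_nth)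
      have "jet (cert_point ns (pts ! t')) u' F = (if k = l then 1 else 0)"
        using F(2) l by auto
      \<comment> \<open>Distinctness of the listed jets comes from the dual form itself: a jet
        repeated at another position would have both values 1 and 0.\<close>
      moreover have "k = l \<longleftrightarrow> t' = t \<and> u' = u"
      proof
        assume "t' = t \<and> u' = u"
        hence "jet (cert_point ns (pts ! t')) u' F = 1" using F(2) k by auto
        with calculation show "k = l" by (metis zero_neq_one)
      qed (use k l in auto)
      ultimately show ?thesis by simp
    qed
    with F(1) show ?thesis by blast
  qed
  thus "separates {..<length ns} ((!) ns) ((!) as) (length pts) (\<lambda>t. cert_point ns (pts ! t))"
    using check_affine[OF c] by (auto simp: separates_def)
qed

text \<open>For use when conditions outnumber forms and cannot all be independent: as many jets as
  there are forms are selected, and dual forms for these show that a form is determined by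
  them.\<close>

lemma check_kills:
  assumes c: "check ns as pts fs cert" and ns: "ns \<noteq> []" "\<forall>i<length ns. as ! i > 0"
    and fs: "set fs \<subseteq> set (all_jets ns (length pts))"
    and N: "length fs = (\<Prod>i<length ns. (ns ! i + as ! i) choose as ! i)"
  shows "kills {..<length ns} ((!) ns) ((!) as) (length pts) (\<lambda>t. cert_point ns (pts ! t))"
proof -
  let ?V = "forms {..<length ns} ((!) ns) ((!) as)"
  define l where "l k = jet (cert_point ns (pts ! fst (fs ! k))) (snd (fs ! k))" for k
  have "\<forall>k\<in>{..<length fs}. \<exists>F\<in>?V. \<forall>l'\<in>{..<length fs}. l l' F = (if k = l' then 1 else 0)"
    using check_dual[OF c] fs unfolding set_all_jets l_def by blast
  then obtain F where F: "\<And>k. k \<in> {..<length fs} \<Longrightarrow> F k \<in> ?V"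
    "\<And>k l'. k \<in> {..<length fs} \<Longrightarrow> l' \<in> {..<length fs} \<Longrightarrow> l l' (F k) = (if k = l' then 1 else 0)"
    by metis
  have "poly_vs.dim ?V = poly_vs.dim (kernel_on ?V {..<length fs} l) + card {..<length fs}"
  proof (rule dim_kernel_dual[OF subspace_forms forms_finite_dim, where F = F])
    show "l i (F j) = (if i = j then 1 else 0)" if "i \<in> {..<length fs}" "j \<in> {..<length fs}" for i j
      using F(2)[OF that(2,1)] by auto
  qed (use F in \<open>auto simp: l_def functional_jet\<close>)
  hence "poly_vs.dim (kernel_on ?V {..<length fs} l) = 0"
    by (simp add: dim_forms N)
  moreover have "kernel_on ?V {..<length fs} l \<subseteq>
      poly_vs.span (monomial_basis {..<length ns} ((!) ns) ((!) as))"
    using forms_subset_span by (auto simp: kernel_on_def)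
  ultimately have ker: "kernel_on ?V {..<length fs} l \<subseteq> {0}"
    by (rule dim_eq_0_imp[OF _ forms_finite_dim(1)[OF finite_lessThan]])
  have aff: "\<forall>t<length pts. affine {..<length ns} ((!) ns) (cert_point ns (pts ! t))"
    using check_affine[OF c] by blast
  have "sing_forms {..<length ns} ((!) ns) ((!) as) (length pts) (\<lambda>t. cert_point ns (pts ! t)) \<subseteq>
      kernel_on ?V {..<length fs} l"
  proof
    fix F assume F: "F \<in> sing_forms {..<length ns} ((!) ns) ((!) as) (length pts)
        (\<lambda>t. cert_point ns (pts ! t))"
    have "l k F = 0" if "k < length fs" for k
    proof -
      have "fs ! k \<in> {..<length pts} \<times> affine_jets {..<length ns} ((!) ns)"
        using that fs nth_mem[OF that] unfolding set_all_jets by blast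
      with F ns show ?thesis
        using sing_forms_affine[of "{..<length ns}" "(!) as", OF _ _ _ aff]
        by (cases "fs ! k") (auto simp: l_def)
    qed
    with F show "F \<in> kernel_on ?V {..<length fs} l"
      by (simp add: kernel_on_def sing_forms_def)
  qed
  with ker aff zero_sing_forms show ?thesis by (auto simp: kills_def)
qed

definition independent4 :: "nat list \<Rightarrow> nat list \<Rightarrow> bool" where
  "independent4 n a \<longleftrightarrow> (\<exists>P. separates {..<length n} ((!) n) ((!) a) 4 P)"

definition complete4 :: "nat list \<Rightarrow> nat list \<Rightarrow> bool" where
  "complete4 n a \<longleftrightarrow> (\<exists>P. kills {..<length n} ((!) n) ((!) a) 4 P)"

text \<open>Any four points at which the matrix of jets has full row rank would serve. The certified
  cases use small integer coordinates, with coordinate points and their sums where possible, to keep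
  the inverses sparse.\<close>

lemma check_independent4:
  assumes "length pts = 4 \<and> check n a pts (all_jets n 4) cert"
  shows "independent4 n a"
  using assms check_separates[of n a pts cert] by (auto simp: independent4_def)

lemma check_complete4:
  assumes "length pts = 4 \<and> n \<noteq> [] \<and> length a = length n \<and> list_all (\<lambda>x. x > 0) a \<and> check n a pts fs cert \<and>
    set fs \<subseteq> set (all_jets n 4) \<and> length fs = prod_list (map2 (\<lambda>x y. (x + y) choose y) n a)"
  shows "complete4 n a"
proof -
  have "prod_list (map2 (\<lambda>x y. (x + y) choose y) n a) =
      (\<Prod>i<length n. (n ! i + a ! i) choose a ! i)"
    using assms by (simp add: prod.list_conv_set_nth lessThan_atLeast0)
  thus ?thesis
    using assms check_kills[of n a pts fs cert] by (auto simp: complete4_def list_all_length)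
qed

section \<open>Certificates of independent conditions in the minimal cases\<close>

lemma independent4_1_7: "independent4 [1] [7]"
  by (rule check_independent4[where pts = "[[[1,-1]],[[1,1]],[[1,0]],[[1,2]]]" and
      cert = "[(108,[(2,56), (3,-124), (4,50), (5,59), (6,-52), (7,11)]), (36,[(2,4), (3,-8), (4,1),
        (5,7), (6,-5), (7,1)]), (4,[(2,8), (3,4), (4,-10), (5,-1), (6,4), (7,-1)]), (4,[(2,-4),
        (4,7), (5,-1), (6,-3), (7,1)]), (4,[(0,4), (2,-11), (3,1), (4,10), (5,-2), (6,-3),
        (7,1)]), (4,[(1,4), (2,-4), (3,-7), (4,8), (5,2), (6,-4), (7,1)]), (108,[(2,25),
        (3,-11), (4,-50), (5,22), (6,25), (7,-11)]), (36,[(2,-2), (3,1), (4,4), (5,-2), (6,-2),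
        (7,1)])]"])
    code_simp

lemma independent4_2_4: "independent4 [2] [4]"
  by (rule check_independent4[where pts = "[[[1,0,0]],[[1,1,0]],[[1,0,1]],[[1,1,1]]]" and
      cert = "[(1,[(0,1), (3,-3), (5,-3), (6,2), (7,2), (8,2), (9,2), (11,-2), (12,1), (13,-2)]),
        (1,[(1,1), (3,-2), (6,1), (7,1), (8,-1), (11,-1), (12,1)]), (1,[(2,1), (5,-2), (7,-1),
        (8,1), (9,1), (12,1), (13,-1)]), (1,[(3,3), (6,-2), (7,-2), (8,-2), (11,2), (12,-1),
        (13,2)]), (1,[(3,-1), (6,1), (7,1), (11,-1)]), (1,[(7,1), (8,-1), (12,-1), (13,1)]),
        (1,[(5,3), (7,-2), (8,-2), (9,-2), (11,2), (12,-1), (13,2)]), (1,[(7,-1), (8,1),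
        (11,1), (12,-1)]), (1,[(5,-1), (8,1), (9,1), (13,-1)]), (1,[(7,2), (8,2), (11,-2),
        (12,1), (13,-2)]), (1,[(7,-1), (11,1)]), (1,[(8,-1), (13,1)])]"])
    code_simp

lemma independent4_3_3: "independent4 [3] [3]"
  by (rule check_independent4[where pts = "[[[1,0,0,0]],[[1,1,0,0]],[[1,0,1,0]],[[1,0,0,1]]]" and
      cert = "[(1,[(0,1), (4,-3), (7,-3), (9,-3), (10,2), (16,2), (19,2)]), (1,[(1,1), (4,-2),
        (10,1), (13,-1), (15,-1)]), (1,[(2,1), (7,-2), (11,-1), (16,1), (18,-1)]), (1,[(3,1),
        (9,-2), (12,-1), (17,-1), (19,1)]), (1,[(4,3), (10,-2)]), (1,[(4,-1), (10,1)]),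
        (1,[(11,1)]), (1,[(12,1)]), (1,[(7,3), (16,-2)]), (1,[(13,1)]), (1,[(7,-1), (16,1)]),
        (1,[(17,1)]), (1,[(9,3), (19,-2)]), (1,[(15,1)]), (1,[(18,1)]), (1,[(9,-1), (19,1)])]"])
    code_simp

lemma independent4_11_15: "independent4 [1,1] [1,5]"
  by (rule check_independent4[where pts = "[[[1,0],[1,0]],[[1,1],[1,1]],[[1,0],[1,-1]],[[1,2],[1,2]]]" and
      cert = "[(4,[(0,4), (2,-7), (3,1), (4,3), (5,-1), (7,-8), (8,8), (9,6), (10,-8), (11,2)]),
        (4,[(6,4), (7,-8), (8,1), (9,7), (10,-5), (11,1)]), (4,[(1,4), (2,2), (3,-6), (4,-2),
        (5,2), (7,-10), (8,7), (9,9), (10,-7), (11,1)]), (4,[(2,2), (3,3), (5,-1), (7,10),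
        (8,-7), (9,-9), (10,7), (11,-1)]), (4,[(2,-2), (3,-3), (5,1), (7,-6), (8,11), (9,6),
        (10,-9), (11,2)]), (2,[(7,-4), (8,4), (9,3), (10,-4), (11,1)]), (36,[(2,46), (3,-35),
        (4,-28), (5,17), (7,-42), (8,23), (9,41), (10,-23), (11,1)]), (36,[(7,-4), (8,12),
        (9,-13), (10,6), (11,-1)]), (6,[(2,2), (3,-1), (4,-2), (5,1), (7,-2), (8,1), (9,2),
        (10,-1)]), (36,[(2,-1), (3,-1), (4,1), (5,1), (7,24), (8,-32), (9,-14), (10,32),
        (11,-10)]), (36,[(2,2), (3,2), (4,-2), (5,-2), (7,-8), (8,7), (9,5), (10,-7), (11,3)]),
        (12,[(7,-2), (8,3), (9,1), (10,-3), (11,1)])]"])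
    code_simp

lemma independent4_11_23: "independent4 [1,1] [2,3]"
  by (rule check_independent4[where pts = "[[[1,0],[1,0]],[[1,1],[1,1]],[[1,1],[1,-1]],[[1,2],[1,2]]]" and
      cert = "[(4,[(0,4), (2,-15), (3,7), (5,-4), (6,22), (7,-10), (8,-4), (9,4), (10,-7), (11,3)]),
        (4,[(2,-6), (3,3), (4,4), (5,-2), (6,8), (7,-4), (8,-4), (9,2), (10,-2), (11,1)]),
        (4,[(1,4), (2,-4), (3,1), (5,-8), (6,8), (7,-2), (9,4), (10,-4), (11,1)]), (4,[(2,6),
        (3,-3), (5,8), (6,-8), (7,2), (8,2), (9,-5), (10,2)]), (2,[(2,-6), (3,3), (5,-2),
        (6,11), (7,-5), (9,2), (10,-5), (11,2)]), (4,[(2,-9), (3,9), (5,-6), (6,18), (7,-12),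
        (8,-1), (9,5), (10,-8), (11,4)]), (12,[(2,10), (3,1), (5,-16), (6,-8), (7,2), (8,6),
        (9,7), (10,-2)]), (6,[(2,-2), (3,1), (5,2), (6,1), (7,-1), (9,-2), (10,1)]), (4,[(2,1),
        (3,1), (5,-2), (6,-2), (8,1), (9,1)]), (12,[(2,17), (3,-13), (5,4), (6,-34), (7,22),
        (9,-4), (10,17), (11,-9)]), (12,[(2,-4), (3,5), (5,-2), (6,8), (7,-8), (9,2), (10,-4),
        (11,3)]), (4,[(2,-2), (3,1), (6,4), (7,-2), (10,-2), (11,1)])]"])
    code_simp

lemma independent4_12_13: "independent4 [1,2] [1,3]"
  by (rule check_independent4[where pts = "[[[1,0],[1,0,0]],[[1,1],[1,1,0]],[[1,0],[1,0,1]],[[1,0],[1,-1,1]]]" and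
      cert = "[(1,[(0,1), (3,-1), (4,-1), (5,-3), (7,1), (8,1), (9,2), (11,-2), (13,2), (18,4)]),
        (1,[(10,1), (11,-2), (13,1), (15,-1), (18,3)]), (1,[(1,1), (3,-1), (4,-3), (7,1),
        (8,2), (11,-1), (13,1), (14,2)]), (1,[(2,1), (5,-2), (9,1), (14,-1), (18,1)]),
        (1,[(3,1), (4,1), (7,-1), (8,-1), (11,2), (13,-2), (18,-4)]), (1,[(3,-1), (4,-1),
        (7,1), (8,1), (13,1), (18,1)]), (1,[(11,-1), (13,1), (18,2)]), (1,[(14,1), (18,-1)]),
        (1,[(3,2), (4,5), (5,3), (6,-2), (7,-5), (8,-5), (9,-2), (11,-2), (13,2), (18,4)]),
        (1,[(15,1), (18,1)]), (1,[(3,-1), (4,-1), (6,1), (7,3), (8,2), (11,1), (13,-1),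
        (14,-2)]), (1,[(4,-1), (5,-1), (8,1), (9,1), (14,1), (18,-1)]), (1,[(3,-2), (4,-5),
        (6,2), (7,5), (8,5), (11,2), (13,-2), (18,-4)]), (1,[(18,-1)]), (1,[(3,-1), (4,-2),
        (6,1), (7,2), (8,2), (11,1), (13,-1), (18,-2)]), (1,[(4,1), (8,-1), (14,-1), (18,1)])]"])
    code_simp

lemma independent4_13_41: "independent4 [1,3] [4,1]"
  by (rule check_independent4[where pts = "[[[1,0],[1,0,0,0]],[[1,1],[1,1,0,0]],[[1,2],[1,0,1,0]],[[1,-1],[1,0,0,1]]]" and
      cert = "[(4,[(0,4), (5,-6), (6,-4), (7,2), (8,-5), (9,3), (10,2), (11,-1), (13,6), (14,4),
        (15,-2), (16,1), (17,-3), (18,-2), (19,1)]), (2,[(4,2), (5,-2), (6,-2), (7,-2), (8,-1),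
        (9,1), (10,1), (11,1), (12,-2), (13,2), (14,2), (15,2), (16,1), (17,-1), (18,-1),
        (19,-1)]), (2,[(1,2), (5,-3), (9,-1), (13,3), (17,-1)]), (4,[(2,4), (6,-4), (10,-3),
        (14,4), (18,-1)]), (2,[(3,2), (7,1), (11,-3), (15,-1), (19,1)]), (4,[(5,6), (6,8),
        (7,2), (8,4), (9,-3), (10,-4), (11,-1), (12,2), (13,-6), (14,-8), (15,-2), (16,-2),
        (17,3), (18,4), (19,1)]), (2,[(5,-2), (9,1), (13,2), (17,-1)]), (4,[(6,-8), (7,-2),
        (8,-4), (9,4), (10,4), (11,1), (12,-2), (13,2), (14,8), (15,2), (16,2), (17,-2),
        (18,-4), (19,-1)]), (2,[(6,4), (14,-3), (18,1)]), (4,[(7,2), (11,3), (19,-1)]),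
        (36,[(5,6), (6,-28), (7,-2), (8,-3), (9,-3), (10,14), (11,1), (13,-6), (14,28), (15,2),
        (16,3), (17,3), (18,-14), (19,-1)]), (6,[(6,2), (10,-1), (14,-2), (18,1)]), (6,[(5,1),
        (9,-1), (13,-1), (17,1)]), (36,[(5,-6), (7,2), (8,3), (9,3), (10,-3), (11,-1), (13,6),
        (15,-2), (16,-3), (17,-3), (18,3), (19,1)]), (18,[(7,-1), (11,-1), (15,1), (19,1)]),
        (36,[(5,-6), (6,-8), (7,-34), (8,12), (9,3), (10,4), (11,17), (12,-18), (13,6), (14,8),
        (15,34), (16,6), (17,-3), (18,-4), (19,-17)]), (6,[(7,-2), (11,1), (15,2), (19,-1)]),
        (12,[(5,-2), (9,5), (13,-4), (17,1)]), (18,[(6,-4), (10,8), (14,-5), (18,1)]),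
        (36,[(5,6), (6,8), (8,-12), (9,-3), (10,-4), (11,12), (12,18), (13,-6), (14,-8),
        (15,-18), (16,-6), (17,3), (18,4), (19,6)])]"])
    code_simp

lemma independent4_13_12: "independent4 [1,3] [1,2]"
  by (rule check_independent4[where pts = "[[[1,0],[1,0,0,0]],[[1,1],[1,1,0,0]],[[1,2],[1,0,1,0]],[[1,-1],[1,0,0,1]]]" and
      cert = "[(1,[(0,1), (4,-1), (5,-2), (6,-2), (7,-1), (8,-2), (9,-1), (11,-2), (12,-1), (13,2),
        (14,2), (15,3), (17,1), (18,-1), (19,-2)]), (1,[(10,1), (11,-2), (12,-2), (13,-2),
        (14,1), (15,2), (16,2), (17,1), (18,2), (19,1)]), (1,[(1,1), (4,-1), (5,-1), (6,-1),
        (11,-1), (14,1), (15,1), (16,1)]), (2,[(2,2), (5,-2), (7,-2), (8,-2), (12,-1), (15,1),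
        (17,1), (18,1)]), (1,[(3,1), (6,-1), (8,-1), (9,-1), (13,1), (16,-1), (18,-1),
        (19,-1)]), (1,[(4,1), (5,4), (6,1), (11,2), (14,-2), (15,-4), (16,-1)]), (1,[(4,-1),
        (14,1)]), (2,[(5,-4), (6,-1), (11,-2), (14,2), (15,4), (16,1)]), (1,[(5,2), (15,-1)]),
        (2,[(6,1), (16,1)]), (3,[(5,-6), (7,3), (8,2), (12,3), (15,3), (17,-3), (18,-1)]),
        (1,[(7,-2), (17,1)]), (1,[(5,-1), (15,1)]), (6,[(5,6), (8,-2), (12,-3), (15,-3),
        (17,3), (18,1)]), (3,[(8,1), (18,1)]), (3,[(6,3), (8,4), (9,3), (13,-6), (16,3),
        (18,4), (19,6)]), (1,[(9,1), (19,1)]), (2,[(6,1), (16,-1)]), (3,[(8,2), (18,-1)]),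
        (6,[(6,-3), (8,-4), (13,6), (16,-3), (18,-4), (19,-6)])]"])
    code_simp

lemma independent4_22_22: "independent4 [2,2] [2,2]"
  by (rule check_independent4[where pts = "[[[1,0,0],[1,0,0]],[[1,1,0],[1,1,0]],[[1,0,1],[1,0,1]],[[1,1,1],[1,1,1]]]" and
      cert = "[(1,[(0,1), (3,-2), (5,-2), (9,2), (11,2), (17,2), (18,-1), (20,2), (22,-2), (29,-2),
        (30,-1), (33,1)]), (2,[(3,-2), (4,1), (6,2), (9,2), (11,-2), (18,-2), (20,1), (22,-2),
        (23,2), (31,-1), (33,1)]), (1,[(5,-1), (11,1), (12,1), (15,-1), (17,1), (29,-1),
        (30,-1), (33,1)]), (2,[(1,2), (3,-3), (9,2), (18,-1), (20,2), (22,-2), (31,-2),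
        (33,2)]), (2,[(2,2), (4,-1), (5,-3), (11,2), (17,2), (20,-1), (23,1), (29,-2), (30,-1),
        (31,1)]), (1,[(3,2), (9,-2), (11,-2), (18,1), (20,-2), (22,2), (29,2), (33,-1)]),
        (2,[(3,-2), (4,1), (9,2), (20,1), (22,-2), (31,-1), (33,1)]), (1,[(11,-1), (15,1),
        (29,1), (33,-1)]), (2,[(3,-1), (9,2), (18,-1), (20,2), (22,-2)]), (2,[(4,1), (11,-2),
        (20,1), (23,-1), (29,2), (31,-1)]), (1,[(5,2), (11,-2), (17,-2), (20,-2), (22,2),
        (29,2), (30,1), (33,-1)]), (2,[(4,-1), (11,2), (20,-1), (22,2), (23,-2), (31,1),
        (33,-1)]), (1,[(5,-1), (11,1), (17,1), (29,-1)]), (1,[(20,-1), (22,1), (31,1),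
        (33,-1)]), (2,[(4,-1), (5,-1), (11,2), (17,2), (20,1), (23,-1), (29,-2), (30,-1),
        (31,1)]), (1,[(11,2), (20,2), (22,-2), (29,-2), (33,1)]), (2,[(4,-1), (20,-1), (22,2),
        (31,1), (33,-1)]), (1,[(11,-1), (29,1)]), (1,[(20,-1), (22,1)]), (2,[(4,1), (11,-2),
        (20,-1), (23,1), (29,2), (31,-1)])]"])
    code_simp

lemma independent4_23_21: "independent4 [2,3] [2,1]"
  by (rule check_independent4[where pts = "[[[1,0,0],[1,0,0,0]],[[1,1,0],[1,1,0,0]],[[1,0,1],[1,0,1,0]],[[1,1,1],[1,0,0,1]]]" and
      cert = "[(1,[(0,1), (5,-2), (6,-1), (7,-1), (9,-1), (10,-2), (11,-1), (12,-1), (13,2), (14,1),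
        (15,1), (16,1), (20,-1), (21,1), (22,2), (23,1)]), (1,[(4,1), (5,-1), (6,-1), (7,-1),
        (12,-1), (13,1), (14,1), (15,1)]), (1,[(8,1), (9,-1), (10,-1), (11,-1), (20,-1),
        (21,1), (22,1), (23,1)]), (1,[(1,1), (5,-2), (9,-1), (13,1), (17,1)]), (1,[(2,1),
        (6,-1), (10,-2), (18,1), (22,1)]), (1,[(3,1), (7,-1), (11,-1), (19,1)]), (1,[(5,2),
        (6,1), (7,1), (9,1), (11,-1), (12,1), (13,-2), (14,-1), (15,-1), (16,-1), (21,-1),
        (23,1)]), (1,[(5,-1), (13,1)]), (1,[(9,1), (21,-1)]), (1,[(6,-1), (7,-1), (11,1),
        (12,-1), (13,1), (14,1), (15,1), (16,1), (17,-1), (23,-1)]), (1,[(6,1), (18,-1)]),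
        (1,[(7,1), (11,-1), (19,-1), (23,1)]), (1,[(6,1), (7,-1), (9,1), (10,2), (11,1),
        (14,-1), (15,1), (16,-1), (20,1), (21,-1), (22,-2), (23,-1)]), (1,[(6,1), (14,-1)]),
        (1,[(10,-1), (22,1)]), (1,[(9,1), (17,-1)]), (1,[(7,1), (9,-1), (11,-1), (15,-1),
        (16,1), (18,-1), (20,-1), (21,1), (22,1), (23,1)]), (1,[(7,-1), (11,1), (15,1),
        (19,-1)]), (1,[(6,-1), (7,1), (9,-1), (11,1), (14,1), (15,-1), (16,1), (21,1),
        (23,-1)]), (1,[(7,-1), (15,1)]), (1,[(11,-1), (23,1)]), (1,[(9,-1), (17,1), (21,1)]),
        (1,[(6,-1), (14,1), (18,1)]), (1,[(6,1), (9,1), (14,-1), (16,-1), (19,1), (21,-1)])]"])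
    code_simp

lemma independent4_111_311: "independent4 [1,1,1] [3,1,1]"
  by (rule check_independent4[where pts = "[[[1,0],[1,0],[1,0]],[[1,1],[1,1],[1,1]],[[1,-1],[1,1],[1,1]],[[1,2],[1,2],[1,0]]]" and
      cert = "[(4,[(0,4), (3,-4), (5,-2), (6,-2), (7,4), (8,-9), (9,5), (10,5), (11,-1), (12,4),
        (13,-2), (14,-2)]), (4,[(4,4), (5,-4), (6,-4), (7,4), (8,-4), (9,4), (10,4), (11,-4),
        (12,1), (13,-1), (14,-1), (15,1)]), (4,[(2,4), (3,-4), (6,-2), (7,2), (8,-6), (9,6),
        (10,2), (11,-2), (12,3), (13,-3), (14,-1), (15,1)]), (2,[(1,2), (3,-2), (5,-1), (7,1),
        (9,-2), (11,2), (13,1), (15,-1)]), (4,[(3,2), (5,4), (6,4), (7,-5), (8,12), (9,-10),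
        (10,-10), (11,8), (12,-6), (13,4), (14,4), (15,-3)]), (4,[(3,-1), (5,-3), (7,2),
        (11,1), (13,3), (15,-2)]), (2,[(5,-2), (7,2), (9,-1), (11,1), (13,1), (15,-1)]),
        (2,[(6,-2), (7,2), (8,-6), (9,6), (10,5), (11,-5), (12,3), (13,-3), (14,-2), (15,2)]),
        (12,[(3,6), (5,-8), (6,-4), (7,3), (8,4), (9,2), (10,2), (11,-8), (12,-2), (13,4),
        (15,1)]), (4,[(3,1), (5,-1), (11,-1), (13,1)]), (6,[(5,2), (7,-2), (9,-3), (11,3),
        (13,1), (15,-1)]), (6,[(6,2), (7,-2), (8,-2), (9,2), (10,-1), (11,1), (12,1),
        (13,-1)]), (12,[(5,2), (6,-2), (8,-13), (9,13), (10,13), (11,-13), (12,8), (13,-10),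
        (14,-6), (15,8)]), (4,[(8,2), (9,-2), (10,-2), (11,2), (12,-1), (13,1), (14,1),
        (15,-1)]), (12,[(6,2), (7,-2), (8,4), (9,-4), (10,-4), (11,4), (12,-5), (13,5), (14,3),
        (15,-3)]), (6,[(5,1), (7,-1), (13,-1), (15,1)])]"])
    code_simp

lemma independent4_111_221: "independent4 [1,1,1] [2,2,1]"
  by (rule check_independent4[where pts = "[[[1,0],[1,0],[1,0]],[[1,1],[1,1],[1,2]],[[1,1],[1,0],[1,1]],[[1,0],[1,1],[1,1]]]" and
      cert = "[(1,[(0,1), (3,-2), (4,-1), (5,2), (7,-2), (11,2), (12,-1), (13,2), (15,2), (16,1),
        (17,-4)]), (1,[(6,1), (7,-1), (10,-1), (11,1), (12,-1), (13,1), (16,1), (17,-1)]),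
        (1,[(2,1), (3,-1), (4,-1), (5,1), (14,-1), (15,1), (16,1), (17,-1)]), (1,[(1,1),
        (3,-2), (5,1), (7,-2), (11,2), (13,1), (15,2), (17,-3)]), (1,[(10,-2), (11,2), (14,-2),
        (15,2), (16,5), (17,-4)]), (1,[(10,1), (11,-1), (16,-1), (17,1)]), (1,[(14,1), (15,-1),
        (16,-1), (17,1)]), (1,[(16,-2), (17,1)]), (1,[(7,2), (11,-2), (12,1), (13,-2), (14,2),
        (15,-2), (16,-3), (17,4)]), (1,[(7,-1), (11,1), (13,1), (17,-1)]), (1,[(14,2), (15,-1),
        (16,-2), (17,1)]), (1,[(12,-1), (13,1), (14,2), (15,-2), (16,-1), (17,1)]), (1,[(3,2),
        (4,1), (5,-2), (10,2), (11,-2), (15,-2), (16,-3), (17,4)]), (1,[(10,2), (11,-1),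
        (16,-2), (17,1)]), (1,[(3,-1), (5,1), (15,1), (17,-1)]), (1,[(4,-1), (5,1), (10,2),
        (11,-2), (16,-1), (17,1)])]"])
    code_simp

lemma independent4_112_112: "independent4 [1,1,2] [1,1,2]"
  by (rule check_independent4[where pts = "[[[1,0],[1,0],[1,0,0]],[[1,1],[1,1],[1,1,0]],[[1,0],[1,1],[1,0,1]],[[1,1],[1,0],[1,1,1]]]" and
      cert = "[(1,[(0,1), (3,-1), (4,1), (5,-1), (7,-2), (8,-2), (9,2), (10,1), (11,2), (14,-2),
        (16,1), (17,1), (20,3), (22,-2), (23,-2)]), (1,[(3,-1), (4,1), (9,1), (10,-1), (12,1),
        (14,-2), (16,1), (18,-1), (20,2), (22,-1)]), (1,[(6,1), (7,-2), (8,-2), (9,1), (10,2),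
        (11,1), (20,1), (22,-1), (23,-1)]), (1,[(1,1), (3,-1), (7,-1), (9,1), (14,-1), (16,1),
        (20,1), (22,-1)]), (1,[(2,1), (5,-1), (8,-1), (11,1), (14,-1), (17,1), (20,1),
        (23,-1)]), (1,[(3,1), (4,-1), (7,2), (9,-2), (10,-1), (16,-1), (17,1), (20,1), (22,2),
        (23,-2)]), (1,[(7,-2), (9,1), (10,2), (18,1), (20,-1), (22,-1)]), (1,[(3,-1), (4,1),
        (9,1), (10,-1), (16,1), (17,-1), (22,-1), (23,1)]), (1,[(7,-1), (9,1), (10,1),
        (22,-1)]), (1,[(20,1), (23,-1)]), (1,[(4,-1), (5,1), (8,2), (10,1), (11,-2), (16,1),
        (17,-1), (20,-1), (22,-2), (23,2)]), (1,[(20,1), (22,-1)]), (1,[(4,1), (5,-1), (10,-1),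
        (11,1), (16,-1), (17,1), (22,1), (23,-1)]), (1,[(10,1), (22,-1)]), (1,[(8,-1), (11,1),
        (20,1), (23,-1)]), (1,[(4,1), (10,-1), (14,2), (16,-1), (17,-1), (20,-3), (22,2),
        (23,2)]), (1,[(4,-1), (10,1), (16,1), (22,-1)]), (1,[(20,-1), (22,1), (23,1)]),
        (1,[(14,-1), (16,1), (20,1), (22,-1)]), (1,[(14,-1), (17,1), (20,1), (23,-1)])]"])
    code_simp

lemma independent4_113_211: "independent4 [1,1,3] [2,1,1]"
  by (rule check_independent4[where pts = "[[[1,0],[1,0],[1,0,0,0]],[[1,1],[1,-1],[1,1,0,0]],[[1,2],[1,0],[1,0,1,0]],[[1,-1],[1,-1],[1,0,0,1]]]" and
      cert = "[(4,[(0,4), (5,4), (6,4), (7,4), (9,-6), (10,-4), (11,2), (13,-6), (14,-4), (15,2),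
        (16,-1), (17,3), (18,2), (19,-1), (20,3), (21,-1), (22,-2), (23,-5)]), (2,[(8,2),
        (9,-2), (10,-2), (11,-2), (12,2), (13,-2), (14,-2), (15,-2), (16,-1), (17,1), (18,1),
        (19,1), (20,-1), (21,1), (22,1), (23,1)]), (1,[(4,1), (5,-1), (6,-1), (7,-1), (20,-1),
        (21,1), (22,1), (23,1)]), (2,[(1,2), (5,2), (9,-3), (13,-3), (17,1), (21,1)]),
        (4,[(2,4), (6,4), (10,-4), (14,-4), (18,1), (22,1)]), (2,[(3,2), (7,2), (11,1), (15,1),
        (19,-1), (23,-1)]), (4,[(5,-3), (6,-4), (7,-1), (9,8), (12,-2), (13,8), (17,-4),
        (20,-2), (21,-1), (22,4), (23,1)]), (2,[(5,1), (21,-1)]), (1,[(9,2), (13,2), (17,-1),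
        (21,-1)]), (4,[(6,4), (7,1), (12,2), (13,-2), (20,2), (21,-2), (22,-4), (23,-1)]),
        (2,[(6,-2), (14,-1), (22,1)]), (4,[(7,-1), (15,-2), (23,-1)]), (12,[(6,4), (9,-6),
        (10,12), (11,2), (13,-6), (14,12), (15,2), (16,3), (17,3), (18,-6), (19,-1), (20,3),
        (21,3), (22,-10), (23,-1)]), (2,[(10,-2), (14,-2), (18,1), (22,1)]), (3,[(6,-1),
        (22,1)]), (2,[(9,-1), (13,-1), (17,1), (21,1)]), (12,[(9,6), (11,-2), (13,6), (15,-2),
        (16,-3), (17,-3), (18,3), (19,1), (20,-3), (21,-3), (22,3), (23,1)]), (6,[(11,1),
        (15,1), (19,1), (23,1)]), (12,[(5,-3), (6,-4), (7,-9), (11,-8), (12,6), (15,-8),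
        (19,4), (20,-6), (21,3), (22,4), (23,13)]), (2,[(7,-1), (23,1)]), (3,[(11,-2), (15,-2),
        (19,1), (23,1)]), (4,[(5,-1), (13,2), (21,-1)]), (6,[(6,-2), (14,3), (22,-1)]),
        (12,[(5,3), (6,4), (12,-6), (15,6), (20,6), (21,-3), (22,-4), (23,-6)])]"])
    code_simp

lemma independent4_133_111: "independent4 [1,3,3] [1,1,1]"
  by (rule check_independent4[where pts = "[[[1,0],[1,0,0,0],[1,0,0,0]],[[1,1],[1,1,0,0],[1,1,0,0]],[[1,-1],[1,0,1,0],[1,0,1,0]],[[1,2],[1,0,0,1],[1,0,0,1]]]" and
      cert = "[(2,[(0,2), (5,-2), (6,-2), (7,-2), (9,-2), (10,-2), (11,-2), (13,-2), (14,-2),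
        (15,-2), (17,-2), (18,2), (19,-1), (20,-2), (21,4), (23,3), (24,2), (26,-4), (27,-1),
        (28,-1), (29,3), (30,-1), (31,2)]), (1,[(16,1), (17,-1), (18,-1), (19,-1), (20,-1),
        (21,1), (22,1), (23,1), (24,-1), (25,1), (26,1), (27,1), (28,-1), (29,1), (30,1),
        (31,1)]), (1,[(4,1), (5,-1), (6,-1), (7,-1), (20,-1), (21,1), (22,1), (23,1)]),
        (1,[(8,1), (9,-1), (10,-1), (11,-1), (24,1), (25,-1), (26,-1), (27,-1)]), (2,[(12,2),
        (13,-2), (14,-2), (15,-2), (28,-1), (29,1), (30,1), (31,1)]), (1,[(1,1), (5,-1),
        (9,-1), (13,-1), (17,-1), (21,1), (25,1), (29,1)]), (1,[(2,1), (6,-1), (10,-1),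
        (14,-1), (18,1), (22,-1), (26,-1), (30,-1)]), (2,[(3,2), (7,-2), (11,-2), (15,-2),
        (19,-1), (23,1), (27,1), (31,1)]), (2,[(5,2), (6,1), (7,4), (9,1), (13,4), (17,2),
        (20,2), (21,-4), (22,-1), (23,-4), (25,-1), (29,-4)]), (1,[(5,-1), (21,1)]),
        (2,[(9,-1), (13,-4), (17,-2), (21,2), (25,1), (29,4)]), (2,[(9,1), (25,1)]),
        (1,[(13,2), (29,-1)]), (2,[(6,-1), (7,-4), (20,-2), (21,2), (22,1), (23,4)]),
        (2,[(6,1), (22,1)]), (1,[(7,2), (23,-1)]), (6,[(6,3), (9,3), (10,6), (11,4), (14,4),
        (18,-6), (22,3), (24,-6), (25,3), (26,12), (27,4), (30,4)]), (1,[(10,1), (26,1)]),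
        (2,[(6,1), (22,-1)]), (6,[(6,-3), (14,-4), (18,6), (22,-3), (26,-6), (30,-4)]),
        (3,[(14,2), (30,-1)]), (2,[(9,1), (25,-1)]), (6,[(9,-3), (11,-4), (24,6), (25,-3),
        (26,-6), (27,-4)]), (3,[(11,2), (27,-1)]), (6,[(7,-6), (11,2), (13,-6), (14,2), (15,6),
        (19,3), (23,3), (27,-1), (28,3), (29,3), (30,-1), (31,-6)]), (1,[(15,-2), (31,1)]),
        (1,[(7,-1), (23,1)]), (3,[(11,1), (27,1)]), (6,[(7,6), (11,-2), (19,-3), (23,-3),
        (27,1), (31,3)]), (1,[(13,-1), (29,1)]), (3,[(14,1), (30,1)]), (6,[(13,6), (14,-2),
        (28,-3), (29,-3), (30,1), (31,3)])]"])
    code_simp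

lemma independent4_223_111: "independent4 [2,2,3] [1,1,1]"
  by (rule check_independent4[where pts = "[[[1,0,0],[1,0,0],[1,0,0,0]],[[1,1,0],[1,1,0],[1,1,0,0]],[[1,0,1],[1,0,1],[1,0,1,0]],[[1,1,1],[1,0,-1],[1,0,0,1]]]" and
      cert = "[(1,[(0,1), (5,-1), (9,-1), (10,-1), (11,1), (13,-1), (16,-1), (17,2), (20,2), (21,-1),
        (22,-2), (23,-2), (26,-1), (27,-1), (31,1), (32,-1), (33,1), (34,2)]), (1,[(7,1),
        (12,1), (13,-1), (14,-1), (15,-1), (16,-1), (17,1), (18,1), (20,1), (21,-1), (22,-1),
        (23,-1)]), (1,[(9,-2), (20,2), (22,-2), (23,-2), (24,1), (26,-1), (27,-1), (29,-1),
        (32,-1), (33,2), (34,1), (35,1)]), (1,[(4,1), (5,-1), (16,-1), (17,1), (30,-1)]),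
        (1,[(8,1), (9,-1), (10,-1), (11,-1), (32,-1), (33,1), (34,1), (35,1)]), (1,[(1,1),
        (5,-1), (9,-1), (13,-1), (17,1), (21,1)]), (1,[(2,1), (10,-1), (18,-1), (26,-1),
        (34,1)]), (1,[(3,1), (7,-1), (11,1), (27,-1), (31,1), (35,-1)]), (1,[(5,1), (9,-1),
        (13,1), (16,1), (17,-2), (21,1), (31,-1), (33,1)]), (1,[(5,-1), (17,1)]), (1,[(29,1)]),
        (1,[(9,1), (13,-1), (17,1), (21,-1), (33,-1)]), (1,[(9,1), (33,-1)]), (1,[(16,-1),
        (17,1), (31,1)]), (1,[(18,1)]), (1,[(7,1), (31,-1)]), (2,[(7,1), (9,2), (10,2),
        (14,-1), (15,-1), (18,1), (20,-2), (22,3), (23,1), (26,2), (27,1), (31,-1), (32,2),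
        (33,-2), (34,-4), (35,-1)]), (2,[(14,1), (18,-1), (22,1)]), (1,[(10,-1), (34,1)]),
        (1,[(30,1)]), (1,[(14,1), (18,-1), (22,-1), (26,-1), (34,1)]), (1,[(9,1), (21,-1)]),
        (2,[(7,-1), (9,-2), (15,1), (20,2), (22,-2), (23,-1), (27,-1), (31,1), (32,-2), (33,2),
        (34,2), (35,1)]), (2,[(7,1), (15,-1), (23,-1), (27,1), (31,-1), (35,1)]), (2,[(7,-1),
        (9,2), (11,-2), (14,1), (15,1), (18,-1), (20,-2), (22,1), (23,3), (27,1), (31,1),
        (33,-2), (35,1)]), (2,[(7,-1), (11,2), (15,1), (23,-1), (27,-1), (31,1), (35,-1)]),
        (1,[(11,1), (35,-1)]), (1,[(31,1)]), (1,[(7,-1), (15,1), (23,1), (31,1)]), (1,[(9,1),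
        (21,-1), (33,-1)]), (2,[(14,1), (18,-1), (22,-1)]), (2,[(9,-2), (14,-1), (18,1),
        (20,2), (22,-1), (23,-2), (33,2)])]"])
    code_simp

lemma independent4_1111_2111: "independent4 [1,1,1,1] [2,1,1,1]"
  by (rule check_independent4[where pts = "[[[1,0],[1,0],[1,0],[1,0]],[[1,1],[1,1],[1,0],[1,1]],[[1,0],[1,-1],[1,1],[1,1]],[[1,1],[1,0],[1,2],[1,0]]]" and
      cert = "[(1,[(0,1), (3,-1), (5,1), (6,1), (7,-2), (9,-4), (10,-1), (15,-5), (16,-1), (17,4),
        (18,1), (19,1), (21,-1), (22,-1), (23,7)]), (2,[(8,2), (9,-2), (10,-1), (15,-1),
        (16,-2), (17,2), (18,1), (23,1)]), (1,[(4,1), (5,-1), (6,-1), (7,1), (20,-1), (21,1),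
        (22,1), (23,-1)]), (1,[(2,1), (3,-1), (6,1), (7,-1), (10,-2), (15,-2), (18,1), (19,1),
        (22,-1), (23,3)]), (1,[(1,1), (3,-1), (5,1), (7,-1), (9,-4), (15,-4), (17,3), (19,1),
        (21,-1), (23,5)]), (2,[(9,4), (15,4), (17,-2), (19,-1), (20,2), (21,-2), (22,-1),
        (23,-2)]), (1,[(9,-1), (15,-1), (17,1), (23,1)]), (2,[(17,-2), (19,1), (21,2),
        (23,-1)]), (1,[(23,1)]), (2,[(20,-2), (21,2), (22,1), (23,-1)]), (1,[(3,1), (5,-1),
        (6,-1), (7,2), (9,2), (15,2), (17,-2), (19,-1), (21,1), (22,1), (23,-4)]), (1,[(15,-1),
        (23,1)]), (1,[(3,1), (7,1), (19,-1), (23,-1)]), (1,[(5,1), (7,-1), (9,-2), (15,-2),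
        (17,2), (21,-1), (23,3)]), (1,[(6,1), (7,-1), (22,-1), (23,1)]), (2,[(10,2), (15,2),
        (16,2), (17,-2), (18,-2), (19,1), (20,-2), (21,2), (22,1), (23,-4)]), (2,[(10,-1),
        (15,-1), (18,1), (23,1)]), (2,[(22,1), (23,-1)]), (1,[(16,-2), (17,2), (18,1), (19,-1),
        (20,2), (21,-2), (22,-1), (23,1)]), (2,[(19,1), (23,-1)])]"])
    code_simp

lemma independent4_1112_1111: "independent4 [1,1,1,2] [1,1,1,1]"
  by (rule check_independent4[where pts = "[[[1,0],[1,0],[1,0],[1,0,0]],[[1,1],[1,1],[1,1],[1,1,0]],[[1,2],[1,0],[1,1],[1,1,1]],[[1,2],[1,1],[1,0],[1,0,1]]]" and
      cert = "[(2,[(0,2), (4,-2), (7,-2), (8,-2), (9,-2), (10,4), (11,2), (14,-1), (15,-1), (16,1),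
        (17,1), (18,-1), (19,1), (20,2), (21,2), (22,-2), (23,-2)]), (1,[(12,1), (14,-1),
        (15,-1), (17,1), (18,-1), (20,1), (21,1), (23,-1)]), (2,[(6,2), (7,-2), (8,-2), (9,-2),
        (10,2), (11,2), (18,-1), (19,1), (20,1), (21,1), (22,-1), (23,-1)]), (2,[(3,2), (4,-2),
        (9,-2), (10,2), (15,-1), (16,1), (21,1), (22,-1)]), (2,[(1,2), (4,-2), (7,-2), (10,2),
        (13,-1), (16,1), (19,1), (22,-1)]), (2,[(2,2), (5,-2), (8,-2), (11,2), (14,-1), (17,1),
        (20,1), (23,-1)]), (1,[(4,2), (5,-2), (7,2), (9,1), (10,-4), (11,3), (16,-1), (17,1),
        (19,-1), (22,2), (23,-2)]), (1,[(9,-1), (11,1), (21,1), (23,-1)]), (1,[(4,-2), (5,2),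
        (10,2), (11,-2), (16,1), (17,-1), (22,-1), (23,1)]), (1,[(7,-2), (10,2), (19,1),
        (22,-1)]), (1,[(9,-2), (10,2), (21,1), (22,-1)]), (1,[(11,2), (23,-1)]), (2,[(4,-2),
        (5,4), (9,2), (11,-6), (13,1), (15,1), (17,-2), (19,-1), (21,-3), (22,2), (23,4)]),
        (1,[(5,-2), (11,2), (17,1), (23,-1)]), (1,[(9,1), (10,-1), (11,-1), (21,-1), (22,1),
        (23,1)]), (2,[(13,-1), (16,1), (19,1), (22,-1)]), (2,[(15,-1), (16,1), (21,1),
        (22,-1)]), (2,[(4,2), (5,-2), (10,-2), (11,2), (15,-1), (16,-1), (17,2), (21,1),
        (22,1), (23,-2)]), (2,[(7,-2), (8,2), (9,-2), (10,4), (11,-2), (13,-1), (14,1), (16,1),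
        (17,-1), (18,1), (19,2), (20,-2), (21,1), (22,-4), (23,2)]), (1,[(8,-2), (11,2),
        (20,1), (23,-1)]), (2,[(13,1), (14,-1), (16,-1), (17,1), (19,-1), (20,1), (22,1),
        (23,-1)]), (1,[(9,-1), (10,1), (21,1), (22,-1)]), (1,[(7,-1), (10,1), (19,1),
        (22,-1)]), (2,[(7,2), (10,-2), (18,-1), (19,-1), (20,1), (21,1), (22,1), (23,-1)])]"])
    code_simp

lemma independent4_11111_11111: "independent4 [1,1,1,1,1] [1,1,1,1,1]"
  by (rule check_independent4[where pts = "[[[1,0],[1,0],[1,0],[1,0],[1,0]],[[1,1],[1,1],[1,1],[1,0],[1,1]],[[1,1],[1,-1],[1,1],[1,1],[1,2]],[[1,0],[1,1],[1,0],[1,-1],[1,1]]]" and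
      cert = "[(1,[(0,1), (3,1), (5,-1), (6,-1), (9,-1), (10,1), (11,-2), (13,1), (14,-1), (15,2),
        (18,8), (19,-8), (20,-1), (21,1), (22,-7), (23,7)]), (1,[(16,1), (17,-1), (18,-1),
        (19,1), (20,-1), (21,1), (22,1), (23,-1)]), (1,[(8,1), (9,-1), (10,1), (11,-1),
        (12,-1), (13,1), (14,-1), (15,1), (18,2), (19,-2), (22,-2), (23,2)]), (1,[(4,1),
        (5,-1), (6,-1), (7,1), (20,-1), (21,1), (22,1), (23,-1)]), (1,[(2,1), (3,-1), (6,-1),
        (7,1), (10,-1), (11,1), (14,1), (15,-1), (18,-2), (19,2), (22,2), (23,-2)]), (1,[(1,1),
        (3,1), (5,-1), (7,-1), (9,-1), (11,-1), (13,1), (15,1), (18,8), (19,-8), (22,-8),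
        (23,8)]), (2,[(5,2), (6,6), (7,-5), (12,-1), (13,1), (14,3), (15,-2), (17,2), (18,8),
        (19,-6), (20,3), (21,-5), (22,-15), (23,11)]), (1,[(5,-1), (6,-4), (7,3), (21,1),
        (22,4), (23,-3)]), (1,[(5,-1), (7,1), (12,2), (13,-1), (14,-2), (15,1), (20,-2),
        (21,2), (22,2), (23,-2)]), (1,[(17,-1), (18,-4), (19,3), (21,1), (22,4), (23,-3)]),
        (2,[(6,-2), (7,1), (14,2), (15,-1), (22,4), (23,-2)]), (2,[(12,-1), (13,1), (14,1),
        (15,-1), (20,-1), (21,1), (22,1), (23,-1)]), (2,[(7,1), (12,1), (13,-1), (14,-3),
        (15,2), (18,-2), (19,2), (20,-1), (21,1), (22,3), (23,-3)]), (1,[(6,1), (7,-1),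
        (22,-1), (23,1)]), (1,[(6,-1), (7,1), (14,-1), (15,1)]), (1,[(18,1), (19,-1), (22,-1),
        (23,1)]), (2,[(12,-1), (13,1), (14,1), (15,-1), (20,1), (21,-1), (22,-1), (23,1)]),
        (2,[(6,-2), (7,1), (14,2), (15,-1)]), (1,[(3,-1), (6,-2), (7,2), (9,1), (10,-1),
        (11,2), (13,-1), (14,1), (15,-2), (17,-1), (18,-11), (19,10), (21,1), (22,13),
        (23,-11)]), (1,[(18,-2), (19,1), (22,2), (23,-1)]), (1,[(3,1), (7,-1), (11,-1), (15,1),
        (18,4), (19,-4), (22,-4), (23,4)]), (1,[(6,-2), (7,1), (22,2), (23,-1)]), (1,[(9,1),
        (11,1), (13,-1), (15,-1), (17,-1), (18,-8), (19,7), (21,1), (22,8), (23,-7)]),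
        (1,[(10,1), (11,-1), (14,-1), (15,1), (18,1), (19,-1), (22,-1), (23,1)])]"])
    code_simp

text \<open>There are ten plane cubics. The ten selected jets are all nine at the first three points
  and one derivative at the fourth.\<close>

lemma complete4_2_3: "complete4 [2] [3]"
  by (rule check_complete4[where pts = "[[[1,0,0]],[[1,1,0]],[[1,0,1]],[[1,1,1]]]" and
      fs = "[(0, None), (0, Some (0, 1)), (0, Some (0, 2)), (1, None), (1, Some (0, 1)), (1, Some
        (0, 2)), (2, None), (2, Some (0, 1)), (2, Some (0, 2)), (3, Some (0, 1))]" and
      cert = "[(1,[(0,1), (3,-3), (5,-3), (6,2), (9,2)]), (2,[(1,2), (3,-4), (4,-1), (6,2), (7,1),
        (8,-1)]), (1,[(2,1), (4,-1), (5,-2), (8,1), (9,1)]), (1,[(3,3), (6,-2)]), (2,[(3,-2),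
        (4,1), (6,2), (7,-1), (8,-1)]), (1,[(4,1), (8,-1)]), (1,[(5,3), (9,-2)]), (2,[(4,1),
        (7,-1), (8,1)]), (1,[(5,-1), (9,1)]), (2,[(4,-1), (7,1), (8,1)])]"])
    code_simp

section \<open>The order on cases, along which independence ascends and absence of singular forms
  descends\<close>

definition dominated :: "nat list \<Rightarrow> nat list \<Rightarrow> nat list \<Rightarrow> nat list \<Rightarrow> bool" where
  "dominated n0 a0 n a \<longleftrightarrow> (\<exists>g. inj_on g {..<length n0} \<and> g ` {..<length n0} \<subseteq> {..<length n} \<and>
     (\<forall>i<length n0. n0 ! i \<le> n ! g i \<and> a0 ! i \<le> a ! g i))"

lemma dominated_embedding:
  assumes "dominated n0 a0 n a" "n0 \<noteq> []" "\<forall>i<length n0. a0 ! i > 0" "\<forall>i<length n. a ! i > 0"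
  obtains g where
    "block_embedding {..<length n0} ((!) n0) ((!) a0) {..<length n} ((!) n) ((!) a) g"
proof -
  obtain g where "inj_on g {..<length n0}" "g ` {..<length n0} \<subseteq> {..<length n}"
    "\<forall>i<length n0. n0 ! i \<le> n ! g i \<and> a0 ! i \<le> a ! g i"
    using assms(1) unfolding dominated_def by blast
  with assms(2-4) show thesis
    by (intro that[of g]) (auto simp: block_embedding_def)
qed

lemma dominated_trans:
  assumes "dominated n0 a0 n1 a1" "dominated n1 a1 n2 a2"
  shows "dominated n0 a0 n2 a2"
proof -
  obtain g where g: "inj_on g {..<length n0}" "g ` {..<length n0} \<subseteq> {..<length n1}"
    "\<forall>i<length n0. n0 ! i \<le> n1 ! g i \<and> a0 ! i \<le> a1 ! g i"
    using assms(1) unfolding dominated_def by blast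
  obtain h where h: "inj_on h {..<length n1}" "h ` {..<length n1} \<subseteq> {..<length n2}"
    "\<forall>i<length n1. n1 ! i \<le> n2 ! h i \<and> a1 ! i \<le> a2 ! h i"
    using assms(2) unfolding dominated_def by blast
  have "g i < length n1" if "i < length n0" for i using g(2) that by auto
  hence "n0 ! i \<le> n2 ! h (g i) \<and> a0 ! i \<le> a2 ! h (g i)" if "i < length n0" for i
    using g(3) h(3) that order_trans by metis
  moreover have "inj_on (h \<circ> g) {..<length n0}"
    using g h by (intro comp_inj_on) (auto intro: inj_on_subset)
  ultimately show ?thesis
    unfolding dominated_def using g(2) h(2) by (intro exI[of _ "h \<circ> g"]) fastforce
qed

lemma T_if_independent4:
  assumes "independent4 n0 a0" "dominated n0 a0 n a" "n0 \<noteq> []" "\<forall>i<length n0. a0 ! i > 0"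
    "n \<noteq> []" "\<forall>i<length n. a ! i > 0"
  shows "T n a 4"
proof -
  obtain g where "block_embedding {..<length n0} ((!) n0) ((!) a0) {..<length n} ((!) n) ((!) a) g"
    using assms by (elim dominated_embedding)
  from separates_extend[OF this] assms(1) obtain P
    where "separates {..<length n} ((!) n) ((!) a) 4 P"
    unfolding independent4_def by blast
  with assms(5,6) show ?thesis by (intro T_separates)
qed

lemma T_if_complete4:
  assumes "complete4 n1 a1" "dominated n a n1 a1" "\<forall>i<length n1. a1 ! i > 0"
    "n \<noteq> []" "\<forall>i<length n. a ! i > 0"
  shows "T n a 4"
proof -
  obtain g where "block_embedding {..<length n} ((!) n) ((!) a) {..<length n1} ((!) n1) ((!) a1) g"
    using assms by (elim dominated_embedding)
  from kills_restrict[OF this] assms(1) obtain P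
    where "kills {..<length n} ((!) n) ((!) a) 4 P"
    unfolding complete4_def by blast
  with assms(4,5) show ?thesis by (intro T_kills)
qed

lemma complete4_square:
  assumes "independent4 n a" and side: "n \<noteq> [] \<and> length a = length n \<and> list_all (\<lambda>x. x > 0) a \<and>
    prod_list (map2 (\<lambda>x y. (x + y) choose y) n a) = 4 * (1 + sum_list n)"
  shows "complete4 n a"
proof -
  have "(\<Prod>i<length n. (n ! i + a ! i) choose a ! i) = 4 * (1 + (\<Sum>i<length n. n ! i))"
    using side by (elim conjE) (simp add: prod.list_conv_set_nth sum_list_sum_nth lessThan_atLeast0)
  moreover have "finite {..<length n}" "{..<length n} \<noteq> {}" "\<forall>i\<in>{..<length n}. a ! i > 0"
    using side by (auto simp: list_all_length)
  moreover obtain P where "separates {..<length n} ((!) n) ((!) a) 4 P"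
    using assms(1) unfolding independent4_def by blast
  ultimately have "kills {..<length n} ((!) n) ((!) a) 4 P"
    by (intro separates_square_kills)
  thus ?thesis unfolding complete4_def by blast
qed

text \<open>The certificate involves values only: the four points are independent on the
  four-dimensional space of forms for \<open>n\<close> and \<open>a\<close>. By
  \<open>kills_linear_block\<close> this excludes singular forms after adding a block of degree one,
  whatever its dimension \<open>N\<close>.\<close>

lemma check_complete4_linear:
  assumes c: "length pts = 4 \<and> length a = length n \<and>
    check n a pts (map (\<lambda>t. (t, None)) [0..<4]) cert \<and>
    prod_list (map2 (\<lambda>x y. (x + y) choose y) n a) = 4"
  shows "complete4 (n @ [N]) (a @ [1])"
proof -
  let ?k = "length n" and ?n = "(!) (n @ [N])" and ?a = "(!) (a @ [1])"
  \<comment> \<open>In the new block all four points share the first coordinate point, which makes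
    the choice uniform in \<open>N\<close>.\<close>
  define P where "P t v = (if fst v = ?k then (if snd v = 0 then 1 else 0)
    else cert_point n (pts ! t) v)" for t v
  have la: "length a = ?k" using c by simp
  have aff: "affine {..<?k} ((!) n) (cert_point n (pts ! t))" if "t < 4" for t
    using check_affine[of n a pts _ cert t] c that by auto
  have "kills {..<Suc ?k} ?n ?a 4 P"
  proof (rule kills_linear_block[where b = ?k])
    show "?a ?k = 1" by (simp add: nth_append la)
    show "affine {..<Suc ?k} ?n (P t)" if "t < 4" for t
      using aff[OF that] by (auto simp: affine_def P_def vars_def less_Suc_eq cert_point_def nth_append)
    have "{..<Suc ?k} - {?k} = {..<?k}" by auto
    moreover have "(\<Prod>i<?k. (n ! i + a ! i) choose a ! i) = 4"
      using c by (elim conjE) (simp add: prod.list_conv_set_nth lessThan_atLeast0)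
    ultimately show "(\<Prod>i\<in>{..<Suc ?k} - {?k}. (?n i + ?a i) choose ?a i) = 4"
      by (simp add: nth_append la)
  next
    fix t :: nat assume t: "t < 4"
    have "check n a pts (map (\<lambda>t. (t, None)) [0..<4]) cert" using c by simp
    from check_dual[OF this, of t] t obtain F where F: "F \<in> forms {..<?k} ((!) n) ((!) a)"
      "\<forall>l<4. eval_poly F (cert_point n (pts ! l)) = (if t = l then 1 else 0)"
      by (auto simp: affine_jets_iff)
    have "ren id F \<in> forms {..<Suc ?k} ?n (?a(?k := 0))"
      by (rule ren_form[OF F(1)]) (auto simp: nth_append la less_Suc_eq)
    moreover have "eval_poly (ren id F) (P l) = (if l = t then 1 else 0)" if "l < 4" for l
    proof -
      have "eval_poly (ren id F) (P l) = eval_poly F (cert_point n (pts ! l))"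
        unfolding eval_ren by (rule eval_poly_cong[OF F(1)]) (auto simp: P_def vars_def)
      thus ?thesis using F(2) that by auto
    qed
    ultimately show "\<exists>G\<in>forms {..<Suc ?k} ?n (?a(?k := 0)).
        \<forall>t'<4. eval_poly G (P t') = (if t' = t then 1 else 0)" by blast
  qed simp_all
  thus ?thesis unfolding complete4_def by (intro exI[of _ P]) simp
qed

text \<open>A product of the binomial coefficients equals 4 only for linear forms on 3-space, cubic
  forms on a line and forms of degree (1, 1) on two lines; these give the three infinite
  families.\<close>

lemma complete4_3_1_linear: "complete4 ([3] @ [N]) ([1] @ [1])"
  by (rule check_complete4_linear[where pts = "[[[1, 0, 0, 0]], [[1, 1, 0, 0]], [[1, 0, 1, 0]], [[1, 0, 0, 1]]]" and
      cert = "[(1, [(0, 1), (1, -1), (2, -1), (3, -1)]), (1, [(1, 1)]), (1, [(2, 1)]), (1, [(3, 1)])]"])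
    code_simp

lemma complete4_1_3_linear: "complete4 ([1] @ [N]) ([3] @ [1])"
  by (rule check_complete4_linear[where pts = "[[[1, 0]], [[1, 1]], [[1, -1]], [[1, 2]]]" and
      cert = "[(2, [(0, 2), (1, -1), (2, -2), (3, 1)]), (2, [(1, 2), (2, 1), (3, -1)]), (6, [(1, -2),
        (2, 3), (3, -1)]), (6, [(1, -1), (3, 1)])]"])
    code_simp

lemma complete4_11_11_linear: "complete4 ([1, 1] @ [N]) ([1, 1] @ [1])"
  by (rule check_complete4_linear[where pts = "[[[1, 0], [1, 0]], [[1, 1], [1, 0]], [[1, 0], [1, 1]], [[1, 1], [1, 1]]]" and
      cert = "[(1, [(0, 1), (1, -1), (2, -1), (3, 1)]), (1, [(2, 1), (3, -1)]), (1, [(1, 1), (3,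
        -1)]), (1, [(3, 1)])]"])
    code_simp

section \<open>Cases with as many forms as conditions\<close>

lemma complete4_1_7: "complete4 [1] [7]"
  by (rule complete4_square[OF independent4_1_7]) code_simp

lemma complete4_11_15: "complete4 [1, 1] [1, 5]"
  by (rule complete4_square[OF independent4_11_15]) code_simp

lemma complete4_11_23: "complete4 [1, 1] [2, 3]"
  by (rule complete4_square[OF independent4_11_23]) code_simp

lemma complete4_13_41: "complete4 [1, 3] [4, 1]"
  by (rule complete4_square[OF independent4_13_41]) code_simp

lemma complete4_13_12: "complete4 [1, 3] [1, 2]"
  by (rule complete4_square[OF independent4_13_12]) code_simp

lemma complete4_23_21: "complete4 [2, 3] [2, 1]"
  by (rule complete4_square[OF independent4_23_21]) code_simp

lemma complete4_111_311: "complete4 [1, 1, 1] [3, 1, 1]"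
  by (rule complete4_square[OF independent4_111_311]) code_simp

lemma complete4_113_211: "complete4 [1, 1, 3] [2, 1, 1]"
  by (rule complete4_square[OF independent4_113_211]) code_simp

lemma complete4_133_111: "complete4 [1, 3, 3] [1, 1, 1]"
  by (rule complete4_square[OF independent4_133_111]) code_simp

lemma complete4_1112_1111: "complete4 [1, 1, 1, 2] [1, 1, 1, 1]"
  by (rule complete4_square[OF independent4_1112_1111]) code_simp

section \<open>Classification\<close>

definition nondefective4 :: "nat list \<Rightarrow> nat list \<Rightarrow> bool" where
  "nondefective4 n a \<longleftrightarrow>
    (\<exists>n0 a0. independent4 n0 a0 \<and> n0 \<noteq> [] \<and> (\<forall>i<length n0. a0 ! i > 0) \<and> dominated n0 a0 n a) \<or>
    (\<exists>n1 a1. complete4 n1 a1 \<and> (\<forall>i<length n1. a1 ! i > 0) \<and> dominated n a n1 a1)"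

text \<open>The list \<open>gs\<close> gives the image of each block of the smaller case; the lists
  of indices in the case distinctions below are such maps.\<close>

lemma dominated_list:
  assumes "length gs = length n0" "length a0 = length n0" "distinct gs"
    "list_all (\<lambda>(g, x, y). g < length n \<and> x \<le> n ! g \<and> y \<le> a ! g) (zip gs (zip n0 a0))"
  shows "dominated n0 a0 n a"
  unfolding dominated_def
proof (intro exI conjI)
  have "gs ! i < length n \<and> n0 ! i \<le> n ! (gs ! i) \<and> a0 ! i \<le> a ! (gs ! i)"
    if "i < length n0" for i
    using assms that by (auto simp: list_all_length)
  thus "(!) gs ` {..<length n0} \<subseteq> {..<length n}"
    "\<forall>i<length n0. n0 ! i \<le> n ! (gs ! i) \<and> a0 ! i \<le> a ! (gs ! i)" by auto
  show "inj_on ((!) gs) {..<length n0}"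
    using assms(1,3) by (auto intro!: inj_onI simp: nth_eq_iff_index_eq)
qed

lemma nondefective4_up:
  assumes "independent4 n0 a0"
    "length gs = length n0 \<and> length a0 = length n0 \<and> distinct gs \<and> n0 \<noteq> [] \<and> list_all ((<) 0) a0 \<and>
     list_all (\<lambda>(g, x, y). g < length n \<and> x \<le> n ! g \<and> y \<le> a ! g) (zip gs (zip n0 a0))"
  shows "nondefective4 n a"
proof -
  have "dominated n0 a0 n a" using assms(2) by (intro dominated_list[of gs]) auto
  moreover have "n0 \<noteq> []" "\<forall>i<length n0. a0 ! i > 0" using assms(2) by (auto simp: list_all_length)
  ultimately show ?thesis
    unfolding nondefective4_def by (intro disjI1 exI[of _ n0] exI[of _ a0] conjI assms(1))
qed

lemma nondefective4_down:
  assumes "complete4 n1 a1"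
    "length gs = length n \<and> length a = length n \<and> distinct gs \<and> length a1 = length n1 \<and>
     list_all ((<) 0) a1 \<and>
     list_all (\<lambda>(g, x, y). g < length n1 \<and> x \<le> n1 ! g \<and> y \<le> a1 ! g) (zip gs (zip n a))"
  shows "nondefective4 n a"
proof -
  have "dominated n a n1 a1" using assms(2) by (intro dominated_list[of gs]) auto
  moreover have "\<forall>i<length n1. a1 ! i > 0" using assms(2) by (auto simp: list_all_length)
  ultimately show ?thesis
    unfolding nondefective4_def by (intro disjI2 exI[of _ n1] exI[of _ a1] conjI assms(1))
qed

definition exceptional :: "nat list \<Rightarrow> nat list \<Rightarrow> bool" where
  "exceptional n a \<longleftrightarrow>
    (\<exists>m. m \<ge> 4 \<and> n = [m] \<and> a = [2]) \<or>
    (\<exists>n1 n2. 4 \<le> n1 \<and> n1 \<le> n2 \<and> n = [n1, n2] \<and> a = [1, 1]) \<or>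
    (n = [1, 2] \<and> a = [2, 2]) \<or>
    (n = [2, 2, 2] \<and> a = [1, 1, 1]) \<or>
    (\<exists>m. m \<ge> 4 \<and> n = [1, 2, m] \<and> a = [1, 1, 1]) \<or>
    (n = [2, 2, 1] \<and> a = [1, 1, 2])"

section \<open>Case distinction by the number of factors\<close>

lemma classify_1:
  assumes "x > 0" "y > 0"
  shows "exceptional [x] [y] \<or> nondefective4 [x] [y]"
proof -
  have "(x = 1 \<and> y \<le> 7) \<or>
      (x = 1 \<and> y \<ge> 8) \<or>
      (x = 2 \<and> y \<le> 3) \<or>
      (x = 2 \<and> y \<ge> 4) \<or>
      (x = 3 \<and> y \<le> 2) \<or>
      (x \<ge> 3 \<and> y \<ge> 3) \<or>
      (x \<ge> 4 \<and> y = 1) \<or>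
      (x \<ge> 4 \<and> y = 2)"
    using assms by presburger
  then consider
      (1) "x = 1 \<and> y \<le> 7"
    | (2) "x = 1 \<and> y \<ge> 8"
    | (3) "x = 2 \<and> y \<le> 3"
    | (4) "x = 2 \<and> y \<ge> 4"
    | (5) "x = 3 \<and> y \<le> 2"
    | (6) "x \<ge> 3 \<and> y \<ge> 3"
    | (7) "x \<ge> 4 \<and> y = 1"
    | (8) "x \<ge> 4 \<and> y = 2"
    by blast
  thus ?thesis
  proof cases
    case 1
    show ?thesis
      by (intro disjI2 nondefective4_down[OF complete4_1_7, of "[0]"]) (use assms 1 in simp)
  next
    case 2
    show ?thesis
      by (intro disjI2 nondefective4_up[OF independent4_1_7, of "[0]"]) (use assms 2 in simp)
  next
    case 3
    show ?thesis
      by (intro disjI2 nondefective4_down[OF complete4_2_3, of "[0]"]) (use assms 3 in simp)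
  next
    case 4
    show ?thesis
      by (intro disjI2 nondefective4_up[OF independent4_2_4, of "[0]"]) (use assms 4 in simp)
  next
    case 5
    \<comment> \<open>Quadrics on 3-space are the second block of the case \<open>[1, 3]\<close>,
      \<open>[1, 2]\<close>, where no singular form is left.\<close>
    show ?thesis
      by (intro disjI2 nondefective4_down[OF complete4_13_12, of "[1]"]) (use assms 5 in simp)
  next
    case 6
    show ?thesis
      by (intro disjI2 nondefective4_up[OF independent4_3_3, of "[0]"]) (use assms 6 in simp)
  next
    case 7
    \<comment> \<open>The block of free dimension in a linear family, taken on its own.\<close>
    show ?thesis
      by (intro disjI2 nondefective4_down[OF complete4_3_1_linear[of x], of "[1]"]) (use assms 7 in simp)
  next
    case 8
    thus ?thesis using assms by (simp add: exceptional_def)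
  qed
qed

lemma classify_2_ge3:
  assumes "x1 \<ge> 3" "x1 \<le> x2" "y1 > 0" "y2 > 0"
  shows "exceptional [x1, x2] [y1, y2] \<or> nondefective4 [x1, x2] [y1, y2]"
proof -
  from assms consider
      (1) "x1 = 3 \<and> y1 = 1 \<and> y2 = 1"
    | (2) "x1 \<ge> 4 \<and> y1 = 1 \<and> y2 = 1"
    | (3) "y2 \<ge> 2"
    | (4) "y1 \<ge> 2"
    by linarith
  thus ?thesis
  proof cases
    case 1
    show ?thesis
      by (intro disjI2 nondefective4_down[OF complete4_3_1_linear[of x2], of "[0, 1]"]) (use assms 1 in simp)
  next
    case 2
    thus ?thesis using assms by (simp add: exceptional_def)
  next
    case 3
    show ?thesis
      by (intro disjI2 nondefective4_up[OF independent4_13_12, of "[0, 1]"]) (use assms 3 in simp)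
  next
    case 4
    show ?thesis
      by (intro disjI2 nondefective4_up[OF independent4_13_12, of "[1, 0]"]) (use assms 4 in simp)
  qed
qed

text \<open>The second hypothesis is the lexicographic order of the pairs, so that for two planes
  \<open>y2\<close> is the larger degree.\<close>

lemma classify_2_eq2:
  assumes "x1 = 2" "x1 < x2 \<or> x1 = x2 \<and> y1 \<le> y2" "y1 > 0" "y2 > 0"
  shows "exceptional [x1, x2] [y1, y2] \<or> nondefective4 [x1, x2] [y1, y2]"
proof -
  have "(x2 \<ge> 3 \<and> y2 \<ge> 2) \<or>
      (x2 \<ge> 3 \<and> y1 \<ge> 2) \<or>
      (x2 \<ge> 3 \<and> y1 = 1 \<and> y2 = 1) \<or>
      (x2 = 2 \<and> y1 = 1 \<and> y2 \<le> 2) \<or>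
      (x2 = 2 \<and> y2 \<ge> 3) \<or>
      (x2 = 2 \<and> y1 \<ge> 2 \<and> y2 \<ge> 2)"
    using assms by presburger
  then consider
      (1) "x2 \<ge> 3 \<and> y2 \<ge> 2"
    | (2) "x2 \<ge> 3 \<and> y1 \<ge> 2"
    | (3) "x2 \<ge> 3 \<and> y1 = 1 \<and> y2 = 1"
    | (4) "x2 = 2 \<and> y1 = 1 \<and> y2 \<le> 2"
    | (5) "x2 = 2 \<and> y2 \<ge> 3"
    | (6) "x2 = 2 \<and> y1 \<ge> 2 \<and> y2 \<ge> 2"
    by blast
  thus ?thesis
  proof cases
    case 1
    show ?thesis
      by (intro disjI2 nondefective4_up[OF independent4_13_12, of "[0, 1]"]) (use assms 1 in simp)
  next
    case 2
    show ?thesis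
      by (intro disjI2 nondefective4_up[OF independent4_23_21, of "[0, 1]"]) (use assms 2 in simp)
  next
    case 3
    show ?thesis
      by (intro disjI2 nondefective4_down[OF complete4_3_1_linear[of x2], of "[0, 1]"]) (use assms 3 in simp)
  next
    case 4
    show ?thesis
      by (intro disjI2 nondefective4_down[OF complete4_23_21, of "[1, 0]"]) (use assms 4 in simp)
  next
    case 5
    show ?thesis
      by (intro disjI2 nondefective4_up[OF independent4_12_13, of "[0, 1]"]) (use assms 5 in simp)
  next
    case 6
    show ?thesis
      by (intro disjI2 nondefective4_up[OF independent4_22_22, of "[0, 1]"]) (use assms 6 in simp)
  qed
qed

lemma classify_2_eq11:
  assumes "x1 = 1" "x2 = 1" "y1 \<le> y2" "y1 > 0" "y2 > 0"
  shows "exceptional [x1, x2] [y1, y2] \<or> nondefective4 [x1, x2] [y1, y2]"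
proof -
  from assms consider
      (1) "y1 = 1 \<and> y2 \<le> 5"
    | (2) "y2 \<ge> 5"
    | (3) "y1 = 2 \<and> y2 \<le> 3"
    | (4) "y1 \<ge> 2 \<and> y2 \<ge> 3"
    by linarith
  thus ?thesis
  proof cases
    case 1
    show ?thesis
      by (intro disjI2 nondefective4_down[OF complete4_11_15, of "[0, 1]"]) (use assms 1 in simp)
  next
    case 2
    show ?thesis
      by (intro disjI2 nondefective4_up[OF independent4_11_15, of "[0, 1]"]) (use assms 2 in simp)
  next
    case 3
    show ?thesis
      by (intro disjI2 nondefective4_down[OF complete4_11_23, of "[0, 1]"]) (use assms 3 in simp)
  next
    case 4
    show ?thesis
      by (intro disjI2 nondefective4_up[OF independent4_11_23, of "[0, 1]"]) (use assms 4 in simp)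
  qed
qed

text \<open>On a line times a plane only degree (2, 2) lies neither below a maximal nor above a
  minimal case.\<close>

lemma classify_2_eq12:
  assumes "x1 = 1" "x2 = 2" "y1 > 0" "y2 > 0"
  shows "exceptional [x1, x2] [y1, y2] \<or> nondefective4 [x1, x2] [y1, y2]"
proof -
  have "(y2 = 1 \<and> y1 \<le> 4) \<or>
      (y1 \<ge> 5) \<or>
      (y2 = 2 \<and> y1 = 1) \<or>
      (y2 = 2 \<and> y1 = 2) \<or>
      (y2 \<ge> 2 \<and> y1 \<ge> 3) \<or>
      (y2 \<ge> 3)"
    using assms by presburger
  then consider
      (1) "y2 = 1 \<and> y1 \<le> 4"
    | (2) "y1 \<ge> 5"
    | (3) "y2 = 2 \<and> y1 = 1"
    | (4) "y2 = 2 \<and> y1 = 2"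
    | (5) "y2 \<ge> 2 \<and> y1 \<ge> 3"
    | (6) "y2 \<ge> 3"
    by blast
  thus ?thesis
  proof cases
    case 1
    show ?thesis
      by (intro disjI2 nondefective4_down[OF complete4_13_41, of "[0, 1]"]) (use assms 1 in simp)
  next
    case 2
    show ?thesis
      by (intro disjI2 nondefective4_up[OF independent4_11_15, of "[1, 0]"]) (use assms 2 in simp)
  next
    case 3
    show ?thesis
      by (intro disjI2 nondefective4_down[OF complete4_13_12, of "[0, 1]"]) (use assms 3 in simp)
  next
    case 4
    thus ?thesis using assms by (simp add: exceptional_def)
  next
    case 5
    show ?thesis
      by (intro disjI2 nondefective4_up[OF independent4_11_23, of "[1, 0]"]) (use assms 5 in simp)
  next
    case 6
    show ?thesis
      by (intro disjI2 nondefective4_up[OF independent4_12_13, of "[0, 1]"]) (use assms 6 in simp)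
  qed
qed

lemma classify_2_eq1_ge3:
  assumes "x1 = 1" "x2 \<ge> 3" "y1 > 0" "y2 > 0"
  shows "exceptional [x1, x2] [y1, y2] \<or> nondefective4 [x1, x2] [y1, y2]"
proof -
  from assms consider
      (1) "y2 = 1 \<and> y1 \<le> 3"
    | (2) "y1 \<ge> 4"
    | (3) "y2 \<ge> 2"
    by linarith
  thus ?thesis
  proof cases
    case 1
    show ?thesis
      by (intro disjI2 nondefective4_down[OF complete4_1_3_linear[of x2], of "[0, 1]"]) (use assms 1 in simp)
  next
    case 2
    show ?thesis
      by (intro disjI2 nondefective4_up[OF independent4_13_41, of "[0, 1]"]) (use assms 2 in simp)
  next
    case 3
    show ?thesis
      by (intro disjI2 nondefective4_up[OF independent4_13_12, of "[0, 1]"]) (use assms 3 in simp)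
  qed
qed

text \<open>Three planes with all degrees one lie in the gap. Enlarging one dimension leads to
  \<open>[2, 2, 3]\<close>, and raising one degree leads above \<open>[1, 1, 2]\<close> with degrees
  \<open>[1, 1, 2]\<close>.\<close>

lemma classify_3_ge2:
  assumes "x1 \<ge> 2" "x1 \<le> x2" "x2 \<le> x3" "y1 > 0" "y2 > 0" "y3 > 0"
  shows "exceptional [x1, x2, x3] [y1, y2, y3] \<or> nondefective4 [x1, x2, x3] [y1, y2, y3]"
proof -
  from assms consider
      (1) "x2 \<ge> 3"
    | (2) "x1 = 2 \<and> x2 = 2 \<and> x3 = 2 \<and> y1 = 1 \<and> y2 = 1 \<and> y3 = 1"
    | (3) "x3 \<ge> 3"
    | (4) "y1 \<ge> 2"
    | (5) "y2 \<ge> 2"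
    | (6) "y3 \<ge> 2"
    by linarith
  thus ?thesis
  proof cases
    case 1
    show ?thesis
      by (intro disjI2 nondefective4_up[OF independent4_133_111, of "[0, 1, 2]"]) (use assms 1 in simp)
  next
    case 2
    thus ?thesis using assms by (simp add: exceptional_def)
  next
    case 3
    show ?thesis
      by (intro disjI2 nondefective4_up[OF independent4_223_111, of "[0, 1, 2]"]) (use assms 3 in simp)
  next
    case 4
    show ?thesis
      by (intro disjI2 nondefective4_up[OF independent4_112_112, of "[1, 2, 0]"]) (use assms 4 in simp)
  next
    case 5
    show ?thesis
      by (intro disjI2 nondefective4_up[OF independent4_112_112, of "[0, 2, 1]"]) (use assms 5 in simp)
  next
    case 6
    show ?thesis
      by (intro disjI2 nondefective4_up[OF independent4_112_112, of "[0, 1, 2]"]) (use assms 6 in simp)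
  qed
qed

text \<open>Sorting puts the line first, while the exceptional case \<open>[2, 2, 1]\<close>,
  \<open>[1, 1, 2]\<close> lists it last; hence the rotated alternative in the conclusion.\<close>

lemma classify_3_eq12:
  assumes "x1 = 1" "x2 \<ge> 2" "x2 \<le> x3" "y1 > 0" "y2 > 0" "y3 > 0"
  shows "exceptional [x2, x3, x1] [y2, y3, y1] \<or> exceptional [x1, x2, x3] [y1, y2, y3] \<or> nondefective4 [x1, x2, x3] [y1, y2, y3]"
proof -
  have "(x2 \<ge> 3) \<or>
      (y3 \<ge> 2) \<or>
      (y2 \<ge> 2) \<or>
      (x2 = 2 \<and> x3 \<le> 3 \<and> y1 = 1 \<and> y2 = 1 \<and> y3 = 1) \<or>
      (x2 = 2 \<and> x3 = 2 \<and> y1 = 2 \<and> y2 = 1 \<and> y3 = 1) \<or>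
      (y1 \<ge> 3) \<or>
      (x3 \<ge> 3 \<and> y1 \<ge> 2) \<or>
      (x2 = 2 \<and> x3 \<ge> 4 \<and> y1 = 1 \<and> y2 = 1 \<and> y3 = 1)"
    using assms by presburger
  then consider
      (1) "x2 \<ge> 3"
    | (2) "y3 \<ge> 2"
    | (3) "y2 \<ge> 2"
    | (4) "x2 = 2 \<and> x3 \<le> 3 \<and> y1 = 1 \<and> y2 = 1 \<and> y3 = 1"
    | (5) "x2 = 2 \<and> x3 = 2 \<and> y1 = 2 \<and> y2 = 1 \<and> y3 = 1"
    | (6) "y1 \<ge> 3"
    | (7) "x3 \<ge> 3 \<and> y1 \<ge> 2"
    | (8) "x2 = 2 \<and> x3 \<ge> 4 \<and> y1 = 1 \<and> y2 = 1 \<and> y3 = 1"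
    by blast
  thus ?thesis
  proof cases
    case 1
    show ?thesis
      by (rule disjI2, rule disjI2, rule nondefective4_up[OF independent4_133_111, of "[0, 1, 2]"]) (use assms 1 in simp)
  next
    case 2
    show ?thesis
      by (rule disjI2, rule disjI2, rule nondefective4_up[OF independent4_112_112, of "[0, 1, 2]"]) (use assms 2 in simp)
  next
    case 3
    show ?thesis
      by (rule disjI2, rule disjI2, rule nondefective4_up[OF independent4_112_112, of "[0, 2, 1]"]) (use assms 3 in simp)
  next
    case 4
    show ?thesis
      by (rule disjI2, rule disjI2, rule nondefective4_down[OF complete4_133_111, of "[0, 1, 2]"]) (use assms 4 in simp)
  next
    case 5
    thus ?thesis using assms by (simp add: exceptional_def)
  next
    case 6
    show ?thesis
      by (rule disjI2, rule disjI2, rule nondefective4_up[OF independent4_111_311, of "[0, 1, 2]"]) (use assms 6 in simp)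
  next
    case 7
    show ?thesis
      by (rule disjI2, rule disjI2, rule nondefective4_up[OF independent4_113_211, of "[0, 1, 2]"]) (use assms 7 in simp)
  next
    case 8
    thus ?thesis using assms by (simp add: exceptional_def)
  qed
qed

lemma classify_3_111:
  assumes "x1 = 1" "x2 = 1" "x3 = 1" "y1 \<le> y2" "y2 \<le> y3" "y1 > 0" "y2 > 0" "y3 > 0"
  shows "exceptional [x1, x2, x3] [y1, y2, y3] \<or> nondefective4 [x1, x2, x3] [y1, y2, y3]"
proof -
  from assms consider
      (1) "y2 = 1 \<and> y3 \<le> 3"
    | (2) "y3 \<ge> 3"
    | (3) "y2 \<ge> 2"
    by linarith
  thus ?thesis
  proof cases
    case 1
    show ?thesis
      by (intro disjI2 nondefective4_down[OF complete4_111_311, of "[1, 2, 0]"]) (use assms 1 in simp)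
  next
    case 2
    show ?thesis
      by (intro disjI2 nondefective4_up[OF independent4_111_311, of "[2, 0, 1]"]) (use assms 2 in simp)
  next
    case 3
    show ?thesis
      by (intro disjI2 nondefective4_up[OF independent4_111_221, of "[1, 2, 0]"]) (use assms 3 in simp)
  qed
qed

lemma classify_3_112:
  assumes "x1 = 1" "x2 = 1" "x3 = 2" "y1 \<le> y2" "y1 > 0" "y2 > 0" "y3 > 0"
  shows "exceptional [x1, x2, x3] [y1, y2, y3] \<or> nondefective4 [x1, x2, x3] [y1, y2, y3]"
proof -
  from assms consider
      (1) "y3 \<ge> 2"
    | (2) "y1 = 1 \<and> y2 \<le> 2 \<and> y3 = 1"
    | (3) "y2 \<ge> 3"
    | (4) "y1 \<ge> 2"
    by linarith
  thus ?thesis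
  proof cases
    case 1
    show ?thesis
      by (intro disjI2 nondefective4_up[OF independent4_112_112, of "[0, 1, 2]"]) (use assms 1 in simp)
  next
    case 2
    show ?thesis
      by (intro disjI2 nondefective4_down[OF complete4_113_211, of "[1, 0, 2]"]) (use assms 2 in simp)
  next
    case 3
    show ?thesis
      by (intro disjI2 nondefective4_up[OF independent4_111_311, of "[1, 0, 2]"]) (use assms 3 in simp)
  next
    case 4
    show ?thesis
      by (intro disjI2 nondefective4_up[OF independent4_111_221, of "[0, 1, 2]"]) (use assms 4 in simp)
  qed
qed

lemma classify_3_11_ge3:
  assumes "x1 = 1" "x2 = 1" "x3 \<ge> 3" "y1 \<le> y2" "y1 > 0" "y2 > 0" "y3 > 0"
  shows "exceptional [x1, x2, x3] [y1, y2, y3] \<or> nondefective4 [x1, x2, x3] [y1, y2, y3]"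
proof -
  from assms consider
      (1) "y3 \<ge> 2"
    | (2) "y2 \<ge> 2"
    | (3) "y2 = 1 \<and> y3 = 1"
    by linarith
  thus ?thesis
  proof cases
    case 1
    show ?thesis
      by (intro disjI2 nondefective4_up[OF independent4_112_112, of "[0, 1, 2]"]) (use assms 1 in simp)
  next
    case 2
    show ?thesis
      by (intro disjI2 nondefective4_up[OF independent4_113_211, of "[1, 0, 2]"]) (use assms 2 in simp)
  next
    case 3
    show ?thesis
      by (intro disjI2 nondefective4_down[OF complete4_11_11_linear[of x3], of "[0, 1, 2]"]) (use assms 3 in simp)
  qed
qed

text \<open>By the sorting the last block has the largest dimension, and the largest degree among
  blocks of that dimension. It therefore witnesses any dimension above one or, when all blocks are
  lines, any degree above one; what remains is four lines with degrees one.\<close>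

lemma classify_4:
  assumes "list_all ((<) 0) [x1, x2, x3, x4]" "list_all ((<) 0) [y1, y2, y3, y4]"
    "sorted (zip [x1, x2, x3, x4] [y1, y2, y3, y4])"
  shows "nondefective4 [x1, x2, x3, x4] [y1, y2, y3, y4]"
proof -
  have x: "x1 \<le> x4" "x2 \<le> x4" "x3 \<le> x4"
    and y: "x1 = x4 \<Longrightarrow> y1 \<le> y4" "x2 = x4 \<Longrightarrow> y2 \<le> y4" "x3 = x4 \<Longrightarrow> y3 \<le> y4"
    using assms(3) by (auto simp: less_eq_prod_simp)
  consider (1) "x4 \<ge> 2" | (2) "x4 \<le> 1" "y4 \<ge> 2" | (3) "x4 \<le> 1" "y4 \<le> 1" by linarith
  thus ?thesis
  proof cases
    case 1
    show ?thesis
      by (rule nondefective4_up[OF independent4_1112_1111, of "[0, 1, 2, 3]"]) (use assms 1 in auto)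
  next
    case 2
    show ?thesis
      by (rule nondefective4_up[OF independent4_1111_2111, of "[3, 0, 1, 2]"]) (use assms 2 in auto)
  next
    case 3
    hence "x1 = 1 \<and> x2 = 1 \<and> x3 = 1 \<and> x4 = 1" using assms(1) x by simp
    hence "y1 \<le> 1" "y2 \<le> 1" "y3 \<le> 1" using y 3 by auto
    thus ?thesis
      using x 3
      by (intro nondefective4_down[OF complete4_1112_1111, of "[0, 1, 2, 3]"]) auto
  qed
qed

lemma classify_5:
  assumes "list_all ((<) 0) n" "list_all ((<) 0) a" "length a = length n" "length n \<ge> 5"
  shows "nondefective4 n a"
proof -
  have nz: "0 < n ! i \<and> 0 < a ! i" if "i < 5" for i
    using assms that by (simp add: list_all_length)
  have "n \<noteq> []" using assms(4) by auto
  show ?thesis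
    by (rule nondefective4_up[OF independent4_11111_11111, of "[0, 1, 2, 3, 4]"])
    (use nz[of 0] nz[of 1] nz[of 2] nz[of 3] nz[of 4] assms(3,4) \<open>n \<noteq> []\<close> in \<open>simp add: Suc_le_eq\<close>)
qed


lemma classify_sorted:
  assumes l: "length a = length n" "n \<noteq> []" and pos: "list_all ((<) 0) n" "list_all ((<) 0) a"
    and sorted: "sorted (zip n a)"
  shows "exceptional n a \<or> nondefective4 n a \<or>
    (\<exists>x1 x2 x3 y1 y2 y3. n = [x1, x2, x3] \<and> a = [y1, y2, y3] \<and>
      exceptional [x2, x3, x1] [y2, y3, y1])"
proof -
  consider "length n = 1" | "length n = 2" | "length n = 3" | "length n = 4" | "length n \<ge> 5"
  proof -
    have "length n > 0" using l(2) by simp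
    thus ?thesis using that by linarith
  qed
  thus ?thesis
  proof cases
    case 1
    then obtain x y where "n = [x]" "a = [y]"
      using l(1) by (auto simp: length_Suc_conv)
    thus ?thesis using classify_1[of x y] pos by simp
  next
    case 2
    then obtain x1 x2 y1 y2 where na: "n = [x1, x2]" "a = [y1, y2]"
      using l(1) by (auto simp: numeral_2_eq_2 length_Suc_conv)
    have *: "x1 < x2 \<or> x1 = x2 \<and> y1 \<le> y2" "x1 \<le> x2" "x1 > 0" "y1 > 0" "y2 > 0"
      using sorted pos by (auto simp: na less_eq_prod_simp)
    then consider "x1 \<ge> 3" | "x1 = 2" | "x1 = 1" "x2 = 1" "y1 \<le> y2" | "x1 = 1" "x2 = 2"
      | "x1 = 1" "x2 \<ge> 3" by linarith
    thus ?thesis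
    proof cases
      case 1
      have "exceptional n a \<or> nondefective4 n a"
        unfolding na by (rule classify_2_ge3) (use 1 * in simp_all)
      thus ?thesis by blast
    next
      case 2
      have "exceptional n a \<or> nondefective4 n a"
        unfolding na by (rule classify_2_eq2) (use 2 * in simp_all)
      thus ?thesis by blast
    next
      case 3
      have "exceptional n a \<or> nondefective4 n a"
        unfolding na by (rule classify_2_eq11) (use 3 * in simp_all)
      thus ?thesis by blast
    next
      case 4
      have "exceptional n a \<or> nondefective4 n a"
        unfolding na by (rule classify_2_eq12) (use 4 * in simp_all)
      thus ?thesis by blast
    next
      case 5
      have "exceptional n a \<or> nondefective4 n a"
        unfolding na by (rule classify_2_eq1_ge3) (use 5 * in simp_all)
      thus ?thesis by blast
    qed
  next
    case 3
    then obtain x1 x2 x3 y1 y2 y3 where na: "n = [x1, x2, x3]" "a = [y1, y2, y3]"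
      using l(1) by (auto simp: numeral_3_eq_3 length_Suc_conv)
    have *: "x1 \<le> x2" "x2 \<le> x3" "x1 > 0" "y1 > 0" "y2 > 0" "y3 > 0"
      "x1 = x2 \<longrightarrow> y1 \<le> y2" "x2 = x3 \<longrightarrow> y2 \<le> y3"
      using sorted pos by (auto simp: na less_eq_prod_simp)
    then consider "x1 \<ge> 2" | "x1 = 1" "x2 \<ge> 2" | "x1 = 1" "x2 = 1" "x3 = 1"
      | "x1 = 1" "x2 = 1" "x3 = 2" | "x1 = 1" "x2 = 1" "x3 \<ge> 3" by linarith
    thus ?thesis
    proof cases
      case 1
      have "exceptional n a \<or> nondefective4 n a"
        unfolding na by (rule classify_3_ge2) (use 1 * in simp_all)
      thus ?thesis by blast
    next
      case 2
      have "exceptional [x2, x3, x1] [y2, y3, y1] \<or> exceptional n a \<or> nondefective4 n a"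
        unfolding na by (rule classify_3_eq12) (use 2 * in simp_all)
      thus ?thesis using na by blast
    next
      case 3
      have "exceptional n a \<or> nondefective4 n a"
        unfolding na by (rule classify_3_111) (use 3 * in simp_all)
      thus ?thesis by blast
    next
      case 4
      have "exceptional n a \<or> nondefective4 n a"
        unfolding na by (rule classify_3_112) (use 4 * in simp_all)
      thus ?thesis by blast
    next
      case 5
      have "exceptional n a \<or> nondefective4 n a"
        unfolding na by (rule classify_3_11_ge3) (use 5 * in simp_all)
      thus ?thesis by blast
    qed
  next
    case 4
    then obtain x1 x2 x3 x4 y1 y2 y3 y4 where "n = [x1, x2, x3, x4]" "a = [y1, y2, y3, y4]"
      using l(1) by (auto simp: numeral_eq_Suc length_Suc_conv)
    thus ?thesis using classify_4[of x1 x2 x3 x4 y1 y2 y3 y4] pos sorted by simp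
  next
    case 5
    thus ?thesis using classify_5 l pos by blast
  qed
qed

section \<open>Passage to permuted blocks\<close>

lemma exceptional_not_T:
  assumes \<sigma>: "\<sigma> permutes {..<length n}" and l: "length a = length n"
    and a: "\<forall>i<length n. a ! i > 0"
    and exc: "exceptional (permute_list \<sigma> n) (permute_list \<sigma> a)"
  shows "\<not> T n a 4"
proof -
  let ?n = "permute_list \<sigma> n" and ?a = "permute_list \<sigma> a"
  have nth: "n ! \<sigma> i = ?n ! i" "a ! \<sigma> i = ?a ! i" if "i < length n" for i
    using permute_list_nth[of \<sigma> n i] permute_list_nth[of \<sigma> a i] \<sigma> l that by simp_all
  have inj: "\<sigma> i = \<sigma> j \<longleftrightarrow> i = j" for i j
    using permutes_inj[OF \<sigma>] by (auto dest: injD)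
  have img: "{..<length n} = \<sigma> ` {..<length n}" using permutes_image[OF \<sigma>] by simp
  have ln: "length n = length ?n" by simp
  from exc consider (1) m where "m \<ge> 4" "?n = [m]" "?a = [2]"
    | (2) n1 n2 where "4 \<le> n1" "n1 \<le> n2" "?n = [n1, n2]" "?a = [1, 1]"
    | (3) "?n = [1, 2]" "?a = [2, 2]"
    | (4) "?n = [2, 2, 2]" "?a = [1, 1, 1]"
    | (5) m where "m \<ge> 4" "?n = [1, 2, m]" "?a = [1, 1, 1]"
    | (6) "?n = [2, 2, 1]" "?a = [1, 1, 2]"
    unfolding exceptional_def by blast
  hence "excess {..<length n} ((!) n) ((!) a) 4"
  proof cases
    case 1
    have len: "length n = 1" using ln by (simp add: 1)
    obtain i1 where s: "\<sigma> 0 = i1" by blast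
    have B: "{..<length n} = {i1}"
      using img s by (auto simp: len lessThan_Suc numeral_3_eq_3 numeral_2_eq_2)
    have v: "n ! i1 = m" "a ! i1 = 2"
      using nth[of 0] s 1 len by simp_all
    show ?thesis
      unfolding B by (rule excess_quadric) (use v 1 in simp_all)
  next
    case 2
    have len: "length n = 2" using ln by (simp add: 2)
    obtain i1 i2 where s: "\<sigma> 0 = i1" "\<sigma> 1 = i2" by blast
    have B: "{..<length n} = {i1, i2}"
      using img s by (auto simp: len lessThan_Suc numeral_3_eq_3 numeral_2_eq_2)
    have v: "n ! i1 = n1" "a ! i1 = 1" "n ! i2 = n2" "a ! i2 = 1"
      using nth[of 0] nth[of 1] s 2 len by simp_all
    have ne: "i1 \<noteq> i2" using inj s by auto
    show ?thesis
      unfolding B by (rule excess_segre2) (use v ne 2 in simp_all)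
  next
    case 3
    have len: "length n = 2" using ln by (simp add: 3)
    obtain i1 i2 where s: "\<sigma> 0 = i1" "\<sigma> 1 = i2" by blast
    have B: "{..<length n} = {i1, i2}"
      using img s by (auto simp: len lessThan_Suc numeral_3_eq_3 numeral_2_eq_2)
    have v: "n ! i1 = 1" "a ! i1 = 2" "n ! i2 = 2" "a ! i2 = 2"
      using nth[of 0] nth[of 1] s 3 len by simp_all
    have ne: "i1 \<noteq> i2" using inj s by auto
    show ?thesis
      unfolding B by (rule excess_12_22) (use v ne in simp_all)
  next
    case 4
    have len: "length n = 3" using ln by (simp add: 4)
    obtain i1 i2 i3 where s: "\<sigma> 0 = i1" "\<sigma> 1 = i2" "\<sigma> 2 = i3" by blast
    have B: "{..<length n} = {i1, i2, i3}"
      using img s by (auto simp: len lessThan_Suc numeral_3_eq_3 numeral_2_eq_2)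
    have v: "n ! i1 = 2" "a ! i1 = 1" "n ! i2 = 2" "a ! i2 = 1" "n ! i3 = 2" "a ! i3 = 1"
      using nth[of 0] nth[of 1] nth[of 2] s 4 len by simp_all
    have ne: "i1 \<noteq> i2" "i1 \<noteq> i3" "i2 \<noteq> i3" using inj s by auto
    show ?thesis
      unfolding B by (rule excess_222) (use v ne in simp_all)
  next
    case 5
    have len: "length n = 3" using ln by (simp add: 5)
    obtain i1 i2 i3 where s: "\<sigma> 0 = i1" "\<sigma> 1 = i2" "\<sigma> 2 = i3" by blast
    have B: "{..<length n} = {i1, i2, i3}"
      using img s by (auto simp: len lessThan_Suc numeral_3_eq_3 numeral_2_eq_2)
    have v: "n ! i1 = 1" "a ! i1 = 1" "n ! i2 = 2" "a ! i2 = 1" "n ! i3 = m" "a ! i3 = 1"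
      using nth[of 0] nth[of 1] nth[of 2] s 5 len by simp_all
    have ne: "i1 \<noteq> i2" "i1 \<noteq> i3" "i2 \<noteq> i3" using inj s by auto
    show ?thesis
      unfolding B by (rule excess_segre_12m) (use v ne 5 in simp_all)
  next
    case 6
    have len: "length n = 3" using ln by (simp add: 6)
    obtain i1 i2 i3 where s: "\<sigma> 0 = i1" "\<sigma> 1 = i2" "\<sigma> 2 = i3" by blast
    have B: "{..<length n} = {i1, i2, i3}"
      using img s by (auto simp: len lessThan_Suc numeral_3_eq_3 numeral_2_eq_2)
    have v: "n ! i1 = 2" "a ! i1 = 1" "n ! i2 = 2" "a ! i2 = 1" "n ! i3 = 1" "a ! i3 = 2"
      using nth[of 0] nth[of 1] nth[of 2] s 6 len by simp_all
    have ne: "i1 \<noteq> i2" "i1 \<noteq> i3" "i2 \<noteq> i3" using inj s by auto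
    show ?thesis
      unfolding B by (rule excess_221_112) (use v ne in simp_all)
  qed
  moreover have "n \<noteq> []" using exc by (auto simp: exceptional_def)
  ultimately show ?thesis using a by (intro excess_not_T)
qed

text \<open>A permutation of the blocks embeds in both directions, by itself and by its inverse, so
  both monotonicity results apply to permuted lists.\<close>

lemma permute_list_dominated:
  assumes \<sigma>: "\<sigma> permutes {..<length n}" and l: "length a = length n"
  shows "dominated (permute_list \<sigma> n) (permute_list \<sigma> a) n a"
    and "dominated n a (permute_list \<sigma> n) (permute_list \<sigma> a)"
proof -
  have nth: "n ! \<sigma> i = permute_list \<sigma> n ! i" "a ! \<sigma> i = permute_list \<sigma> a ! i" if "i < length n" for i
    using permute_list_nth[of \<sigma> n i] permute_list_nth[of \<sigma> a i] \<sigma> l that by simp_all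
  show "dominated (permute_list \<sigma> n) (permute_list \<sigma> a) n a"
    unfolding dominated_def
    by (intro exI[of _ \<sigma>]) (use nth permutes_inj_on[OF \<sigma>] permutes_image[OF \<sigma>] in simp)
  have lt: "inv_into UNIV \<sigma> i < length n" if "i < length n" for i
    using permutes_in_image[OF permutes_inv[OF \<sigma>], of i] that by simp
  have "n ! i = permute_list \<sigma> n ! (inv_into UNIV \<sigma> i)" "a ! i = permute_list \<sigma> a ! (inv_into UNIV \<sigma> i)"
    if "i < length n" for i
    using nth[OF lt[OF that]] permutes_inverses(1)[OF \<sigma>] by simp_all
  thus "dominated n a (permute_list \<sigma> n) (permute_list \<sigma> a)"
    unfolding dominated_def
    by (intro exI[of _ "inv_into UNIV \<sigma>"])
      (use permutes_inj_on[OF permutes_inv[OF \<sigma>]] permutes_image[OF permutes_inv[OF \<sigma>]] in simp)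
qed

lemma nondefective4_T:
  assumes \<sigma>: "\<sigma> permutes {..<length n}" and l: "length a = length n"
    and n: "n \<noteq> []" and a: "\<forall>i<length n. a ! i > 0"
    and nd: "nondefective4 (permute_list \<sigma> n) (permute_list \<sigma> a)"
  shows "T n a 4"
  using nd unfolding nondefective4_def
proof (elim disjE exE conjE)
  fix n0 a0
  assume "independent4 n0 a0" "n0 \<noteq> []" "\<forall>i<length n0. 0 < a0 ! i"
    "dominated n0 a0 (permute_list \<sigma> n) (permute_list \<sigma> a)"
  thus ?thesis
    using dominated_trans[OF _ permute_list_dominated(1)[OF \<sigma> l]] n a
    by (intro T_if_independent4[of n0 a0]) simp_all
next
  fix n1 a1
  assume "complete4 n1 a1" "\<forall>i<length n1. 0 < a1 ! i"
    "dominated (permute_list \<sigma> n) (permute_list \<sigma> a) n1 a1"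
  thus ?thesis
    using dominated_trans[OF permute_list_dominated(2)[OF \<sigma> l]] n a
    by (intro T_if_complete4[of n1 a1]) simp_all
qed

lemma classification:
  assumes l: "length a = length n" and ne: "n \<noteq> []"
    and n: "\<forall>i<length n. n ! i > 0" and a: "\<forall>i<length n. a ! i > 0"
  shows "\<exists>\<sigma>. \<sigma> permutes {..<length n} \<and> (exceptional (permute_list \<sigma> n) (permute_list \<sigma> a) \<or>
    nondefective4 (permute_list \<sigma> n) (permute_list \<sigma> a))"
proof -
  \<comment> \<open>Sorting the zipped list yields one permutation that acts on dimensions and
    degrees simultaneously.\<close>
  have "mset (sort (zip n a)) = mset (zip n a)" by simp
  then obtain \<sigma> where "\<sigma> permutes {..<length (zip n a)}" "permute_list \<sigma> (zip n a) = sort (zip n a)"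
    by (rule mset_eq_permutation)
  hence \<sigma>: "\<sigma> permutes {..<length n}" and s: "permute_list \<sigma> (zip n a) = sort (zip n a)"
    using l by simp_all
  define n' where "n' = permute_list \<sigma> n"
  define a' where "a' = permute_list \<sigma> a"
  have len: "length a' = length n'" "length n' = length n" using l by (simp_all add: n'_def a'_def)
  have "zip n' a' = sort (zip n a)"
    unfolding n'_def a'_def s[symmetric]
    by (rule permute_list_zip[OF \<sigma> refl l[symmetric], symmetric])
  hence sorted: "sorted (zip n' a')" by simp
  have "set n' = set n" "set a' = set a"
    using set_permute_list[of \<sigma> n] set_permute_list[of \<sigma> a] \<sigma> l by (simp_all add: n'_def a'_def)
  hence pos: "list_all ((<) 0) n'" "list_all ((<) 0) a'"
    using n a l by (auto simp: list_all_iff in_set_conv_nth)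
  have ne': "n' \<noteq> []" using ne len by auto
  from classify_sorted[OF len(1) ne' pos sorted]
  consider "exceptional n' a' \<or> nondefective4 n' a'"
    | x1 x2 x3 y1 y2 y3 where "n' = [x1, x2, x3]" "a' = [y1, y2, y3]"
      "exceptional [x2, x3, x1] [y2, y3, y1]" by blast
  thus ?thesis
  proof cases
    case 1
    thus ?thesis using \<sigma> unfolding n'_def a'_def by blast
  next
    case 2
    \<comment> \<open>The rotation that moves the first block to the end, undoing the sorted order
      for two planes and a line.\<close>
    define \<rho> :: "nat \<Rightarrow> nat" where
      "\<rho> i = (if i = 0 then 1 else if i = 1 then 2 else if i = 2 then 0 else i)" for i
    have 3: "length n = 3" using len 2 by simp
    have \<rho>: "\<rho> permutes {..<3}"
    proof (rule bij_imp_permutes)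
      show "bij_betw \<rho> {..<3} {..<3}"
        by (rule bij_betw_byWitness[of _ "\<lambda>i. if i = 0 then 2 else if i = 1 then 0 else 1"])
          (auto simp: \<rho>_def)
    qed (auto simp: \<rho>_def)
    have "permute_list (\<sigma> \<circ> \<rho>) n = [x2, x3, x1]" "permute_list (\<sigma> \<circ> \<rho>) a = [y2, y3, y1]"
      using \<rho> 3 l 2(1,2) unfolding n'_def a'_def
      by (simp_all add: permute_list_compose) (simp_all add: permute_list_def \<rho>_def numeral_3_eq_3)
    moreover have "(\<sigma> \<circ> \<rho>) permutes {..<length n}"
      using permutes_compose[OF \<rho>] \<sigma> 3 by simp
    ultimately show ?thesis using 2(3) by (intro exI[of _ "\<sigma> \<circ> \<rho>"]) simp
  qed
qed

theorem theorem4p13: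
  fixes k :: nat and n a :: "nat list"
  assumes "k \<ge> 1"
    and "length n = k" and "length a = k"
    and "\<forall>i<k. n ! i > 0" and "\<forall>i<k. a ! i > 0"
  shows "\<not> T n a 4 \<longleftrightarrow>
    (\<exists>\<sigma> n' a'. \<sigma> permutes {..<k} \<and> n' = permute_list \<sigma> n \<and> a' = permute_list \<sigma> a \<and>
      ((\<exists>m. m \<ge> 4 \<and> n' = [m] \<and> a' = [2]) \<or>
       (\<exists>n1 n2. 4 \<le> n1 \<and> n1 \<le> n2 \<and> n' = [n1, n2] \<and> a' = [1, 1]) \<or>
       (n' = [1, 2] \<and> a' = [2, 2]) \<or>
       (n' = [2, 2, 2] \<and> a' = [1, 1, 1]) \<or>
       (\<exists>m. m \<ge> 4 \<and> n' = [1, 2, m] \<and> a' = [1, 1, 1]) \<or>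
       (n' = [2, 2, 1] \<and> a' = [1, 1, 2])))"
proof -
  have l: "length a = length n" and ne: "n \<noteq> []" using assms by auto
  have n: "\<forall>i<length n. n ! i > 0" and a: "\<forall>i<length n. a ! i > 0" using assms by simp_all
  have "\<not> T n a 4 \<longleftrightarrow>
      (\<exists>\<sigma>. \<sigma> permutes {..<length n} \<and> exceptional (permute_list \<sigma> n) (permute_list \<sigma> a))"
    using classification[OF l ne n a] nondefective4_T[OF _ l ne a] exceptional_not_T[OF _ l a]
    by blast
  thus ?thesis unfolding exceptional_def assms(2) by (simp only: ex_simps simp_thms)
qed

end
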